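(* Let $d\ge1$ and let $E\subset\mathbb R^d$ be compact with $\dim_{\mathcal H}(E)>\frac d2+\frac14$. Then the set $$\left\{(x-y)\cdot(z-w) : x,y,z,w\in E\right\}\subset\mathbb R$$ has nonempty interior.
   Context: $\dim_{\mathcal H}$ denotes Hausdorff dimension and $\cdot$ the Euclidean inner product on $\mathbb R^d$. *)

theory Defs
  imports "HOL-Analysis.Analysis"
begin

definition hausdorff_pre :: "real \<Rightarrow> real \<Rightarrow> 'a::metric_space set \<Rightarrow> ennreal" where
  "hausdorff_pre s \<delta> A =
     (INF U \<in> {U :: nat \<Rightarrow> 'a set. A \<subseteq> (\<Union>i. U i) \<and>
                  (\<forall>i. bounded (U i) \<and> diameter (U i) \<le> \<delta>)}.
        (\<Sum>i. ennreal (diameter (U i) powr s)))"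

definition hausdorff_measure :: "real \<Rightarrow> 'a::metric_space set \<Rightarrow> ennreal" where
  "hausdorff_measure s A = (SUP \<delta> \<in> {0<..}. hausdorff_pre s \<delta> A)"

definition hausdorff_dim :: "'a::metric_space set \<Rightarrow> real" where
  "hausdorff_dim A = Inf {s. 0 \<le> s \<and> hausdorff_measure s A = 0}"

end

theory Submission
  imports Defs "HOL-Probability.Characteristic_Functions"
begin

text \<open>
  Put \<open>d = DIM('a)\<close> and take a Frostman measure \<open>\<mu>\<close> on \<open>E\<close> of exponent \<open>s > d/2 + 1/4\<close>. Let \<open>\<nu>\<close> be the
  distribution of \<open>u \<bullet> v\<close>, \<open>u = x - y\<close>, \<open>v = z - w\<close>, under \<open>\<mu>\<^sup>4\<close> with the weight
  \<open>exp (- (|u|\<^sup>2 + |v|\<^sup>2) / 2)\<close>. Expanding \<open>exp (i t u \<bullet> v)\<close> times this weight as a Gaussian Fourier integral in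
  \<open>(\<xi>, \<eta>)\<close> turns \<open>\<integral>\<^sub>A\<^sup>B \<nu>^(t) exp (- i r t) dt\<close> into an integral of \<open>|\<mu>^(\<xi>)|\<^sup>2 |\<mu>^(\<eta>)|\<^sup>2\<close> against a
  one-dimensional oscillatory integral with phase \<open>r t + (\<xi> \<bullet> \<eta>) t / (1 + t\<^sup>2)\<close>. For \<open>r\<close> bounded away from
  \<open>0\<close> and \<open>A \<le> t \<le> 2 A\<close>, van der Corput's estimate gains \<open>A powr (- 1/2)\<close> over the trivial bound, so that
  the whole is \<open>O (A powr (d + 1/2 - 2 s))\<close>, which is summable over dyadic \<open>A\<close>. Hence \<open>\<nu>\<close> has a
  continuous density away from \<open>0\<close>. To avoid weak limits, \<open>\<mu>\<close> is replaced by finitely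
  supported measures on \<open>E\<close> that satisfy the Frostman condition down to scale \<open>2\<^sup>-\<^sup>n\<close>; all estimates are
  uniform in \<open>n\<close>. The Fejer means of \<open>\<nu>^\<close> are then bounded below on an interval of fixed length, whereas they
  tend to \<open>0\<close> at every point outside the closed set in question.
\<close>

subsection \<open>Gaussian Fourier integrals\<close>

text \<open>The Gaussian weight serves two ends. It turns the exponent into a complex quadratic form
  with an explicit inverse, and the nonnegative factor |mu^(xi)|^2 |mu^(eta)|^2 loses nothing when
  absolute values are taken. The Gaussian envelope that remains is transformed back into a Gaussian
  energy of mu at scale 1/A, which the Frostman condition bounds by A^(-s) for each of the two
  differences. Integrating trivially over t would give A^(d + 1 - 2 s), hence the threshold d/2 +
  1/2; the square root saved by oscillation lowers it to d/2 + 1/4. The saving fails at r = 0, where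
  the phase need not oscillate when xi . eta is small. So a fixed share of nu must be shown to live
  away from 0; this comes from a lower bound for its second moment. Without a limit measure, the
  place where the Fejer means are large may vary with n. Points outside the closed set are therefore
  fixed beforehand, one in each cell of a finite grid, and n is chosen last. Fejer means are
  preferred to Dirichlet integrals because their kernel is nonnegative and decays off its
  peak.\<close>

lemma borel_measurable_cis [measurable (raw)]:
  "f \<in> borel_measurable M \<Longrightarrow> (\<lambda>x. cis (f x)) \<in> borel_measurable M"
  unfolding cis_conv_exp by measurable

text \<open>A rescaling of the characteristic function of the standard normal law.\<close>

lemma gaussian_char_1d:
  fixes x \<sigma> :: real
  assumes "\<sigma> > 0"
  shows "has_bochner_integral lborel (\<lambda>t. exp (- t\<^sup>2 / (2 * \<sigma>\<^sup>2)) *\<^sub>R cis (t * x))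
           (of_real (sqrt (2 * pi) * \<sigma> * exp (- \<sigma>\<^sup>2 * x\<^sup>2 / 2)))"
proof -
  have norm: "integrable lborel std_normal_density" by simp
  have int: "integrable lborel (\<lambda>t. std_normal_density t *\<^sub>R cis (t * (\<sigma> * x)))"
    by (rule Bochner_Integration.integrable_bound[OF norm]) (auto simp: cis_conv_exp)
  have "(\<integral>t. std_normal_density t *\<^sub>R cis (t * (\<sigma> * x)) \<partial>lborel) = char std_normal_distribution (\<sigma> * x)"
    unfolding char_def
    by (subst integral_density) (auto simp: cis_conv_exp mult_ac normal_density_nonneg)
  also have "\<dots> = of_real (exp (- (\<sigma> * x)\<^sup>2 / 2))"
    by (simp add: char_std_normal_distribution)
  finally have hb: "has_bochner_integral lborel (\<lambda>t. std_normal_density t *\<^sub>R cis (t * (\<sigma> * x)))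
      (of_real (exp (- (\<sigma> * x)\<^sup>2 / 2)))"
    using int by (simp add: has_bochner_integral_iff)
  have "has_bochner_integral lborel (\<lambda>t. std_normal_density (0 + (1/\<sigma>) * t) *\<^sub>R cis ((0 + (1/\<sigma>) * t) * (\<sigma> * x)))
      (of_real (exp (- (\<sigma> * x)\<^sup>2 / 2)) /\<^sub>R \<bar>1/\<sigma>\<bar>)"
    using iffD1[OF lborel_has_bochner_integral_real_affine_iff[of "1/\<sigma>" _ _ 0] hb] assms by simp
  then have "has_bochner_integral lborel (\<lambda>t. sqrt (2 * pi) *\<^sub>R (std_normal_density (0 + (1/\<sigma>) * t) *\<^sub>R cis ((0 + (1/\<sigma>) * t) * (\<sigma> * x))))
      (sqrt (2 * pi) *\<^sub>R (of_real (exp (- (\<sigma> * x)\<^sup>2 / 2)) /\<^sub>R \<bar>1/\<sigma>\<bar>))"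
    by (intro has_bochner_integral_scaleR_right)
  then show ?thesis
    using assms by (simp add: std_normal_density_def scaleR_conv_of_real power_mult_distrib power_divide mult_ac)
qed

text \<open>Gaussian and character both factor over the coordinates, and \<open>lborel\<close> is
  the image of a product of one-dimensional Lebesgue measures.\<close>

lemma gaussian_char:
  fixes x :: "'a::euclidean_space" and \<sigma> :: real
  assumes "\<sigma> > 0"
  shows "has_bochner_integral lborel (\<lambda>\<xi>. exp (- (norm \<xi>)\<^sup>2 / (2 * \<sigma>\<^sup>2)) *\<^sub>R cis (\<xi> \<bullet> x))
           (of_real ((sqrt (2 * pi) * \<sigma>) ^ DIM('a) * exp (- \<sigma>\<^sup>2 * (norm x)\<^sup>2 / 2)))"
proof -
  interpret product_sigma_finite "\<lambda>b::'a. lborel :: real measure" ..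
  let ?f = "\<lambda>b t. exp (- t\<^sup>2 / (2 * \<sigma>\<^sup>2)) *\<^sub>R cis (t * (x \<bullet> b))"
  note one = gaussian_char_1d[OF assms, of "x \<bullet> b" for b]
  have int: "integrable lborel (?f b)" for b
    using one by (simp add: has_bochner_integral_iff) 
  have eq: "(\<Prod>b\<in>Basis. ?f b (\<xi> \<bullet> b)) = exp (- (norm \<xi>)\<^sup>2 / (2 * \<sigma>\<^sup>2)) *\<^sub>R cis (\<xi> \<bullet> x)" for \<xi>
  proof -
    have "(\<Prod>b\<in>Basis. ?f b (\<xi> \<bullet> b)) = (\<Prod>b\<in>Basis. exp (of_real (- (\<xi> \<bullet> b)\<^sup>2 / (2 * \<sigma>\<^sup>2)) + \<i> * of_real ((\<xi> \<bullet> b) * (x \<bullet> b))))"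
      by (simp only: exp_add cis_conv_exp scaleR_conv_of_real exp_of_real)
    also have "\<dots> = exp (\<Sum>b\<in>Basis. of_real (- (\<xi> \<bullet> b)\<^sup>2 / (2 * \<sigma>\<^sup>2)) + \<i> * of_real ((\<xi> \<bullet> b) * (x \<bullet> b)))"
      by (rule exp_sum[symmetric]) simp
    also have "(\<Sum>b\<in>Basis. of_real (- (\<xi> \<bullet> b)\<^sup>2 / (2 * \<sigma>\<^sup>2)) + \<i> * of_real ((\<xi> \<bullet> b) * (x \<bullet> b)))
       = of_real (- (norm \<xi>)\<^sup>2 / (2 * \<sigma>\<^sup>2)) + \<i> * of_real (\<xi> \<bullet> x)"
      unfolding power2_norm_eq_inner euclidean_inner[of \<xi> \<xi>] euclidean_inner[of \<xi> x] power2_eq_square[of "\<xi> \<bullet> _"]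
      by (simp add: sum.distrib sum_subtractf sum_distrib_left sum_divide_distrib sum_negf)
    also have "exp (of_real (- (norm \<xi>)\<^sup>2 / (2 * \<sigma>\<^sup>2)) + \<i> * of_real (\<xi> \<bullet> x)) = exp (- (norm \<xi>)\<^sup>2 / (2 * \<sigma>\<^sup>2)) *\<^sub>R cis (\<xi> \<bullet> x)"
      unfolding exp_add cis_conv_exp scaleR_conv_of_real exp_of_real ..
    finally show ?thesis .
  qed
  have eq': "?f b ((\<Sum>c\<in>Basis. g c *\<^sub>R c) \<bullet> b) = ?f b (g b)" if "b \<in> Basis" for b g
    using that by simp
  have meas: "(\<lambda>\<xi>::'a. \<Prod>b\<in>Basis. ?f b (\<xi> \<bullet> b)) \<in> borel_measurable borel"
    by measurable
  have proj: "(\<lambda>g. \<Sum>b\<in>Basis. g b *\<^sub>R b) \<in> (\<Pi>\<^sub>M b\<in>(Basis::'a set). (lborel :: real measure)) \<rightarrow>\<^sub>M borel"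
    by measurable
  have cong: "(\<lambda>g. \<Prod>b\<in>Basis. ?f b ((\<Sum>c\<in>Basis. g c *\<^sub>R c) \<bullet> b)) = (\<lambda>g. \<Prod>b\<in>Basis. ?f b (g b))"
    by (intro ext prod.cong refl eq')
  have "integrable lborel (\<lambda>\<xi>::'a. \<Prod>b\<in>Basis. ?f b (\<xi> \<bullet> b))"
    unfolding lborel_eq[where 'a='a] integrable_distr_eq[OF proj meas] cong
    by (intro product_integrable_prod int finite_Basis)
  moreover have "integral\<^sup>L lborel (\<lambda>\<xi>::'a. \<Prod>b\<in>Basis. ?f b (\<xi> \<bullet> b)) = (\<Prod>b\<in>Basis. of_real (sqrt (2 * pi) * \<sigma> * exp (- \<sigma>\<^sup>2 * (x \<bullet> b)\<^sup>2 / 2)))"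
    unfolding lborel_eq[where 'a='a] integral_distr[OF proj meas] cong product_integral_prod[OF finite_Basis int]
    by (intro prod.cong refl has_bochner_integral_integral_eq one)
  moreover have "(\<Prod>b\<in>Basis. of_real (sqrt (2 * pi) * \<sigma> * exp (- \<sigma>\<^sup>2 * (x \<bullet> b)\<^sup>2 / 2))) = 
     (of_real ((sqrt (2 * pi) * \<sigma>) ^ DIM('a) * exp (- \<sigma>\<^sup>2 * (norm x)\<^sup>2 / 2)) :: complex)"
  proof -
    have "(\<Prod>b\<in>Basis. exp (- \<sigma>\<^sup>2 * (x \<bullet> b)\<^sup>2 / 2)) = exp (\<Sum>b\<in>Basis. - \<sigma>\<^sup>2 * (x \<bullet> b)\<^sup>2 / 2)"
      by (rule exp_sum[symmetric]) simp
    also have "(\<Sum>b\<in>Basis. - \<sigma>\<^sup>2 * (x \<bullet> b)\<^sup>2 / 2) = - \<sigma>\<^sup>2 * (norm x)\<^sup>2 / 2"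
      unfolding power2_norm_eq_inner euclidean_inner[of x x] power2_eq_square[of "x \<bullet> _"]
      by (simp add: sum_distrib_left sum_divide_distrib sum_negf)
    finally show ?thesis
      by (simp only: of_real_prod[symmetric] prod.distrib prod_constant power_mult_distrib)
  qed
  ultimately show ?thesis
    unfolding eq has_bochner_integral_iff by metis
qed

lemma lborel_integral_translate:
  fixes f :: "'a::euclidean_space \<Rightarrow> 'b::{banach, second_countable_topology}"
  assumes [measurable]: "f \<in> borel_measurable borel"
  shows "(\<integral>x. f (x + c) \<partial>lborel) = (\<integral>x. f x \<partial>lborel)"
proof -
  have "(\<integral>x. f x \<partial>lborel) = (\<integral>x. f x \<partial>(distr lborel borel ((+) c)))"
    by (simp add: lborel_distr_plus)
  also have "\<dots> = (\<integral>x. f (c + x) \<partial>lborel)"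
    by (rule integral_distr) auto
  finally show ?thesis by (simp add: add.commute)
qed

lemma integrable_gaussian:
  fixes \<sigma> :: real
  assumes "\<sigma> > 0"
  shows "integrable lborel (\<lambda>\<xi>::'a::euclidean_space. exp (- (norm \<xi>)\<^sup>2 / (2 * \<sigma>\<^sup>2)))"
proof -
  have "integrable lborel (\<lambda>\<xi>::'a. norm (exp (- (norm \<xi>)\<^sup>2 / (2 * \<sigma>\<^sup>2)) *\<^sub>R cis (\<xi> \<bullet> 0)))"
    using gaussian_char[OF assms, of "0::'a"] by (intro integrable_norm) (simp add: has_bochner_integral_iff)
  then show ?thesis by simp
qed

text \<open>The form |u|^2 + |v|^2 - 2 i t (u . v) has the block matrix with rows (1, -i t) and (-i
  t, 1). Its determinant is \<open>a ^ DIM('a)\<close> and its inverse has rows (1, i t) and (i t,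
  1), divided by \<open>a\<close>. This is where the width \<open>a\<close>, the factor
  \<open>sqrt a ^ DIM('a)\<close> and the phase
  \<open>t * (fst \<zeta> \<bullet> snd \<zeta>) / a\<close> come from.\<close>

lemma bilinear_phase_representation:
  fixes u v :: "'a::euclidean_space" and t :: real
  defines "a \<equiv> 1 + t\<^sup>2"
  shows "has_bochner_integral lborel
     (\<lambda>\<zeta>. (exp (- (norm \<zeta>)\<^sup>2 / (2 * a)) / sqrt a ^ DIM('a)) *\<^sub>R cis (\<zeta> \<bullet> (u, v) - t * (fst \<zeta> \<bullet> snd \<zeta>) / a))
     (of_real ((2 * pi) ^ DIM('a) * exp (- (norm (u, v))\<^sup>2 / 2)) * cis (t * (u \<bullet> v)))"
proof -
  let ?d = "DIM('a)"
  define F :: "'a \<Rightarrow> 'a \<Rightarrow> complex" where "F = (\<lambda>\<xi> \<eta>. (exp (- (norm (\<xi>, \<eta>))\<^sup>2 / (2 * a)) / sqrt a ^ ?d) *\<^sub>R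
     cis ((\<xi>, \<eta>) \<bullet> (u, v) - t * (\<xi> \<bullet> \<eta>) / a))"
  have a: "a > 0" "sqrt a > 0" "(sqrt a)\<^sup>2 = a"
    unfolding a_def by (auto simp: add_pos_nonneg)
  have intp: "integrable (lborel \<Otimes>\<^sub>M lborel) (\<lambda>(\<xi>, \<eta>). F \<xi> \<eta>)"
  proof -
    have "integrable lborel (\<lambda>\<zeta>. (1 / sqrt a ^ ?d) * exp (- (norm (\<zeta>::'a\<times>'a))\<^sup>2 / (2 * a)))"
      using integrable_gaussian[of "sqrt a", where 'a="'a\<times>'a"] a by (intro integrable_mult_right) simp
    then show ?thesis
      unfolding lborel_prod
    proof (rule Bochner_Integration.integrable_bound)
      show "(\<lambda>(\<xi>, \<eta>). F \<xi> \<eta>) \<in> borel_measurable lborel"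
        using a by (auto simp: F_def split_beta' intro!: borel_measurable_continuous_onI continuous_intros)
    qed (use a in \<open>auto simp: F_def split_beta'\<close>)
  qed
  have inner: "(\<integral>\<xi>. F \<xi> \<eta> \<partial>lborel) = of_real (sqrt (2 * pi) ^ ?d * exp (- (norm u)\<^sup>2 / 2)) * 
      (exp (- (norm (\<eta> - t *\<^sub>R u))\<^sup>2 / 2) *\<^sub>R cis (\<eta> \<bullet> v))" for \<eta>
  proof -
    \<comment> \<open>For fixed \<eta> the phase is linear in \<xi>, with frequency
      \<open>w\<close>; the inner integral is a Gaussian Fourier transform of width
      \<open>sqrt a\<close>.\<close>
    define w where "w = u - (t / a) *\<^sub>R \<eta>"
    have "F \<xi> \<eta> = (of_real (exp (- (norm \<eta>)\<^sup>2 / (2 * a)) / sqrt a ^ ?d) * cis (\<eta> \<bullet> v)) * 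
            (exp (- (norm \<xi>)\<^sup>2 / (2 * (sqrt a)\<^sup>2)) *\<^sub>R cis (\<xi> \<bullet> w))" for \<xi>
    proof -
      have "exp (- (norm (\<xi>, \<eta>))\<^sup>2 / (2 * a)) = exp (- (norm \<eta>)\<^sup>2 / (2 * a)) * exp (- (norm \<xi>)\<^sup>2 / (2 * a))"
        by (simp add: norm_Pair exp_add[symmetric] add_divide_distrib diff_divide_distrib)
      moreover have "(\<xi>, \<eta>) \<bullet> (u, v) - t * (\<xi> \<bullet> \<eta>) / a = \<eta> \<bullet> v + \<xi> \<bullet> w"
        by (simp add: w_def inner_diff_right)
      then have "cis ((\<xi>, \<eta>) \<bullet> (u, v) - t * (\<xi> \<bullet> \<eta>) / a) = cis (\<eta> \<bullet> v) * cis (\<xi> \<bullet> w)"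
        by (simp only: cis_mult)
      ultimately show ?thesis
        unfolding F_def a(3) by (simp only: scaleR_conv_of_real of_real_mult of_real_divide times_divide_eq_left times_divide_eq_right mult_ac)
    qed
    then have "(\<integral>\<xi>. F \<xi> \<eta> \<partial>lborel) = (of_real (exp (- (norm \<eta>)\<^sup>2 / (2 * a)) / sqrt a ^ ?d) * cis (\<eta> \<bullet> v)) *
         of_real ((sqrt (2 * pi) * sqrt a) ^ DIM('a) * exp (- (sqrt a)\<^sup>2 * (norm w)\<^sup>2 / 2))"
      by (simp only: integral_mult_right_zero has_bochner_integral_integral_eq[OF gaussian_char[OF a(2), of w]])
    also have "\<dots> = of_real (sqrt (2 * pi) ^ ?d) * of_real (exp (- (norm \<eta>)\<^sup>2 / (2 * a)) * exp (- a * (norm w)\<^sup>2 / 2)) * cis (\<eta> \<bullet> v)"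
      using a by (simp add: power_mult_distrib)
    \<comment> \<open>Completing the square: |eta|^2 / a + a |w|^2 = |u|^2 + |eta - t u|^2, because
      1/a + t^2/a = 1.\<close>
    also have "exp (- (norm \<eta>)\<^sup>2 / (2 * a)) * exp (- a * (norm w)\<^sup>2 / 2) = exp (- (norm u)\<^sup>2 / 2) * exp (- (norm (\<eta> - t *\<^sub>R u))\<^sup>2 / 2)"
    proof -
      have "(norm w)\<^sup>2 = u \<bullet> u - 2 * (t / a) * (u \<bullet> \<eta>) + (t / a)\<^sup>2 * (\<eta> \<bullet> \<eta>)"
        unfolding w_def power2_norm_eq_inner
        by (simp add: inner_diff_left inner_diff_right inner_commute power2_eq_square algebra_simps)
      then have "a * (norm w)\<^sup>2 = a * (u \<bullet> u) - 2 * t * (u \<bullet> \<eta>) + t\<^sup>2 / a * (\<eta> \<bullet> \<eta>)"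
        using a(1) by (simp add: distrib_left right_diff_distrib power2_eq_square)
      moreover have "(norm (\<eta> - t *\<^sub>R u))\<^sup>2 = \<eta> \<bullet> \<eta> - 2 * t * (u \<bullet> \<eta>) + t\<^sup>2 * (u \<bullet> u)"
        unfolding power2_norm_eq_inner
        by (simp add: inner_diff_left inner_diff_right inner_commute power2_eq_square algebra_simps)
      moreover have "(\<eta> \<bullet> \<eta>) / a + t\<^sup>2 / a * (\<eta> \<bullet> \<eta>) = \<eta> \<bullet> \<eta>"
      proof -
        have "(\<eta> \<bullet> \<eta>) / a + t\<^sup>2 / a * (\<eta> \<bullet> \<eta>) = (a * (\<eta> \<bullet> \<eta>)) / a"
          by (simp add: a_def distrib_right add_divide_distrib)
        then show ?thesis using a(1) by simp
      qed
      moreover have "a * (u \<bullet> u) = u \<bullet> u + t\<^sup>2 * (u \<bullet> u)"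
        by (simp add: a_def distrib_right)
      moreover have "(norm u)\<^sup>2 = u \<bullet> u" "(norm \<eta>)\<^sup>2 / a = (\<eta> \<bullet> \<eta>) / a"
        by (simp_all add: power2_norm_eq_inner)
      ultimately have "(norm \<eta>)\<^sup>2 / a + a * (norm w)\<^sup>2 = (norm u)\<^sup>2 + (norm (\<eta> - t *\<^sub>R u))\<^sup>2"
        by linarith
      then have "- (norm \<eta>)\<^sup>2 / (2 * a) + - a * (norm w)\<^sup>2 / 2 = - (norm u)\<^sup>2 / 2 + - (norm (\<eta> - t *\<^sub>R u))\<^sup>2 / 2"
      proof -
        have "- (norm \<eta>)\<^sup>2 / (2 * a) = - ((norm \<eta>)\<^sup>2 / a) / 2" by simp
        moreover have "- a * (norm w)\<^sup>2 / 2 = - (a * (norm w)\<^sup>2) / 2" by simp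
        ultimately show ?thesis using \<open>_ = (norm u)\<^sup>2 + (norm (\<eta> - t *\<^sub>R u))\<^sup>2\<close> by argo
      qed
      then show ?thesis by (simp only: exp_add[symmetric])
    qed
    finally show ?thesis by (simp add: scaleR_conv_of_real mult_ac)
  qed
  have outer: "(\<integral>\<eta>. exp (- (norm (\<eta> - t *\<^sub>R u))\<^sup>2 / 2) *\<^sub>R cis (\<eta> \<bullet> v) \<partial>lborel)
      = of_real (sqrt (2 * pi) ^ ?d * exp (- (norm v)\<^sup>2 / 2)) * cis (t * (u \<bullet> v))"
  proof -
    \<comment> \<open>Recentring the Gaussian at \<open>t *\<^sub>R u\<close> is what releases the
      phase \<open>t * (u \<bullet> v)\<close>.\<close>
    have "(\<integral>\<eta>. exp (- (norm (\<eta> - t *\<^sub>R u))\<^sup>2 / 2) *\<^sub>R cis (\<eta> \<bullet> v) \<partial>lborel)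
       = (\<integral>\<eta>. exp (- (norm \<eta>)\<^sup>2 / 2) *\<^sub>R cis ((\<eta> + t *\<^sub>R u) \<bullet> v) \<partial>lborel)"
      by (subst lborel_integral_translate[of _ "t *\<^sub>R u", symmetric]) auto
    also have "\<dots> = (\<integral>\<eta>. cis (t * (u \<bullet> v)) * (exp (- (norm \<eta>)\<^sup>2 / (2 * 1\<^sup>2)) *\<^sub>R cis (\<eta> \<bullet> v)) \<partial>lborel)"
      by (simp add: inner_add_left cis_mult[symmetric] mult_ac)
    also have "\<dots> = cis (t * (u \<bullet> v)) * of_real ((sqrt (2 * pi) * 1) ^ DIM('a) * exp (- 1\<^sup>2 * (norm v)\<^sup>2 / 2))"
      by (simp only: integral_mult_right_zero has_bochner_integral_integral_eq[OF gaussian_char[OF zero_less_one, of v]])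
    finally show ?thesis by (simp add: mult_ac)
  qed
  have "(\<integral>\<zeta>. (\<lambda>(\<xi>, \<eta>). F \<xi> \<eta>) \<zeta> \<partial>lborel) = (\<integral>\<eta>. (\<integral>\<xi>. F \<xi> \<eta> \<partial>lborel) \<partial>lborel)"
    using lborel_pair.integral_snd[OF intp] by (simp add: lborel_prod)
  also have "\<dots> = of_real (sqrt (2 * pi) ^ ?d * exp (- (norm u)\<^sup>2 / 2)) * 
       (of_real (sqrt (2 * pi) ^ ?d * exp (- (norm v)\<^sup>2 / 2)) * cis (t * (u \<bullet> v)))"
    by (simp only: inner integral_mult_right_zero outer)
  also have "\<dots> = of_real ((sqrt (2 * pi) * sqrt (2 * pi)) ^ ?d * (exp (- (norm u)\<^sup>2 / 2) * exp (- (norm v)\<^sup>2 / 2))) * cis (t * (u \<bullet> v))"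
    by (simp only: power_mult_distrib of_real_mult mult_ac)
  also have "exp (- (norm u)\<^sup>2 / 2) * exp (- (norm v)\<^sup>2 / 2) = exp (- (norm (u, v))\<^sup>2 / 2)"
    by (simp add: norm_Pair exp_add[symmetric] add_divide_distrib diff_divide_distrib)
  also have "sqrt (2 * pi) * sqrt (2 * pi) = 2 * pi" by simp
  finally show ?thesis
    using intp unfolding has_bochner_integral_iff lborel_prod F_def split_beta' prod.collapse by blast
qed

subsection \<open>A van der Corput estimate\<close>

text \<open>
  With \<open>h = \<theta>' / (\<theta>'\<^sup>2 + \<kappa>)\<close>, the function \<open>a e\<^sup>i\<^sup>\<theta>\<close> differs from the derivative of \<open>- i a h e\<^sup>i\<^sup>\<theta>\<close> by terms of
  size \<open>|a' h|\<close> and \<open>|a| (|\<theta>''| + \<kappa>) / (\<theta>'\<^sup>2 + \<kappa>)\<close>. This covers the first and the second derivative test at once.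
\<close>

lemma oscillatory_integral_bound:
  fixes a a' \<theta> \<theta>' \<theta>'' G g :: "real \<Rightarrow> real"
  assumes AB: "A \<le> B" and lam: "\<kappa> > 0"
    and a: "\<And>t. t \<in> {A..B} \<Longrightarrow> (a has_real_derivative a' t) (at t)"
    and th: "\<And>t. t \<in> {A..B} \<Longrightarrow> (\<theta> has_real_derivative \<theta>' t) (at t)"
    and th': "\<And>t. t \<in> {A..B} \<Longrightarrow> (\<theta>' has_real_derivative \<theta>'' t) (at t)"
    and G: "\<And>t. t \<in> {A..B} \<Longrightarrow> (G has_real_derivative g t) (at t)"
    and aM: "\<And>t. t \<in> {A..B} \<Longrightarrow> \<bar>a t\<bar> \<le> M"
    and aM': "\<And>t. t \<in> {A..B} \<Longrightarrow> \<bar>a' t\<bar> \<le> M'"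
    and g: "\<And>t. t \<in> {A..B} \<Longrightarrow> (\<bar>\<theta>'' t\<bar> + \<kappa>) / ((\<theta>' t)\<^sup>2 + \<kappa>) \<le> g t"
  shows "norm (integral {A..B} (\<lambda>t. a t *\<^sub>R cis (\<theta> t)))
           \<le> M / sqrt \<kappa> + M' * (B - A) / (2 * sqrt \<kappa>) + M * (G B - G A)"
proof -
  define D where "D = (\<lambda>t. (\<theta>' t)\<^sup>2 + \<kappa>)"
  define h where "h = (\<lambda>t. \<theta>' t / D t)"
  define h' where "h' = (\<lambda>t. \<theta>'' t * (\<kappa> - (\<theta>' t)\<^sup>2) / (D t)\<^sup>2)"
  define F where "F = (\<lambda>t. (a t * h t) *\<^sub>R (- \<i> * cis (\<theta> t)))"
  define F' where "F' = (\<lambda>t. (a' t * h t + a t * h' t) *\<^sub>R (- \<i> * cis (\<theta> t)) + (a t * h t * \<theta>' t) *\<^sub>R cis (\<theta> t))"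
  have D: "D t > 0" for t unfolding D_def using lam by (simp add: add_nonneg_pos)
  have h_le: "\<bar>h t\<bar> \<le> 1 / (2 * sqrt \<kappa>)" for t
  proof -
    have "0 \<le> (\<bar>\<theta>' t\<bar> - sqrt \<kappa>)\<^sup>2" by simp
    then have "2 * sqrt \<kappa> * \<bar>\<theta>' t\<bar> \<le> D t"
      using lam by (simp add: power2_diff D_def mult_ac)
    then show ?thesis
      unfolding h_def using D[of t] lam by (simp add: abs_divide divide_simps mult_ac)
  qed
  have h_deriv: "(h has_real_derivative h' t) (at t)" if "t \<in> {A..B}" for t
    unfolding h_def h'_def D_def
    apply (rule derivative_eq_intros th'[OF that] refl)+
    using D[of t] by (auto simp: D_def divide_simps power2_eq_square algebra_simps)
  have h'_le: "\<bar>h' t\<bar> \<le> \<bar>\<theta>'' t\<bar> / D t" for t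
  proof -
    have "\<bar>\<kappa> - (\<theta>' t)\<^sup>2\<bar> \<le> D t"
      unfolding D_def using lam by (simp add: abs_if)
    then have "\<bar>\<theta>'' t\<bar> * \<bar>\<kappa> - (\<theta>' t)\<^sup>2\<bar> \<le> \<bar>\<theta>'' t\<bar> * D t"
      by (rule mult_left_mono) simp
    then have "\<bar>h' t\<bar> \<le> \<bar>\<theta>'' t\<bar> * D t / (D t)\<^sup>2"
      unfolding h'_def by (simp add: abs_mult abs_divide divide_right_mono)
    then show ?thesis using D[of t] by (simp add: power2_eq_square)
  qed
  have cis_deriv: "((\<lambda>t. cis (\<theta> t)) has_vector_derivative \<theta>' t *\<^sub>R (\<i> * cis (\<theta> t))) (at t)" if "t \<in> {A..B}" for t
  proof -
    have "(cis has_vector_derivative \<i> * cis x) (at x)" for x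
      unfolding cis_conv_exp
      by (rule has_vector_derivative_real_field[of "\<lambda>z. exp (\<i> * z)"]) (auto intro!: derivative_eq_intros)
    then have "((cis \<circ> \<theta>) has_vector_derivative \<theta>' t *\<^sub>R (\<i> * cis (\<theta> t))) (at t)"
      using th[OF that, unfolded has_real_derivative_iff_has_vector_derivative]
      by (intro vector_diff_chain_at)
    then show ?thesis by (simp add: o_def)
  qed
  have F_deriv: "(F has_vector_derivative F' t) (at t)" if t: "t \<in> {A..B}" for t
  proof -
    have "((\<lambda>t. a t * h t) has_real_derivative (a' t * h t + a t * h' t)) (at t)"
      using DERIV_mult[OF a[OF t] h_deriv[OF t]] by (simp add: algebra_simps)
    from has_vector_derivative_scaleR[OF this has_vector_derivative_mult_right[OF cis_deriv[OF t], of "- \<i>"]]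
    show ?thesis
      unfolding F_def F'_def by (simp add: scaleR_conv_of_real algebra_simps)
  qed
  have intF': "(F' has_integral (F B - F A)) {A..B}"
    by (rule fundamental_theorem_of_calculus[OF AB])
       (use F_deriv in \<open>auto intro: has_vector_derivative_at_within\<close>)
  have conta: "continuous_on {A..B} a" and contth: "continuous_on {A..B} \<theta>"
    using DERIV_isCont[OF a] DERIV_isCont[OF th] by (auto intro!: continuous_at_imp_continuous_on)
  have inta: "(\<lambda>t. a t *\<^sub>R cis (\<theta> t)) integrable_on {A..B}"
    by (intro integrable_continuous_real continuous_intros conta contth)
  \<comment> \<open>The second-derivative error enters through the increment of the primitive
    \<open>G\<close>. Bounding it by a supremum times the length of the interval would lose the
    gain.\<close>
  have intg: "((\<lambda>t. M' / (2 * sqrt \<kappa>) + M * g t) has_integral (M' * (B - A) / (2 * sqrt \<kappa>) + M * (G B - G A))) {A..B}"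
  proof (intro has_integral_add has_integral_mult_right)
    show "((\<lambda>t. M' / (2 * sqrt \<kappa>)) has_integral M' * (B - A) / (2 * sqrt \<kappa>)) {A..B}"
      using has_integral_const_real[of "M' / (2 * sqrt \<kappa>)" A B] AB by (simp add: mult_ac)
    show "(g has_integral G B - G A) {A..B}"
      by (rule fundamental_theorem_of_calculus[OF AB])
         (use G in \<open>auto intro: has_vector_derivative_at_within simp: has_real_derivative_iff_has_vector_derivative\<close>)
  qed
  have M0: "0 \<le> M" using aM[of A] AB by auto
  have ptw: "norm (a t *\<^sub>R cis (\<theta> t) - F' t) \<le> M' / (2 * sqrt \<kappa>) + M * g t" if t: "t \<in> {A..B}" for t
  proof -
    have "a t *\<^sub>R cis (\<theta> t) - F' t = (a' t * h t) *\<^sub>R (\<i> * cis (\<theta> t)) + (a t * h' t) *\<^sub>R (\<i> * cis (\<theta> t)) + (a t * (1 - h t * \<theta>' t)) *\<^sub>R cis (\<theta> t)"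
      unfolding F'_def by (simp add: scaleR_conv_of_real algebra_simps)
    then have "norm (a t *\<^sub>R cis (\<theta> t) - F' t) \<le> norm ((a' t * h t) *\<^sub>R (\<i> * cis (\<theta> t))) + norm ((a t * h' t) *\<^sub>R (\<i> * cis (\<theta> t))) + norm ((a t * (1 - h t * \<theta>' t)) *\<^sub>R cis (\<theta> t))"
      by (metis norm_triangle_ineq norm_triangle_mono order_refl)
    also have "\<dots> = \<bar>a' t\<bar> * \<bar>h t\<bar> + \<bar>a t\<bar> * (\<bar>h' t\<bar> + \<bar>1 - h t * \<theta>' t\<bar>)"
      by (simp only: norm_scaleR norm_mult norm_cis norm_ii abs_mult mult_1 mult_1_right) (simp add: algebra_simps)
    also have "\<dots> \<le> M' * (1 / (2 * sqrt \<kappa>)) + M * g t"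
    proof (intro add_mono mult_mono)
      have "1 - h t * \<theta>' t = \<kappa> / D t"
        unfolding h_def using D[of t] by (simp add: field_simps D_def power2_eq_square)
      then have "\<bar>h' t\<bar> + \<bar>1 - h t * \<theta>' t\<bar> \<le> \<bar>\<theta>'' t\<bar> / D t + \<kappa> / D t"
        using h'_le[of t] lam D[of t] by simp
      also have "\<dots> \<le> g t" using g[OF t] by (simp add: D_def add_divide_distrib)
      finally show "\<bar>h' t\<bar> + \<bar>1 - h t * \<theta>' t\<bar> \<le> g t" .
    qed (use aM[OF t] aM'[OF t] h_le[of t] M0 in auto)
    finally show ?thesis by simp
  qed
  define I where "I = integral {A..B} (\<lambda>t. a t *\<^sub>R cis (\<theta> t))"
  have "norm (integral {A..B} (\<lambda>t. a t *\<^sub>R cis (\<theta> t) - F' t)) \<le> M' * (B - A) / (2 * sqrt \<kappa>) + M * (G B - G A)"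
    using integral_norm_bound_integral[OF integrable_diff[OF inta has_integral_integrable[OF intF']] has_integral_integrable[OF intg] ptw]
    by (simp add: integral_unique[OF intg])
  moreover have "integral {A..B} (\<lambda>t. a t *\<^sub>R cis (\<theta> t) - F' t) = I - (F B - F A)"
    unfolding I_def using integral_unique[OF has_integral_diff[OF integrable_integral[OF inta] intF']] .
  ultimately have "norm (I - (F B - F A)) \<le> M' * (B - A) / (2 * sqrt \<kappa>) + M * (G B - G A)"
    by simp
  moreover have "norm (F t) \<le> M * (1 / (2 * sqrt \<kappa>))" if "t \<in> {A..B}" for t
  proof -
    have "\<bar>a t\<bar> * \<bar>h t\<bar> \<le> M * (1 / (2 * sqrt \<kappa>))"
      using aM[OF that] h_le[of t] M0 by (intro mult_mono) auto
    then show ?thesis unfolding F_def by (simp add: norm_mult abs_mult)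
  qed
  then have "norm (F B - F A) \<le> M * (1 / (2 * sqrt \<kappa>)) + M * (1 / (2 * sqrt \<kappa>))"
    using AB by (intro order_trans[OF norm_triangle_ineq4 add_mono]) auto
  then have "norm (F B - F A) \<le> M / sqrt \<kappa>"
    by (simp add: field_simps)
  ultimately show ?thesis
    unfolding I_def[symmetric] using norm_triangle_ineq2[of I "F B - F A"] by linarith
qed

text \<open>If |beta| is at most \<open>r\<^sub>1 * A\<^sup>2 / 2\<close>, the first derivative of
  the phase stays at least \<open>r\<^sub>1 / 2\<close> in size. Otherwise the second derivative is
  at least of order \<open>r\<^sub>1 / A\<close>. In both cases the integral is at most the
  amplitude times a multiple of \<open>sqrt A\<close>, uniformly in beta. For
  \<open>t \<ge> 2\<close> the second derivative keeps its sign, so the integral of |theta''| /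
  (theta'^2 + kappa) is an increment of arctan, at most pi / sqrt kappa.\<close>

lemma gaussian_phase_integral_bound:
  fixes A B r r\<^sub>1 \<beta> X :: real and d :: nat
  assumes A: "2 \<le> A" "A \<le> B" "B \<le> 2 * A" and r: "0 < r\<^sub>1" "r\<^sub>1 \<le> \<bar>r\<bar>" and X: "0 \<le> X"
  shows "norm (integral {A..B} (\<lambda>t. (exp (- X / (1 + t\<^sup>2)) / sqrt (1 + t\<^sup>2) ^ d) *\<^sub>R cis (- (r * t + \<beta> * t / (1 + t\<^sup>2)))))
     \<le> ((16 + 4 * real d + 16 * pi) / sqrt r\<^sub>1 + 1 / (16 * r\<^sub>1)) * (sqrt A * (exp (- X / (10 * A\<^sup>2)) / A ^ d))"
proof -
  define s where "s = (\<lambda>t::real. 1 + t\<^sup>2)"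
  \<comment> \<open>The power of \<open>sqrt (s t)\<close> is moved into the exponent, so that the
    derivative is \<open>a\<close> times a rational function.\<close>
  define a where "a = (\<lambda>t. exp (- X / s t - real d / 2 * ln (s t)))"
  define a' where "a' = (\<lambda>t. a t * (2 * t * X / (s t)\<^sup>2 - real d * t / s t))"
  define \<theta> where "\<theta> = (\<lambda>t. - (r * t + \<beta> * t / s t))"
  define \<theta>' where "\<theta>' = (\<lambda>t. - (r + \<beta> * (1 - t\<^sup>2) / (s t)\<^sup>2))"
  define \<theta>'' where "\<theta>'' = (\<lambda>t. - (\<beta> * (2 * t * (t\<^sup>2 - 3)) / (s t) ^ 3))"
  \<comment> \<open>For \<open>t \<ge> 2\<close> one has \<open>t\<^sup>2 > 3\<close>, so
    \<open>\<theta>''\<close> has the sign opposite to \<beta> and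
    \<open>\<sigma> * \<theta>'' t\<close> is its absolute value.\<close>
  define \<sigma> :: real where "\<sigma> = (if \<beta> \<ge> 0 then - 1 else 1)"
  \<comment> \<open>The lower bound for |theta''| when |beta| exceeds
    \<open>r\<^sub>1 * A\<^sup>2 / 2\<close>, namely
    \<open>(r\<^sub>1 * A\<^sup>2 / 2) / (4 * (2 * A) ^ 3)\<close>.\<close>
  define \<kappa> where "\<kappa> = r\<^sub>1 / (64 * A)"
  \<comment> \<open>The factor 2 absorbs \<open>\<kappa>\<close> where
    \<open>\<kappa> \<le> \<bar>\<theta>'' t\<bar>\<close>; the constant term covers the case where
    |theta'| is at least \<open>r\<^sub>1 / 2\<close>.\<close>
  define g where "g = (\<lambda>t. 2 * \<sigma> * \<theta>'' t / ((\<theta>' t)\<^sup>2 + \<kappa>) + 4 * \<kappa> / r\<^sub>1\<^sup>2)"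
  define G where "G = (\<lambda>t. 2 * \<sigma> * arctan (\<theta>' t / sqrt \<kappa>) / sqrt \<kappa> + 4 * \<kappa> / r\<^sub>1\<^sup>2 * t)"
  define M where "M = exp (- X / (10 * A\<^sup>2)) / A ^ d"
  define M' where "M' = (real d + 2) / A * M"
  have "s t > 0" for t unfolding s_def by (simp add: add_pos_nonneg)
  then have s: "s t > 0" "s t \<noteq> 0" for t by (simp_all add: less_imp_neq[symmetric])
  have s_deriv: "(s has_real_derivative 2 * t) (at t)" for t
    unfolding s_def by (auto intro!: derivative_eq_intros)
  have \<kappa>: "\<kappa> > 0" unfolding \<kappa>_def using A r by simp
  have M: "M \<ge> 0" unfolding M_def using A by simp
  have amp: "exp (- X / (1 + t\<^sup>2)) / sqrt (1 + t\<^sup>2) ^ d = a t" for t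
  proof -
    have "sqrt (s t) = exp (ln (s t) / 2)"
      using s[of t] by (simp add: powr_half_sqrt[symmetric] powr_def)
    then have "sqrt (s t) ^ d = exp (real d / 2 * ln (s t))"
      by (simp add: exp_of_nat_mult[symmetric])
    then show ?thesis by (simp add: a_def exp_diff s_def)
  qed
  have tA: "2 \<le> t" "A \<le> t" "t \<le> 2 * A" if "t \<in> {A..B}" for t using that A by auto
  have s_bounds: "t\<^sup>2 \<le> s t" "s t \<le> 5/4 * t\<^sup>2" "s t \<le> 5 * A\<^sup>2" "A\<^sup>2 \<le> s t" if "t \<in> {A..B}" for t
  proof -
    note t = tA[OF that]
    have t2: "2\<^sup>2 \<le> t\<^sup>2" "A\<^sup>2 \<le> t\<^sup>2" "t\<^sup>2 \<le> (2 * A)\<^sup>2" "2\<^sup>2 \<le> A\<^sup>2" using power_mono[of 2 t 2] power_mono[of A t 2] power_mono[of t "2 * A" 2] power_mono[of 2 A 2] t A by auto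
    then show "t\<^sup>2 \<le> s t" "s t \<le> 5/4 * t\<^sup>2" "s t \<le> 5 * A\<^sup>2" "A\<^sup>2 \<le> s t" by (auto simp: s_def power_mult_distrib)
  qed
  have a_deriv: "(a has_real_derivative a' t) (at t)" for t
  proof -
    have "((\<lambda>t. - X / s t) has_real_derivative (0 * s t - (- X) * (2 * t)) / (s t * s t)) (at t)"
      by (rule DERIV_divide[OF DERIV_const s_deriv s(2)])
    moreover have "((\<lambda>t. real d / 2 * ln (s t)) has_real_derivative real d / 2 * (inverse (s t) * (2 * t))) (at t)"
      by (rule DERIV_cmult[OF DERIV_chain2[OF DERIV_ln[OF s(1)] s_deriv]])
    ultimately have "((\<lambda>t. - X / s t - real d / 2 * ln (s t)) has_real_derivative
        (0 * s t - (- X) * (2 * t)) / (s t * s t) - real d / 2 * (inverse (s t) * (2 * t))) (at t)"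
      by (rule DERIV_diff)
    also have "(0 * s t - (- X) * (2 * t)) / (s t * s t) - real d / 2 * (inverse (s t) * (2 * t)) = 2 * t * X / (s t)\<^sup>2 - real d * t / s t"
      by (simp add: power2_eq_square inverse_eq_divide mult_ac)
    finally show ?thesis
      unfolding a_def a'_def by (rule DERIV_chain2[OF DERIV_exp])
  qed
  have \<theta>_deriv: "(\<theta> has_real_derivative \<theta>' t) (at t)" for t
  proof -
    have "((\<lambda>t. \<beta> * t / s t) has_real_derivative ((\<beta> * 1) * s t - \<beta> * t * (2 * t)) / (s t * s t)) (at t)"
      by (rule DERIV_divide[OF DERIV_cmult[OF DERIV_ident] s_deriv s(2)])
    also have "(\<beta> * 1) * s t - \<beta> * t * (2 * t) = \<beta> * (1 - t\<^sup>2)"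
      by (simp add: s_def power2_eq_square algebra_simps)
    finally have "((\<lambda>t. - (r * t + \<beta> * t / s t)) has_real_derivative - (r * 1 + \<beta> * (1 - t\<^sup>2) / (s t * s t))) (at t)"
      by (intro DERIV_minus DERIV_add DERIV_cmult DERIV_ident)
    then show ?thesis
      unfolding \<theta>_def \<theta>'_def by (simp add: power2_eq_square)
  qed
  have \<theta>'_deriv: "(\<theta>' has_real_derivative \<theta>'' t) (at t)" for t
  proof -
    have "((\<lambda>t. 1 - t\<^sup>2) has_real_derivative - (2 * t)) (at t)"
      by (auto intro!: derivative_eq_intros)
    moreover have "((\<lambda>t. (s t)\<^sup>2) has_real_derivative 2 * s t * (2 * t)) (at t)"
      using DERIV_power[OF s_deriv[of t], of 2] by (simp add: mult_ac)
    moreover have "(s t)\<^sup>2 \<noteq> 0" using s(2)[of t] by simp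
    ultimately have "((\<lambda>t. (1 - t\<^sup>2) / (s t)\<^sup>2) has_real_derivative ((- (2 * t)) * (s t)\<^sup>2 - (1 - t\<^sup>2) * (2 * s t * (2 * t))) / ((s t)\<^sup>2 * (s t)\<^sup>2)) (at t)"
      by (rule DERIV_divide)
    from DERIV_minus[OF DERIV_add[OF DERIV_const[of r] DERIV_cmult[OF this, of \<beta>]]]
    have "(\<theta>' has_real_derivative - (\<beta> * (((- (2 * t)) * (s t)\<^sup>2 - (1 - t\<^sup>2) * (2 * s t * (2 * t))) / ((s t)\<^sup>2 * (s t)\<^sup>2)))) (at t)"
      unfolding \<theta>'_def by simp
    moreover have num: "(- (2 * t)) * (s t)\<^sup>2 - (1 - t\<^sup>2) * (2 * s t * (2 * t)) = s t * (2 * t * (t\<^sup>2 - 3))"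
      by (simp add: s_def power2_eq_square algebra_simps)
    moreover have den: "(s t)\<^sup>2 * (s t)\<^sup>2 = s t * (s t) ^ 3"
      by (simp add: power2_eq_square power3_eq_cube)
    moreover have "s t * (2 * t * (t\<^sup>2 - 3)) / (s t * (s t) ^ 3) = 2 * t * (t\<^sup>2 - 3) / (s t) ^ 3"
      using s(2) by (rule nonzero_mult_divide_mult_cancel_left)
    ultimately show ?thesis
      unfolding \<theta>''_def num den by (simp only: times_divide_eq_right)
  qed
  have abs'': "\<bar>\<theta>'' t\<bar> = \<sigma> * \<theta>'' t" "\<bar>\<theta>'' t\<bar> = \<bar>\<beta>\<bar> * (2 * t * (t\<^sup>2 - 3) / (s t) ^ 3)" if "t \<in> {A..B}" for t
  proof -
    have "2\<^sup>2 \<le> t\<^sup>2" using tA[OF that] by (intro power_mono) auto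
    then have "0 \<le> 2 * t * (t\<^sup>2 - 3) / (s t) ^ 3"
      using s[of t] tA[OF that] by simp
    note nn = this
    show "\<bar>\<theta>'' t\<bar> = \<bar>\<beta>\<bar> * (2 * t * (t\<^sup>2 - 3) / (s t) ^ 3)"
      unfolding \<theta>''_def abs_minus_cancel times_divide_eq_right[symmetric, of \<beta>] abs_mult[of \<beta>] abs_of_nonneg[OF nn] ..
    then show "\<bar>\<theta>'' t\<bar> = \<sigma> * \<theta>'' t"
      by (simp add: \<sigma>_def \<theta>''_def)
  qed
  have G_deriv: "(G has_real_derivative g t) (at t)" for t
  proof -
    have "((\<lambda>t. arctan (\<theta>' t / sqrt \<kappa>)) has_real_derivative inverse (1 + (\<theta>' t / sqrt \<kappa>)\<^sup>2) * (\<theta>'' t / sqrt \<kappa>)) (at t)"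
      by (rule DERIV_chain2[OF DERIV_arctan DERIV_cdivide[OF \<theta>'_deriv]])
    from DERIV_add[OF DERIV_cmult[OF this, of "2 * \<sigma> / sqrt \<kappa>"] DERIV_cmult[OF DERIV_ident, of "4 * \<kappa> / r\<^sub>1\<^sup>2"]]
    have G1: "(G has_real_derivative 2 * \<sigma> / sqrt \<kappa> * (inverse (1 + (\<theta>' t / sqrt \<kappa>)\<^sup>2) * (\<theta>'' t / sqrt \<kappa>)) + 4 * \<kappa> / r\<^sub>1\<^sup>2 * 1) (at t)"
      unfolding G_def by simp
    have D1: "1 + (\<theta>' t / sqrt \<kappa>)\<^sup>2 = ((\<theta>' t)\<^sup>2 + \<kappa>) / (sqrt \<kappa> * sqrt \<kappa>)"
      using \<kappa> by (simp add: power_divide field_simps)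
    have cancel: "2 * \<sigma> / q * (inverse (D / (q * q)) * (y / q)) = 2 * \<sigma> * y / D" if "q \<noteq> 0" for q D y :: real
      using that by (cases "D = 0") (simp_all add: field_simps)
    have sq0: "sqrt \<kappa> \<noteq> 0" using \<kappa> by simp
    from G1 show ?thesis unfolding g_def D1 cancel[OF sq0] mult_1_right .
  qed
  have a_le: "a t \<le> exp (- X / s t) / A ^ d" if "t \<in> {A..B}" for t
  proof -
    have "A \<le> sqrt (s t)" using s_bounds(4)[OF that] by (rule real_le_rsqrt)
    then have "A ^ d \<le> sqrt (1 + t\<^sup>2) ^ d" using A unfolding s_def by (intro power_mono) auto
    then show ?thesis unfolding amp[symmetric] s_def using A s(1)[of t, unfolded s_def] by (intro divide_left_mono mult_pos_pos zero_less_power) auto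
  qed
  have expX: "exp (- X / (c * s t)) \<le> exp (- X / (c * (5 * A\<^sup>2)))" if "t \<in> {A..B}" "c > 0" for t c
  proof -
    have "X / (c * (5 * A\<^sup>2)) \<le> X / (c * s t)"
      using s_bounds[OF that(1)] s[of t] that(2) X A by (intro divide_left_mono mult_left_mono mult_pos_pos) auto
    then show ?thesis by simp
  qed
  have aM: "\<bar>a t\<bar> \<le> M" if t: "t \<in> {A..B}" for t
  proof -
    have "exp (- X / s t) \<le> exp (- X / (2 * s t))"
      using X s[of t] by (simp add: field_simps)
    also have "\<dots> \<le> exp (- X / (10 * A\<^sup>2))" using expX[OF t, of 2] by simp
    finally have "a t \<le> M"
      using a_le[OF t] A unfolding M_def by (meson divide_right_mono order_trans zero_le_power zero_le_numeral)
    then show ?thesis by (simp add: a_def)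
  qed
  have aM': "\<bar>a' t\<bar> \<le> M'" if t: "t \<in> {A..B}" for t
  proof -
    define y where "y = X / s t"
    have y: "y \<ge> 0" unfolding y_def using X s[of t] by simp
    \<comment> \<open>Differentiating the Gaussian factor produces \<open>y = X / s t\<close>. Half
      of the exponent is spent on it, which is why \<open>M\<close> has
      \<open>10 * A\<^sup>2\<close> although \<open>s t \<le> 5 * A\<^sup>2\<close>.\<close>
    have "y \<le> exp (y / 2)"
    proof -
      have "0 \<le> (y / 2 - 1)\<^sup>2" by simp
      then have "y \<le> 1 + y / 2 + (y / 2)\<^sup>2 / 2" by (simp add: power2_eq_square algebra_simps)
      also have "\<dots> \<le> exp (y / 2)" using exp_lower_Taylor_quadratic[of "y / 2"] y by simp
      finally show ?thesis .
    qed
    then have "a t * y \<le> (exp (- y) / A ^ d) * exp (y / 2)"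
      using a_le[OF t] y A by (intro mult_mono) (auto simp: y_def)
    also have "\<dots> = exp (- X / (2 * s t)) / A ^ d"
      by (simp add: y_def exp_add[symmetric])
    also have "\<dots> \<le> M"
      unfolding M_def using expX[OF t, of 2] A by (intro divide_right_mono) auto
    finally have ay: "a t * y \<le> M" .
    have ts: "0 \<le> t / s t" "t / s t \<le> 1 / A"
    proof -
      have "A * t \<le> t * t" using tA[OF t] by (intro mult_right_mono) auto
      also have "\<dots> \<le> s t" using s_bounds(1)[OF t] by (simp add: power2_eq_square)
      finally show "t / s t \<le> 1 / A" using s[of t] A by (simp add: field_simps)
      show "0 \<le> t / s t" using tA[OF t] s[of t] by simp
    qed
    have "a' t = (2 * (a t * y) - real d * a t) * (t / s t)"
      unfolding a'_def y_def by (simp add: algebra_simps power2_eq_square)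
    then have "\<bar>a' t\<bar> = \<bar>2 * (a t * y) - real d * a t\<bar> * (t / s t)"
      using ts(1) by (simp only: abs_mult abs_of_nonneg)
    also have "\<dots> \<le> ((real d + 2) * M) * (1 / A)"
    proof (intro mult_mono ts)
      have "0 \<le> a t * y" "0 \<le> real d * a t" using y by (auto simp: a_def)
      moreover have "real d * a t \<le> real d * M" using aM[OF t] by (intro mult_left_mono) auto
      ultimately show "\<bar>2 * (a t * y) - real d * a t\<bar> \<le> (real d + 2) * M"
        using ay by (simp add: algebra_simps)
    qed (use M ts in auto)
    finally show ?thesis by (simp add: M'_def mult_ac)
  qed
  have g_le: "(\<bar>\<theta>'' t\<bar> + \<kappa>) / ((\<theta>' t)\<^sup>2 + \<kappa>) \<le> g t" if t: "t \<in> {A..B}" for t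
  proof -
    have D: "(\<theta>' t)\<^sup>2 + \<kappa> > 0" using \<kappa> by (simp add: add_nonneg_pos)
    \<comment> \<open>either \<open>\<theta>'\<close> stays close to \<open>- r\<close>, or \<open>\<bar>\<theta>''\<bar> \<ge> \<kappa>\<close>\<close>
    have "\<kappa> / ((\<theta>' t)\<^sup>2 + \<kappa>) \<le> \<bar>\<theta>'' t\<bar> / ((\<theta>' t)\<^sup>2 + \<kappa>) + 4 * \<kappa> / r\<^sub>1\<^sup>2"
    proof (cases "\<bar>\<beta>\<bar> \<le> r\<^sub>1 * A\<^sup>2 / 2")
      case True
      have "2\<^sup>2 \<le> t\<^sup>2" using tA[OF t] by (intro power_mono) auto
      then have "\<bar>1 - t\<^sup>2\<bar> \<le> s t" by (auto simp: s_def)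
      then have "\<bar>\<beta> * (1 - t\<^sup>2) / (s t)\<^sup>2\<bar> \<le> \<bar>\<beta>\<bar> * s t / (s t)\<^sup>2"
        by (simp add: abs_mult divide_right_mono mult_left_mono)
      also have "\<dots> = \<bar>\<beta>\<bar> / s t" using s[of t] by (simp add: power2_eq_square)
      also have "\<dots> \<le> (r\<^sub>1 * A\<^sup>2 / 2) / A\<^sup>2"
        using True s_bounds(4)[OF t] A r by (intro frac_le) auto
      also have "\<dots> = r\<^sub>1 / 2" using A by simp
      finally have "r\<^sub>1 / 2 \<le> \<bar>\<theta>' t\<bar>" using r unfolding \<theta>'_def by linarith
      then have "(r\<^sub>1 / 2)\<^sup>2 \<le> \<bar>\<theta>' t\<bar>\<^sup>2" using r by (intro power_mono) auto
      then have "r\<^sub>1\<^sup>2 / 4 \<le> (\<theta>' t)\<^sup>2 + \<kappa>" using \<kappa> by (simp add: power_divide)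
      then have "\<kappa> / ((\<theta>' t)\<^sup>2 + \<kappa>) \<le> \<kappa> / (r\<^sub>1\<^sup>2 / 4)"
        using \<kappa> r by (intro divide_left_mono mult_pos_pos D) auto
      then have "\<kappa> / ((\<theta>' t)\<^sup>2 + \<kappa>) \<le> 4 * \<kappa> / r\<^sub>1\<^sup>2" by (simp add: mult.commute)
      moreover have "0 \<le> \<bar>\<theta>'' t\<bar> / ((\<theta>' t)\<^sup>2 + \<kappa>)" using D by simp
      ultimately show ?thesis by linarith
    next
      case False
      have t2: "2\<^sup>2 \<le> t\<^sup>2" using tA[OF t] by (intro power_mono) auto
      \<comment> \<open>The right side equals (32/125) / t^3. The next step uses
        \<open>t\<^sup>2 - 3 \<ge> t\<^sup>2 / 4\<close> and
        \<open>s t \<le> 5/4 * t\<^sup>2\<close>, both valid for \<open>t \<ge> 2\<close>.\<close>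
      have "1 / (4 * t ^ 3) \<le> 2 * t * (t\<^sup>2 / 4) / (5/4 * t\<^sup>2) ^ 3"
        using tA[OF t] by (simp add: field_simps power2_eq_square power3_eq_cube)
      also have "\<dots> \<le> 2 * t * (t\<^sup>2 - 3) / (s t) ^ 3"
        using tA[OF t] s_bounds(2)[OF t] t2 s[of t]
        by (intro frac_le mult_left_mono power_mono) auto
      finally have "1 / (4 * t ^ 3) \<le> 2 * t * (t\<^sup>2 - 3) / (s t) ^ 3" .
      moreover have "1 / (4 * (2 * A) ^ 3) \<le> 1 / (4 * t ^ 3)"
        using tA[OF t] by (intro divide_left_mono mult_left_mono power_mono mult_pos_pos) auto
      ultimately have "(r\<^sub>1 * A\<^sup>2 / 2) * (1 / (4 * (2 * A) ^ 3)) \<le> \<bar>\<beta>\<bar> * (2 * t * (t\<^sup>2 - 3) / (s t) ^ 3)"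
        using False A r by (intro mult_mono) auto
      moreover have "(r\<^sub>1 * A\<^sup>2 / 2) * (1 / (4 * (2 * A) ^ 3)) = \<kappa>"
        using A by (simp add: \<kappa>_def field_simps power2_eq_square power3_eq_cube)
      ultimately have "\<kappa> \<le> \<bar>\<theta>'' t\<bar>" using abs''(2)[OF t] by simp
      then have "\<kappa> / ((\<theta>' t)\<^sup>2 + \<kappa>) \<le> \<bar>\<theta>'' t\<bar> / ((\<theta>' t)\<^sup>2 + \<kappa>)"
        using D by (intro divide_right_mono) auto
      moreover have "0 \<le> 4 * \<kappa> / r\<^sub>1\<^sup>2" using \<kappa> by simp
      ultimately show ?thesis by linarith
    qed
    moreover have "g t = 2 * (\<bar>\<theta>'' t\<bar> / ((\<theta>' t)\<^sup>2 + \<kappa>)) + 4 * \<kappa> / r\<^sub>1\<^sup>2"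
      by (simp add: g_def abs''(1)[OF t])
    ultimately show ?thesis by (simp add: add_divide_distrib)
  qed
  have sqk: "1 / sqrt \<kappa> = 8 * sqrt A / sqrt r\<^sub>1"
    unfolding \<kappa>_def using A r real_sqrt_mult[of 64 A] by (simp add: real_sqrt_divide)
  have GBA: "G B - G A \<le> 2 * pi / sqrt \<kappa> + 1 / (16 * r\<^sub>1)"
  proof -
    have "\<sigma> * arctan x \<le> pi / 2" "- (pi / 2) \<le> \<sigma> * arctan x" for x
      using arctan_bounded[of x] by (auto simp: \<sigma>_def)
    from this(1)[of "\<theta>' B / sqrt \<kappa>"] this(2)[of "\<theta>' A / sqrt \<kappa>"]
    have "2 * (\<sigma> * arctan (\<theta>' B / sqrt \<kappa>) - \<sigma> * arctan (\<theta>' A / sqrt \<kappa>)) / sqrt \<kappa> \<le> 2 * pi / sqrt \<kappa>"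
      using \<kappa> by (intro divide_right_mono) auto
    moreover have "4 * \<kappa> / r\<^sub>1\<^sup>2 * (B - A) \<le> 4 * \<kappa> / r\<^sub>1\<^sup>2 * A"
      using A \<kappa> by (intro mult_left_mono) auto
    moreover have "4 * \<kappa> / r\<^sub>1\<^sup>2 * A = 1 / (16 * r\<^sub>1)"
      using A r by (simp add: \<kappa>_def field_simps power2_eq_square)
    ultimately show ?thesis
      unfolding G_def by (simp add: algebra_simps diff_divide_distrib)
  qed
  have "norm (integral {A..B} (\<lambda>t. a t *\<^sub>R cis (\<theta> t)))
           \<le> M / sqrt \<kappa> + M' * (B - A) / (2 * sqrt \<kappa>) + M * (G B - G A)"
    by (rule oscillatory_integral_bound[OF A(2) \<kappa> a_deriv \<theta>_deriv \<theta>'_deriv G_deriv aM aM' g_le])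
  also have "\<dots> \<le> M / sqrt \<kappa> + (real d + 2) / 2 * M * (1 / sqrt \<kappa>) + M * (2 * pi / sqrt \<kappa> + 1 / (16 * r\<^sub>1))"
  proof (intro add_mono order_refl mult_left_mono GBA M)
    have "M' * (B - A) / (2 * sqrt \<kappa>) \<le> M' * A / (2 * sqrt \<kappa>)"
      using A M \<kappa> by (intro divide_right_mono mult_left_mono) (auto simp: M'_def)
    also have "M' * A / (2 * sqrt \<kappa>) = (real d + 2) / 2 * M * (1 / sqrt \<kappa>)"
      using A by (simp add: M'_def)
    finally show "M' * (B - A) / (2 * sqrt \<kappa>) \<le> (real d + 2) / 2 * M * (1 / sqrt \<kappa>)" .
  qed
  also have "\<dots> = M * ((2 + real d / 2 + 2 * pi) * (1 / sqrt \<kappa>) + 1 / (16 * r\<^sub>1))"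
    by (simp add: algebra_simps add_divide_distrib)
  also have "\<dots> \<le> M * ((16 + 4 * real d + 16 * pi) / sqrt r\<^sub>1 * sqrt A + 1 / (16 * r\<^sub>1) * sqrt A)"
  proof (intro mult_left_mono add_mono M)
    show "(2 + real d / 2 + 2 * pi) * (1 / sqrt \<kappa>) \<le> (16 + 4 * real d + 16 * pi) / sqrt r\<^sub>1 * sqrt A"
      unfolding sqk by (simp add: algebra_simps add_divide_distrib)
    have "1 \<le> sqrt A" using A by simp
    then have "1 / (16 * r\<^sub>1) * 1 \<le> 1 / (16 * r\<^sub>1) * sqrt A"
      using r by (intro mult_left_mono) auto
    then show "1 / (16 * r\<^sub>1) \<le> 1 / (16 * r\<^sub>1) * sqrt A" by simp
  qed
  finally have bound: "norm (integral {A..B} (\<lambda>t. a t *\<^sub>R cis (\<theta> t)))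
      \<le> M * ((16 + 4 * real d + 16 * pi) / sqrt r\<^sub>1 * sqrt A + 1 / (16 * r\<^sub>1) * sqrt A)" .
  have "m * (p * u + q * u) = (p + q) * (u * m)" for m p q u :: real
    by (simp add: algebra_simps)
  from bound[unfolded this \<theta>_def s_def M_def] show ?thesis
    unfolding amp .
qed

subsection \<open>Oscillation of positive definite sums\<close>

lemma mult_swap_factors:
  fixes a b c d u v :: "'a::comm_semiring_1"
  assumes "a * b = c * d"
  shows "(u * a) * (v * b) = (u * c) * (v * d)"
proof -
  have "(u * a) * (v * b) = (u * v) * (a * b)" by (simp only: mult_ac)
  also have "\<dots> = (u * c) * (v * d)" unfolding assms by (simp only: mult_ac)
  finally show ?thesis .
qed

lemma mult_regroup_factors:
  fixes a b u v p :: "'a::comm_semiring_1"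
  shows "(u * a) * ((p * v) * b) = (p * (u * v)) * (a * b)"
  by (simp only: mult_ac)

text \<open>After the Fourier representation and Fubini the sum is an integral of
  \<open>\<Psi> \<zeta> * J \<zeta>\<close>, where \<open>J\<close> is the oscillatory integral in
  \<open>t\<close> and \<open>\<Psi>\<close> is nonnegative by \<open>pos\<close>. The Gaussian
  bound for \<open>J\<close> can therefore be integrated against \<open>\<Psi>\<close> exactly,
  giving back a Gaussian sum in \<open>Z\<close>, now at scale 1/A. The power
  \<open>A ^ DIM('a)\<close> is the volume A^(2 d) of the envelope times the factor A^(-d) from
  \<open>J\<close>.\<close>

lemma oscillatory_sum_bound:
  fixes Z :: "'k \<Rightarrow> 'a::euclidean_space \<times> 'a" and w :: "'k \<Rightarrow> real" and r r\<^sub>1 A B :: real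
  assumes fin: "finite K" and w: "\<And>k. k \<in> K \<Longrightarrow> 0 \<le> w k"
    and pos: "\<And>\<zeta>. \<exists>\<psi>\<ge>0. (\<Sum>k\<in>K. w k *\<^sub>R cis (\<zeta> \<bullet> Z k)) = of_real \<psi>"
    and A: "2 \<le> A" "A \<le> B" "B \<le> 2 * A" and r: "0 < r\<^sub>1" "r\<^sub>1 \<le> \<bar>r\<bar>"
  shows "norm (\<Sum>k\<in>K. (w k * exp (- (norm (Z k))\<^sup>2 / 2)) *\<^sub>R integral {A..B} (\<lambda>t. cis (t * (fst (Z k) \<bullet> snd (Z k) - r))))
    \<le> ((16 + 4 * real DIM('a) + 16 * pi) / sqrt r\<^sub>1 + 1 / (16 * r\<^sub>1)) * 10 ^ DIM('a) * sqrt A * A ^ DIM('a)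
        * (\<Sum>k\<in>K. w k * exp (- 5 * A\<^sup>2 * (norm (Z k))\<^sup>2))"
proof -
  let ?d = "DIM('a)"
  define C where "C = (16 + 4 * real DIM('a) + 16 * pi) / sqrt r\<^sub>1 + 1 / (16 * r\<^sub>1)"
  define \<Psi> :: "'a \<times> 'a \<Rightarrow> complex" where "\<Psi> = (\<lambda>\<zeta>. \<Sum>k\<in>K. w k *\<^sub>R cis (\<zeta> \<bullet> Z k))"
  define amp :: "real \<Rightarrow> 'a \<times> 'a \<Rightarrow> real" where "amp = (\<lambda>t \<zeta>. exp (- (norm \<zeta>)\<^sup>2 / (2 * (1 + t\<^sup>2))) / sqrt (1 + t\<^sup>2) ^ ?d)"
  define \<phi> :: "real \<Rightarrow> 'a \<times> 'a \<Rightarrow> complex" where "\<phi> = (\<lambda>t \<zeta>. amp t \<zeta> *\<^sub>R cis (- (r * t + (fst \<zeta> \<bullet> snd \<zeta>) * t / (1 + t\<^sup>2))))"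
  define f :: "real \<Rightarrow> 'a \<times> 'a \<Rightarrow> complex" where "f = (\<lambda>t \<zeta>. indicator {A..B} t *\<^sub>R (\<Psi> \<zeta> * \<phi> t \<zeta>))"
  have s: "1 + t\<^sup>2 > 0" "1 + t\<^sup>2 \<noteq> 0" "1 \<le> sqrt (1 + t\<^sup>2)" for t :: real
    by (auto simp: add_pos_nonneg) (metis add_pos_nonneg less_numeral_extra(1,3) zero_le_power2)
  have s': "2 + 2 * t\<^sup>2 \<noteq> 0" for t :: real
    using s(1)[of t] by linarith
  have cont_\<Psi>: "continuous_on UNIV \<Psi>"
    unfolding \<Psi>_def by (intro continuous_intros)
  have cont_\<phi>: "continuous_on UNIV (\<lambda>(t, \<zeta>). \<phi> t \<zeta>)"
    unfolding \<phi>_def amp_def split_beta' using s by (intro continuous_intros) (auto simp: s(2) s')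
  have norm_\<phi>: "norm (\<phi> t \<zeta>) \<le> exp (- (norm \<zeta>)\<^sup>2 / (2 * (1 + t\<^sup>2)))" for t \<zeta>
  proof -
    have "exp (- (norm \<zeta>)\<^sup>2 / (2 * (1 + t\<^sup>2))) / sqrt (1 + t\<^sup>2) ^ ?d \<le> exp (- (norm \<zeta>)\<^sup>2 / (2 * (1 + t\<^sup>2))) / 1"
      using s(3)[of t] s(1)[of t] by (intro divide_left_mono one_le_power) (auto intro!: zero_less_power)
    then show ?thesis using s[of t] by (simp add: \<phi>_def amp_def)
  qed
  define W where "W = (\<Sum>k\<in>K. w k)"
  have norm_\<Psi>: "norm (\<Psi> \<zeta>) \<le> W" for \<zeta>
    unfolding \<Psi>_def W_def using w by (intro sum_norm_le) auto
  have W0: "W \<ge> 0" unfolding W_def using w by (auto intro!: sum_nonneg)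
  have intf: "integrable (lborel \<Otimes>\<^sub>M lborel) (case_prod f)"
  proof -
    \<comment> \<open>A dominating Gaussian in all variables, \<open>t\<close> included:
      \<open>\<sigma>\<close> is the largest width on \<open>{A..B}\<close>, and the factor
      \<open>exp (B\<^sup>2 / (2 * \<sigma>\<^sup>2))\<close> pays for including
      \<open>t\<close>.\<close>
    define \<sigma> where "\<sigma> = sqrt (1 + B\<^sup>2)"
    have \<sigma>: "\<sigma> > 0" "\<sigma>\<^sup>2 = 1 + B\<^sup>2" unfolding \<sigma>_def using s[of B] by auto
    have "integrable lborel (\<lambda>p::real\<times>'a\<times>'a. (W * exp (B\<^sup>2 / (2 * \<sigma>\<^sup>2))) * exp (- (norm p)\<^sup>2 / (2 * \<sigma>\<^sup>2)))"
      by (intro integrable_mult_right integrable_gaussian \<sigma>)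
    then show ?thesis
      unfolding lborel_prod
    proof (rule Bochner_Integration.integrable_bound)
      have [measurable]: "(\<lambda>(t, \<zeta>). \<Psi> \<zeta> * \<phi> t \<zeta>) \<in> borel_measurable borel"
        using cont_\<phi> continuous_on_compose2[OF cont_\<Psi> continuous_on_snd[OF continuous_on_id], of UNIV]
        unfolding split_beta'
        by (intro borel_measurable_continuous_onI continuous_on_mult) auto
      have [measurable]: "(\<lambda>p::real\<times>'a\<times>'a. indicator {A..B} (fst p) :: real) \<in> borel_measurable borel"
        by (intro measurable_compose[OF borel_measurable_continuous_onI[OF continuous_on_fst[OF continuous_on_id]]]) auto
      have "(\<lambda>p. indicator {A..B} (fst p) *\<^sub>R (\<lambda>(t, \<zeta>). \<Psi> \<zeta> * \<phi> t \<zeta>) p) \<in> borel_measurable borel"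
        by measurable
      then show "case_prod f \<in> borel_measurable lborel"
        by (simp add: f_def split_beta')
      show "AE p in lborel. norm (case_prod f p) \<le> norm ((W * exp (B\<^sup>2 / (2 * \<sigma>\<^sup>2))) * exp (- (norm p)\<^sup>2 / (2 * \<sigma>\<^sup>2)))"
      proof (intro AE_I2, clarify)
        fix t :: real and \<xi> \<eta> :: 'a
        let ?\<zeta> = "(\<xi>, \<eta>)"
        show "norm (f t ?\<zeta>) \<le> norm ((W * exp (B\<^sup>2 / (2 * \<sigma>\<^sup>2))) * exp (- (norm (t, ?\<zeta>))\<^sup>2 / (2 * \<sigma>\<^sup>2)))"
        proof (cases "t \<in> {A..B}")
          case True
          have t2: "t\<^sup>2 \<le> B\<^sup>2" using True A by (intro power_mono) auto
          have "norm (f t ?\<zeta>) \<le> W * exp (- (norm ?\<zeta>)\<^sup>2 / (2 * (1 + t\<^sup>2)))"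
            using True norm_\<phi>[of t ?\<zeta>] norm_\<Psi>[of ?\<zeta>] W0 by (auto simp: f_def norm_mult intro!: mult_mono)
          also have "\<dots> \<le> W * exp (- (norm ?\<zeta>)\<^sup>2 / (2 * \<sigma>\<^sup>2))"
          proof (intro mult_left_mono W0)
            have "(norm ?\<zeta>)\<^sup>2 / (2 * \<sigma>\<^sup>2) \<le> (norm ?\<zeta>)\<^sup>2 / (2 * (1 + t\<^sup>2))"
              using t2 \<sigma> s[of t] by (intro divide_left_mono) auto
            then show "exp (- (norm ?\<zeta>)\<^sup>2 / (2 * (1 + t\<^sup>2))) \<le> exp (- (norm ?\<zeta>)\<^sup>2 / (2 * \<sigma>\<^sup>2))"
              by simp
          qed
          also have "\<dots> \<le> W * (exp (B\<^sup>2 / (2 * \<sigma>\<^sup>2)) * exp (- (norm (t, ?\<zeta>))\<^sup>2 / (2 * \<sigma>\<^sup>2)))"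
          proof (intro mult_left_mono W0)
            have "(norm (t, ?\<zeta>))\<^sup>2 = t\<^sup>2 + (norm ?\<zeta>)\<^sup>2" by (simp add: norm_Pair)
            then have "- (norm ?\<zeta>)\<^sup>2 \<le> B\<^sup>2 - (norm (t, ?\<zeta>))\<^sup>2" using t2 by simp
            then have "- (norm ?\<zeta>)\<^sup>2 / (2 * \<sigma>\<^sup>2) \<le> (B\<^sup>2 - (norm (t, ?\<zeta>))\<^sup>2) / (2 * \<sigma>\<^sup>2)"
              using \<sigma> by (intro divide_right_mono) auto
            then show "exp (- (norm ?\<zeta>)\<^sup>2 / (2 * \<sigma>\<^sup>2)) \<le> exp (B\<^sup>2 / (2 * \<sigma>\<^sup>2)) * exp (- (norm (t, ?\<zeta>))\<^sup>2 / (2 * \<sigma>\<^sup>2))"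
              by (simp add: exp_add[symmetric] diff_divide_distrib)
          qed
          finally show ?thesis using W0 by (simp add: abs_mult mult_ac)
        qed (simp add: f_def)
      qed
    qed
  qed
  have inner_\<zeta>: "(\<integral>\<zeta>. f t \<zeta> \<partial>lborel) = indicator {A..B} t *\<^sub>R (\<Sum>k\<in>K. of_real ((2 * pi) ^ ?d * (w k * exp (- (norm (Z k))\<^sup>2 / 2))) * cis (t * (fst (Z k) \<bullet> snd (Z k) - r)))" for t
  proof -
    have "has_bochner_integral lborel (\<lambda>\<zeta>. \<Sum>k\<in>K. (of_real (w k) * cis (- (r * t))) * 
           ((exp (- (norm \<zeta>)\<^sup>2 / (2 * (1 + t\<^sup>2))) / sqrt (1 + t\<^sup>2) ^ ?d) *\<^sub>R cis (\<zeta> \<bullet> (fst (Z k), snd (Z k)) - t * (fst \<zeta> \<bullet> snd \<zeta>) / (1 + t\<^sup>2))))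
      (\<Sum>k\<in>K. (of_real (w k) * cis (- (r * t))) * (of_real ((2 * pi) ^ ?d * exp (- (norm (fst (Z k), snd (Z k)))\<^sup>2 / 2)) * cis (t * (fst (Z k) \<bullet> snd (Z k)))))"
      by (intro has_bochner_integral_sum has_bochner_integral_mult_right bilinear_phase_representation)
    moreover have "(\<Sum>k\<in>K. (of_real (w k) * cis (- (r * t))) * 
           ((exp (- (norm \<zeta>)\<^sup>2 / (2 * (1 + t\<^sup>2))) / sqrt (1 + t\<^sup>2) ^ ?d) *\<^sub>R cis (\<zeta> \<bullet> (fst (Z k), snd (Z k)) - t * (fst \<zeta> \<bullet> snd \<zeta>) / (1 + t\<^sup>2))))
        = \<Psi> \<zeta> * \<phi> t \<zeta>" for \<zeta>
    proof -
      have phase: "cis (- (r * t)) * cis (\<zeta> \<bullet> Z k - t * (fst \<zeta> \<bullet> snd \<zeta>) / (1 + t\<^sup>2)) = cis (\<zeta> \<bullet> Z k) * cis (- (r * t + (fst \<zeta> \<bullet> snd \<zeta>) * t / (1 + t\<^sup>2)))" for k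
        unfolding cis_mult by (rule arg_cong[of _ _ cis]) (simp add: mult.commute)
      show ?thesis
        unfolding \<Psi>_def \<phi>_def amp_def sum_distrib_right prod.collapse scaleR_conv_of_real
        by (intro sum.cong refl mult_swap_factors phase)
    qed
    moreover have "(\<Sum>k\<in>K. (of_real (w k) * cis (- (r * t))) * (of_real ((2 * pi) ^ ?d * exp (- (norm (fst (Z k), snd (Z k)))\<^sup>2 / 2)) * cis (t * (fst (Z k) \<bullet> snd (Z k)))))
       = (\<Sum>k\<in>K. of_real ((2 * pi) ^ ?d * (w k * exp (- (norm (Z k))\<^sup>2 / 2))) * cis (t * (fst (Z k) \<bullet> snd (Z k) - r)))"
    proof (intro sum.cong refl)
      fix k
      have "cis (- (r * t)) * cis (t * (fst (Z k) \<bullet> snd (Z k))) = cis (t * (fst (Z k) \<bullet> snd (Z k) - r))"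
        unfolding cis_mult by (rule arg_cong[of _ _ cis]) (simp add: algebra_simps)
      then show "(of_real (w k) * cis (- (r * t))) * (of_real ((2 * pi) ^ ?d * exp (- (norm (fst (Z k), snd (Z k)))\<^sup>2 / 2)) * cis (t * (fst (Z k) \<bullet> snd (Z k))))
         = of_real ((2 * pi) ^ ?d * (w k * exp (- (norm (Z k))\<^sup>2 / 2))) * cis (t * (fst (Z k) \<bullet> snd (Z k) - r))"
        unfolding prod.collapse of_real_mult
        by (subst mult_regroup_factors) (simp only:)
    qed
    ultimately have "has_bochner_integral lborel (\<lambda>\<zeta>. \<Psi> \<zeta> * \<phi> t \<zeta>) 
        (\<Sum>k\<in>K. of_real ((2 * pi) ^ ?d * (w k * exp (- (norm (Z k))\<^sup>2 / 2))) * cis (t * (fst (Z k) \<bullet> snd (Z k) - r)))"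
      by (simp only:)
    then show ?thesis
      unfolding f_def by (simp only: integral_scaleR_right has_bochner_integral_integral_eq)
  qed
  define J :: "'a \<times> 'a \<Rightarrow> complex" where "J = (\<lambda>\<zeta>. integral {A..B} (\<lambda>t. \<phi> t \<zeta>))"
  have set_int: "set_integrable lborel {A..B} (\<lambda>t. \<phi> t \<zeta>)" for \<zeta>
    using continuous_on_compose2[OF cont_\<phi> continuous_on_Pair[OF continuous_on_id continuous_on_const] subset_UNIV, of "{A..B}" \<zeta>]
    by (intro borel_integrable_atLeastAtMost') simp
  have inner_t: "(\<integral>t. f t \<zeta> \<partial>lborel) = \<Psi> \<zeta> * J \<zeta>" for \<zeta>
  proof -
    have "(\<integral>t. f t \<zeta> \<partial>lborel) = (\<integral>t. \<Psi> \<zeta> * (indicator {A..B} t *\<^sub>R \<phi> t \<zeta>) \<partial>lborel)"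
      by (simp add: f_def)
    also have "\<dots> = \<Psi> \<zeta> * (\<integral>t. indicator {A..B} t *\<^sub>R \<phi> t \<zeta> \<partial>lborel)"
      by (rule integral_mult_right_zero)
    also have "(\<integral>t. indicator {A..B} t *\<^sub>R \<phi> t \<zeta> \<partial>lborel) = J \<zeta>"
      using set_borel_integral_eq_integral(2)[OF set_int] unfolding set_lebesgue_integral_def J_def .
    finally show ?thesis .
  qed
  have norm_J: "norm (J \<zeta>) \<le> C * (sqrt A / A ^ ?d * exp (- (norm \<zeta>)\<^sup>2 / (2 * (sqrt 10 * A)\<^sup>2)))" for \<zeta>
  proof -
    have "norm (J \<zeta>) \<le> C * (sqrt A * (exp (- ((norm \<zeta>)\<^sup>2 / 2) / (10 * A\<^sup>2)) / A ^ ?d))"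
      using gaussian_phase_integral_bound[OF A r, of "(norm \<zeta>)\<^sup>2 / 2" ?d "fst \<zeta> \<bullet> snd \<zeta>"]
      unfolding J_def \<phi>_def amp_def C_def by simp
    then show ?thesis by (simp add: power_mult_distrib)
  qed
  have C0: "C \<ge> 0" unfolding C_def using r by simp
  \<comment> \<open>The width of the envelope of \<open>J\<close>; its transform is
    \<open>exp (- \<sigma>\<^sup>2 * (norm (Z k))\<^sup>2 / 2)\<close>, whence the 5 in the
    conclusion.\<close>
  define \<sigma> where "\<sigma> = sqrt 10 * A"
  have \<sigma>: "\<sigma> > 0" "\<sigma>\<^sup>2 = 10 * A\<^sup>2" unfolding \<sigma>_def using A by (auto simp: power_mult_distrib)
  have hbg: "has_bochner_integral lborel (\<lambda>\<zeta>. \<Sum>k\<in>K. of_real (w k) * (exp (- (norm \<zeta>)\<^sup>2 / (2 * \<sigma>\<^sup>2)) *\<^sub>R cis (\<zeta> \<bullet> Z k)))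
       (\<Sum>k\<in>K. of_real (w k) * of_real ((sqrt (2 * pi) * \<sigma>) ^ DIM('a \<times> 'a) * exp (- \<sigma>\<^sup>2 * (norm (Z k))\<^sup>2 / 2)) :: complex)"
    by (intro has_bochner_integral_sum has_bochner_integral_mult_right gaussian_char \<sigma>)
  define S where "S = (\<Sum>k\<in>K. w k * exp (- 5 * A\<^sup>2 * (norm (Z k))\<^sup>2))"
  have val: "(\<Sum>k\<in>K. of_real (w k) * of_real ((sqrt (2 * pi) * \<sigma>) ^ DIM('a \<times> 'a) * exp (- \<sigma>\<^sup>2 * (norm (Z k))\<^sup>2 / 2)) :: complex)
       = of_real ((2 * pi) ^ ?d * 10 ^ ?d * A ^ ?d * A ^ ?d * S)"
  proof -
    have "DIM('a \<times> 'a) = 2 * ?d" by simp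
    then have "(sqrt (2 * pi) * \<sigma>) ^ DIM('a \<times> 'a) = ((sqrt (2 * pi) * \<sigma>)\<^sup>2) ^ ?d"
      by (simp only: power_mult)
    also have "(sqrt (2 * pi) * \<sigma>)\<^sup>2 = (2 * pi) * 10 * A * A"
      by (simp add: power_mult_distrib \<sigma> power2_eq_square[of A])
    also have "\<dots> ^ ?d = (2 * pi) ^ ?d * 10 ^ ?d * A ^ ?d * A ^ ?d"
      by (simp only: power_mult_distrib)
    finally show ?thesis
      unfolding S_def sum_distrib_left of_real_sum
      by (simp add: \<sigma> mult_ac)
  qed
  \<comment> \<open>The one use of positivity: since \<open>norm (\<Psi> \<zeta>)\<close> is
    \<open>\<Psi> \<zeta>\<close>, it is still a sum of characters and can be integrated term by
    term.\<close>
  have gauss_\<Psi>: "(\<Sum>k\<in>K. of_real (w k) * (exp (- (norm \<zeta>)\<^sup>2 / (2 * \<sigma>\<^sup>2)) *\<^sub>R cis (\<zeta> \<bullet> Z k)))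
       = of_real (norm (\<Psi> \<zeta>) * exp (- (norm \<zeta>)\<^sup>2 / (2 * \<sigma>\<^sup>2)))" for \<zeta>
  proof -
    obtain \<psi> where \<psi>: "\<psi> \<ge> 0" "\<Psi> \<zeta> = of_real \<psi>"
      using pos[of \<zeta>] unfolding \<Psi>_def by blast
    then have "of_real (norm (\<Psi> \<zeta>)) = \<Psi> \<zeta>" by simp
    moreover have "(\<Sum>k\<in>K. of_real (w k) * (exp (- (norm \<zeta>)\<^sup>2 / (2 * \<sigma>\<^sup>2)) *\<^sub>R cis (\<zeta> \<bullet> Z k)))
        = \<Psi> \<zeta> * of_real (exp (- (norm \<zeta>)\<^sup>2 / (2 * \<sigma>\<^sup>2)))"
      unfolding \<Psi>_def sum_distrib_right by (simp add: scaleR_conv_of_real mult_ac)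
    ultimately show ?thesis by simp
  qed
  have hb_real: "has_bochner_integral lborel (\<lambda>\<zeta>. norm (\<Psi> \<zeta>) * exp (- (norm \<zeta>)\<^sup>2 / (2 * \<sigma>\<^sup>2)))
      ((2 * pi) ^ ?d * 10 ^ ?d * A ^ ?d * A ^ ?d * S)"
    using has_bochner_integral_bounded_linear[OF bounded_linear_Re hbg[unfolded val gauss_\<Psi>]]
    unfolding Re_complex_of_real .
  have "of_real ((2 * pi) ^ ?d) * (\<Sum>k\<in>K. (w k * exp (- (norm (Z k))\<^sup>2 / 2)) *\<^sub>R integral {A..B} (\<lambda>t. cis (t * (fst (Z k) \<bullet> snd (Z k) - r))))
     = integral {A..B} (\<lambda>t. \<Sum>k\<in>K. of_real ((2 * pi) ^ ?d * (w k * exp (- (norm (Z k))\<^sup>2 / 2))) * cis (t * (fst (Z k) \<bullet> snd (Z k) - r)))"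
  proof -
    have "integral {A..B} (\<lambda>t. \<Sum>k\<in>K. of_real ((2 * pi) ^ ?d * (w k * exp (- (norm (Z k))\<^sup>2 / 2))) * cis (t * (fst (Z k) \<bullet> snd (Z k) - r)))
        = (\<Sum>k\<in>K. integral {A..B} (\<lambda>t. of_real ((2 * pi) ^ ?d * (w k * exp (- (norm (Z k))\<^sup>2 / 2))) * cis (t * (fst (Z k) \<bullet> snd (Z k) - r))))"
      by (intro integral_sum fin integrable_continuous_real continuous_intros)
    also have "\<dots> = (\<Sum>k\<in>K. of_real ((2 * pi) ^ ?d * (w k * exp (- (norm (Z k))\<^sup>2 / 2))) * integral {A..B} (\<lambda>t. cis (t * (fst (Z k) \<bullet> snd (Z k) - r))))"
      by (simp only: Henstock_Kurzweil_Integration.integral_mult_right)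
    finally show ?thesis
      by (simp only: sum_distrib_left of_real_mult scaleR_conv_of_real mult.assoc)
  qed
  also have "\<dots> = (\<integral>t. (\<integral>\<zeta>. f t \<zeta> \<partial>lborel) \<partial>lborel)"
    unfolding inner_\<zeta> set_lebesgue_integral_def[symmetric]
    by (intro set_borel_integral_eq_integral(2)[symmetric] borel_integrable_atLeastAtMost' continuous_intros)
  also have "\<dots> = (\<integral>\<zeta>. (\<integral>t. f t \<zeta> \<partial>lborel) \<partial>lborel)"
    by (rule lborel_pair.Fubini_integral[OF intf, symmetric])
  also have "\<dots> = (\<integral>\<zeta>. \<Psi> \<zeta> * J \<zeta> \<partial>lborel)"
    unfolding inner_t ..
  finally have eq: "of_real ((2 * pi) ^ ?d) * (\<Sum>k\<in>K. (w k * exp (- (norm (Z k))\<^sup>2 / 2)) *\<^sub>R integral {A..B} (\<lambda>t. cis (t * (fst (Z k) \<bullet> snd (Z k) - r))))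
     = (\<integral>\<zeta>. \<Psi> \<zeta> * J \<zeta> \<partial>lborel)" .
  have intJ: "integrable lborel (\<lambda>\<zeta>. \<Psi> \<zeta> * J \<zeta>)"
    using lborel_pair.integrable_snd[OF intf] unfolding inner_t .
  have "norm (\<integral>\<zeta>. \<Psi> \<zeta> * J \<zeta> \<partial>lborel) \<le> (\<integral>\<zeta>. norm (\<Psi> \<zeta> * J \<zeta>) \<partial>lborel)"
    by (rule integral_norm_bound)
  also have "\<dots> \<le> (\<integral>\<zeta>. C * (sqrt A / A ^ ?d) * (norm (\<Psi> \<zeta>) * exp (- (norm \<zeta>)\<^sup>2 / (2 * \<sigma>\<^sup>2))) \<partial>lborel)"
  proof (rule integral_mono)
    show "norm (\<Psi> \<zeta> * J \<zeta>) \<le> C * (sqrt A / A ^ ?d) * (norm (\<Psi> \<zeta>) * exp (- (norm \<zeta>)\<^sup>2 / (2 * \<sigma>\<^sup>2)))" for \<zeta>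
      using mult_left_mono[OF norm_J[of \<zeta>], of "norm (\<Psi> \<zeta>)"] unfolding \<sigma>_def by (simp add: norm_mult mult_ac)
  qed (use intJ hb_real in \<open>auto simp: has_bochner_integral_iff\<close>)
  also have "\<dots> = C * (sqrt A / A ^ ?d) * ((2 * pi) ^ ?d * 10 ^ ?d * A ^ ?d * A ^ ?d * S)"
    by (simp only: integral_mult_right_zero has_bochner_integral_integral_eq[OF hb_real])
  also have "\<dots> = (2 * pi) ^ ?d * (C * 10 ^ ?d * sqrt A * A ^ ?d * S)"
    using A by simp
  finally have "(2 * pi) ^ ?d * norm (\<Sum>k\<in>K. (w k * exp (- (norm (Z k))\<^sup>2 / 2)) *\<^sub>R integral {A..B} (\<lambda>t. cis (t * (fst (Z k) \<bullet> snd (Z k) - r))))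
     \<le> (2 * pi) ^ ?d * (C * 10 ^ ?d * sqrt A * A ^ ?d * S)"
    unfolding eq[symmetric] norm_mult norm_of_real by simp
  then show ?thesis
    unfolding C_def S_def by (subst (asm) mult_le_cancel_left_pos) simp_all
qed

subsection \<open>A discrete Frostman lemma\<close>

text \<open>The label of the half-open dyadic cube of side 2^(-k) around \<open>x\<close>.
  Restricting to \<open>Basis\<close> makes equality of labels the same as lying in one
  cube.\<close>

definition dyadic_index :: "nat \<Rightarrow> 'a::euclidean_space \<Rightarrow> 'a \<Rightarrow> int" where
  "dyadic_index k x = restrict (\<lambda>b. \<lfloor>2 ^ k * (x \<bullet> b)\<rfloor>) Basis"

text \<open>A list suits the recursion over subcubes: concatenation adds costs, and the empty list
  covers the empty set for nothing.\<close>

definition finite_cover_cost :: "real \<Rightarrow> real \<Rightarrow> 'a::metric_space set \<Rightarrow> real \<Rightarrow> bool" where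
  "finite_cover_cost s \<delta> A c \<longleftrightarrow> (\<exists>L. A \<subseteq> \<Union> (set L) \<and> (\<forall>U\<in>set L. bounded U \<and> diameter U \<le> \<delta>)
      \<and> (\<Sum>U\<leftarrow>L. diameter U powr s) \<le> c)"

text \<open>Dyadic cubes are nested, because the coarser floor is the finer one divided by a power
  of 2 with integer division.\<close>

lemma dyadic_index_coarsen:
  assumes "dyadic_index n x = dyadic_index n y" "k \<le> n"
  shows "dyadic_index k x = dyadic_index k y"
proof -
  have "\<lfloor>2 ^ k * (x \<bullet> b)\<rfloor> = \<lfloor>2 ^ k * (y \<bullet> b)\<rfloor>" if b: "b \<in> Basis" for b
  proof -
    have fl: "\<lfloor>2 ^ k * z\<rfloor> = \<lfloor>2 ^ n * z\<rfloor> div 2 ^ (n - k)" for z :: real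
    proof -
      have "(2::real) ^ n = 2 ^ k * 2 ^ (n - k)" using assms(2) by (simp flip: power_add)
      then have "2 ^ k * z = 2 ^ n * z / real_of_int (2 ^ (n - k))" by simp
      then show ?thesis by (metis floor_divide_real_eq_div zero_le_numeral zero_le_power)
    qed
    have "\<lfloor>2 ^ n * (x \<bullet> b)\<rfloor> = \<lfloor>2 ^ n * (y \<bullet> b)\<rfloor>"
      using fun_cong[OF assms(1), of b] b by (simp add: dyadic_index_def)
    then show ?thesis by (simp add: fl)
  qed
  then show ?thesis by (simp add: dyadic_index_def restrict_def fun_eq_iff)
qed

lemma dyadic_index_dist:
  fixes x y :: "'a::euclidean_space"
  assumes "dyadic_index k x = dyadic_index k y"
  shows "dist x y \<le> DIM('a) / 2 ^ k"
proof -
  have "\<bar>(x - y) \<bullet> b\<bar> \<le> 1 / 2 ^ k" if b: "b \<in> Basis" for b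
  proof -
    have "\<lfloor>2 ^ k * (x \<bullet> b)\<rfloor> = \<lfloor>2 ^ k * (y \<bullet> b)\<rfloor>"
      using fun_cong[OF assms, of b] b by (simp add: dyadic_index_def)
    then have "\<bar>2 ^ k * (x \<bullet> b) - 2 ^ k * (y \<bullet> b)\<bar> \<le> 1" by linarith
    then have "2 ^ k * \<bar>(x - y) \<bullet> b\<bar> \<le> 1"
      by (simp add: inner_diff_left abs_mult flip: right_diff_distrib)
    then show ?thesis by (simp add: field_simps)
  qed
  then have "(\<Sum>b\<in>Basis. \<bar>(x - y) \<bullet> b\<bar>) \<le> (\<Sum>b\<in>(Basis::'a set). 1 / 2 ^ k)"
    by (rule sum_mono)
  then show ?thesis using norm_le_l1[of "x - y"] by (simp add: dist_norm)
qed

lemma finite_dyadic_index: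
  fixes E :: "'a::euclidean_space set"
  assumes "bounded E"
  shows "finite (dyadic_index k ` E)"
proof -
  obtain B where B: "\<And>x. x \<in> E \<Longrightarrow> norm x \<le> B"
    using assms by (auto simp: bounded_iff)
  define M where "M = \<lceil>2 ^ k * B\<rceil>"
  have "dyadic_index k x \<in> PiE Basis (\<lambda>_. {- M - 1..M + 1})" if "x \<in> E" for x
  proof -
    have "\<lfloor>2 ^ k * (x \<bullet> b)\<rfloor> \<in> {- M - 1..M + 1}" if b: "b \<in> Basis" for b
    proof -
      have "\<bar>x \<bullet> b\<bar> \<le> B" using Basis_le_norm[OF b, of x] B[OF \<open>x \<in> E\<close>] by linarith
      then have "\<bar>2 ^ k * (x \<bullet> b)\<bar> \<le> 2 ^ k * B" by (simp add: abs_mult)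
      then have "- M - 1 \<le> \<lfloor>2 ^ k * (x \<bullet> b)\<rfloor>" "\<lfloor>2 ^ k * (x \<bullet> b)\<rfloor> \<le> M + 1"
        unfolding M_def by linarith+
      then show ?thesis by simp
    qed
    then show ?thesis unfolding dyadic_index_def by auto
  qed
  then have "dyadic_index k ` E \<subseteq> PiE Basis (\<lambda>_. {- M - 1..M + 1})" by blast
  then show ?thesis by (rule finite_subset) (auto intro: finite_PiE)
qed

lemma finite_cover_cost_Union:
  assumes "finite I" "\<And>i. i \<in> I \<Longrightarrow> finite_cover_cost s \<delta> (A i) (c i)"
  shows "finite_cover_cost s \<delta> (\<Union>i\<in>I. A i) (\<Sum>i\<in>I. c i)"
  using assms
proof (induction I)
  case empty
  show ?case unfolding finite_cover_cost_def by (intro exI[of _ "[]"]) auto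
next
  case (insert i I)
  obtain L where L: "A i \<subseteq> \<Union> (set L)" "\<forall>U\<in>set L. bounded U \<and> diameter U \<le> \<delta>" "(\<Sum>U\<leftarrow>L. diameter U powr s) \<le> c i"
    using insert.prems[of i] unfolding finite_cover_cost_def by blast
  obtain L' where L': "(\<Union>i\<in>I. A i) \<subseteq> \<Union> (set L')" "\<forall>U\<in>set L'. bounded U \<and> diameter U \<le> \<delta>" "(\<Sum>U\<leftarrow>L'. diameter U powr s) \<le> (\<Sum>i\<in>I. c i)"
    using insert.IH insert.prems unfolding finite_cover_cost_def by blast
  show ?case
    unfolding finite_cover_cost_def using L L' insert.hyps by (intro exI[of _ "L @ L'"]) auto
qed

lemma finite_cover_cost_single:
  assumes "\<And>x y. x \<in> A \<Longrightarrow> y \<in> A \<Longrightarrow> dist x y \<le> \<epsilon>" "0 \<le> \<epsilon>" "\<epsilon> \<le> \<delta>" "0 \<le> s"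
  shows "finite_cover_cost s \<delta> A (\<epsilon> powr s)"
proof -
  have b: "bounded A"
  proof (cases "A = {}")
    case False
    then obtain a where "a \<in> A" by blast
    then show ?thesis using assms(1)[of a] by (auto simp: bounded_def)
  qed simp
  have "diameter A \<le> \<epsilon>"
    using assms by (auto simp: diameter_def intro!: cSUP_least)
  moreover have "0 \<le> diameter A" using b by (rule diameter_ge_0)
  ultimately show ?thesis
    unfolding finite_cover_cost_def using assms b
    by (intro exI[of _ "[A]"]) (auto intro: powr_mono2)
qed

lemma hausdorff_pre_le_finite_cover_cost:
  assumes "finite_cover_cost s \<delta> A c" "0 \<le> \<delta>"
  shows "hausdorff_pre s \<delta> A \<le> ennreal c"
proof -
  obtain L where L: "A \<subseteq> \<Union> (set L)" "\<forall>U\<in>set L. bounded U \<and> diameter U \<le> \<delta>" "(\<Sum>U\<leftarrow>L. diameter U powr s) \<le> c"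
    using assms unfolding finite_cover_cost_def by blast
  \<comment> \<open>Padding by empty sets is free: their diameter is 0, and \<open>0 powr s\<close>
    is 0 even for \<open>s = 0\<close>.\<close>
  define U where "U = (\<lambda>i. if i < length L then L ! i else {})"
  have "A \<subseteq> (\<Union>i. U i)"
  proof
    fix x assume "x \<in> A"
    then obtain V where "V \<in> set L" "x \<in> V" using L(1) by blast
    then obtain i where "i < length L" "x \<in> L ! i" by (metis in_set_conv_nth)
    then show "x \<in> (\<Union>i. U i)" by (auto simp: U_def)
  qed
  moreover have "bounded (U i) \<and> diameter (U i) \<le> \<delta>" for i
    using L(2) assms(2) by (auto simp: U_def)
  ultimately have "hausdorff_pre s \<delta> A \<le> (\<Sum>i. ennreal (diameter (U i) powr s))"
    unfolding hausdorff_pre_def by (intro INF_lower) auto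
  also have "\<dots> = (\<Sum>i\<in>{..<length L}. ennreal (diameter (U i) powr s))"
    by (rule suminf_finite) (auto simp: U_def)
  also have "\<dots> = ennreal (\<Sum>i\<in>{..<length L}. diameter (U i) powr s)"
    by (rule sum_ennreal) simp
  also have "(\<Sum>i\<in>{..<length L}. diameter (U i) powr s) = (\<Sum>U\<leftarrow>L. diameter U powr s)"
    unfolding sum_list_sum_nth by (rule sum.cong) (auto simp: U_def)
  finally show ?thesis using L(3) by (meson ennreal_leI order_trans)
qed

section \<open>Construction of the Frostman weights\<close>

text \<open>The weights are built from the finest cubes upwards: whenever the mass of a cube \<open>Q\<close> exceeds
  \<open>side(Q) powr s\<close>, it is scaled down to exactly this value, and then \<open>Q\<close> alone is a
  cover of \<open>E \<inter> Q\<close> whose cost is comparable to its mass.\<close>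

lemma dyadic_weights:
  fixes E P :: "'a::euclidean_space set"
  assumes P: "finite P" "inj_on (dyadic_index n) P" "dyadic_index n ` P = dyadic_index n ` E"
    and s: "0 \<le> s" and k: "k \<le> n" "DIM('a) / 2 ^ k \<le> \<delta>"
  shows "\<exists>m. (\<forall>p. 0 \<le> m p) \<and>
    (\<forall>l\<in>{k..n}. \<forall>i. (\<Sum>p\<in>{p\<in>P. dyadic_index l p = i}. m p) \<le> (1 / 2 ^ l) powr s) \<and>
    (\<forall>i. finite_cover_cost s \<delta> {x\<in>E. dyadic_index k x = i}
        (DIM('a) powr s * (\<Sum>p\<in>{p\<in>P. dyadic_index k p = i}. m p)))"
  using k
proof (induction k rule: inc_induct)
  case base
  have single: "{p\<in>P. dyadic_index n p = i} = {} \<or> (\<exists>q. {p\<in>P. dyadic_index n p = i} = {q})" for i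
    using P(2) by (auto simp: inj_on_def) blast
  \<comment> \<open>A finest cube meeting \<open>E\<close> holds exactly one point of
    \<open>P\<close>; giving it the mass side^s meets the upper bound with equality and pays for the
    cube as its own cover.\<close>
  show ?case
  proof (intro exI[of _ "\<lambda>_. (1 / 2 ^ n) powr s"] conjI allI ballI)
    fix l i assume "l \<in> {n..n}"
    then have "l = n" by simp
    have "(\<Sum>p\<in>Q. a) \<le> a" if "Q = {} \<or> (\<exists>q. Q = {q})" "0 \<le> a" for Q :: "'a set" and a :: real
      using that by auto
    from this[OF single[of i]]
    show "(\<Sum>p\<in>{p\<in>P. dyadic_index l p = i}. (1 / 2 ^ n) powr s) \<le> (1 / 2 ^ l) powr s"
      unfolding \<open>l = n\<close> by simp
  next
    fix i
    show "finite_cover_cost s \<delta> {x\<in>E. dyadic_index n x = i}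
        (DIM('a) powr s * (\<Sum>p\<in>{p\<in>P. dyadic_index n p = i}. (1 / 2 ^ n) powr s))"
    proof (cases "i \<in> dyadic_index n ` E")
      case True
      then have "{p\<in>P. dyadic_index n p = i} \<noteq> {}" using P(3) by force
      then obtain q where "{p\<in>P. dyadic_index n p = i} = {q}" using single[of i] by blast
      moreover have "finite_cover_cost s \<delta> {x\<in>E. dyadic_index n x = i} ((DIM('a) / 2 ^ n) powr s)"
        using base s by (intro finite_cover_cost_single) (auto intro: dyadic_index_dist)
      ultimately show ?thesis by (simp add: powr_divide)
    next
      case False
      then have "{x\<in>E. dyadic_index n x = i} = {}" "{p\<in>P. dyadic_index n p = i} = {}" using P(3) by auto
      then show ?thesis unfolding finite_cover_cost_def by (intro exI[of _ "[]"]) auto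
    qed
  qed simp
next
  case (step k)
  have "DIM('a) / 2 ^ Suc k \<le> DIM('a) / 2 ^ k" by (intro divide_left_mono) auto
  then have "DIM('a) / 2 ^ Suc k \<le> \<delta>" using step.prems by linarith
  from step.IH[OF this] obtain m where m0: "\<And>p. 0 \<le> m p"
    and m1: "\<And>l i. l \<in> {Suc k..n} \<Longrightarrow> (\<Sum>p\<in>{p\<in>P. dyadic_index l p = i}. m p) \<le> (1 / 2 ^ l) powr s"
    and m2: "\<And>i. finite_cover_cost s \<delta> {x\<in>E. dyadic_index (Suc k) x = i}
        (DIM('a) powr s * (\<Sum>p\<in>{p\<in>P. dyadic_index (Suc k) p = i}. m p))"
    by blast
  define M where "M = (\<lambda>i. \<Sum>p\<in>{p\<in>P. dyadic_index k p = i}. m p)"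
  define h where "h = (1 / 2 ^ k :: real) powr s"
  \<comment> \<open>The factor is at most 1, so the bounds at finer levels persist, and it is
    constant on cubes of level \<open>k\<close>, so it brings their mass down to the minimum of
    \<open>M i\<close> and \<open>h\<close>.\<close>
  define c where "c = (\<lambda>i. if M i \<le> h then 1 else h / M i)"
  define m' where "m' = (\<lambda>p. c (dyadic_index k p) * m p)"
  have h: "h > 0" unfolding h_def by simp
  have c: "0 \<le> c i" "c i \<le> 1" for i unfolding c_def using h by auto
  have m'0: "0 \<le> m' p" "m' p \<le> m p" for p
    unfolding m'_def using m0[of p] c[of "dyadic_index k p"] by (auto intro: mult_left_le_one_le)
  have M': "(\<Sum>p\<in>{p\<in>P. dyadic_index k p = i}. m' p) = (if M i \<le> h then M i else h)" for i
  proof -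
    have "(\<Sum>p\<in>{p\<in>P. dyadic_index k p = i}. m' p) = c i * M i"
      unfolding M_def sum_distrib_left by (rule sum.cong) (auto simp: m'_def)
    then show ?thesis using h by (auto simp: c_def)
  qed
  show ?case
  proof (intro exI[of _ m'] conjI allI ballI m'0)
    fix l i assume l: "l \<in> {k..n}"
    show "(\<Sum>p\<in>{p\<in>P. dyadic_index l p = i}. m' p) \<le> (1 / 2 ^ l) powr s"
    proof (cases "l = k")
      case True then show ?thesis using M'[of i] by (auto simp: h_def)
    next
      case False
      have "(\<Sum>p\<in>{p\<in>P. dyadic_index l p = i}. m' p) \<le> (\<Sum>p\<in>{p\<in>P. dyadic_index l p = i}. m p)"
        by (intro sum_mono m'0)
      also have "\<dots> \<le> (1 / 2 ^ l) powr s" using l False by (intro m1) auto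
      finally show ?thesis .
    qed
  next
    fix i
    show "finite_cover_cost s \<delta> {x\<in>E. dyadic_index k x = i}
        (DIM('a) powr s * (\<Sum>p\<in>{p\<in>P. dyadic_index k p = i}. m' p))"
    proof (cases "M i \<le> h")
      case True
      \<comment> \<open>In this case the weights inside the cube are unchanged, so the covers of its
        subcubes can be joined and their costs add up to the required amount.\<close>
      define Q where "Q = {p\<in>P. dyadic_index k p = i}"
      define J where "J = dyadic_index (Suc k) ` Q"
      have finQ: "finite Q" using P(1) by (simp add: Q_def)
      have sub: "{p\<in>Q. dyadic_index (Suc k) p = j} = {p\<in>P. dyadic_index (Suc k) p = j}" if "j \<in> J" for j
        using that unfolding J_def Q_def
        by (auto dest: dyadic_index_coarsen[of "Suc k" _ _ k, OF _ le_SucI[OF order_refl]])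
      have "(\<Sum>j\<in>J. DIM('a) powr s * (\<Sum>p\<in>{p\<in>P. dyadic_index (Suc k) p = j}. m p))
          = DIM('a) powr s * (\<Sum>j\<in>J. \<Sum>p\<in>{p\<in>Q. dyadic_index (Suc k) p = j}. m p)"
        by (simp add: sum_distrib_left sub)
      also have "(\<Sum>j\<in>J. \<Sum>p\<in>{p\<in>Q. dyadic_index (Suc k) p = j}. m p) = M i"
        unfolding J_def M_def Q_def[symmetric] by (rule sum.image_gen[OF finQ, symmetric])
      finally have cost: "(\<Sum>j\<in>J. DIM('a) powr s * (\<Sum>p\<in>{p\<in>P. dyadic_index (Suc k) p = j}. m p)) = DIM('a) powr s * M i" .
      \<comment> \<open>Every point of \<open>E\<close> shares its finest cube with a point of
        \<open>P\<close>, so subcubes without points of \<open>P\<close> may be ignored.\<close>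
      have "{x\<in>E. dyadic_index k x = i} = (\<Union>j\<in>J. {x\<in>E. dyadic_index (Suc k) x = j})"
      proof (intro equalityI subsetI)
        fix x assume x: "x \<in> {x\<in>E. dyadic_index k x = i}"
        then obtain p where p: "p \<in> P" "dyadic_index n p = dyadic_index n x"
          using P(3) by (metis (mono_tags, lifting) imageE imageI mem_Collect_eq)
        have "dyadic_index k p = i" "dyadic_index (Suc k) p = dyadic_index (Suc k) x"
          using dyadic_index_coarsen[OF p(2)] x step.hyps by auto
        then show "x \<in> (\<Union>j\<in>J. {x\<in>E. dyadic_index (Suc k) x = j})"
          using p x by (auto simp: J_def Q_def intro!: image_eqI[of _ _ p])
      next
        fix x assume "x \<in> (\<Union>j\<in>J. {x\<in>E. dyadic_index (Suc k) x = j})"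
        then obtain p where "p \<in> Q" "x \<in> E" "dyadic_index (Suc k) x = dyadic_index (Suc k) p"
          unfolding J_def by auto
        then show "x \<in> {x\<in>E. dyadic_index k x = i}"
          using dyadic_index_coarsen[of "Suc k" x p k] by (auto simp: Q_def)
      qed
      moreover have "finite_cover_cost s \<delta> (\<Union>j\<in>J. {x\<in>E. dyadic_index (Suc k) x = j}) (\<Sum>j\<in>J. DIM('a) powr s * (\<Sum>p\<in>{p\<in>P. dyadic_index (Suc k) p = j}. m p))"
        using finQ by (intro finite_cover_cost_Union m2) (simp add: J_def)
      ultimately show ?thesis using True by (simp add: cost M')
    next
      case False
      have "finite_cover_cost s \<delta> {x\<in>E. dyadic_index k x = i} ((DIM('a) / 2 ^ k) powr s)"
        using step.prems s by (intro finite_cover_cost_single) (auto intro: dyadic_index_dist)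
      then show ?thesis using False by (simp add: M' h_def powr_divide)
    qed
  qed
qed

text \<open>The weights on the level-\<open>N\<close> points come with a cover of \<open>E\<close>
  whose cost is a multiple of their total mass. As the premeasure of \<open>E\<close> is positive,
  that mass is bounded below independently of \<open>n\<close>, and normalising keeps the cube
  bounds with a uniform constant. A ball meets boundedly many cubes of comparable side.\<close>

lemma frostman_discrete:
  fixes E :: "'a::euclidean_space set"
  assumes E: "bounded E" and s: "0 \<le> s" and H: "hausdorff_measure s E \<noteq> 0"
  shows "\<exists>C>0. \<forall>n. \<exists>P m. finite P \<and> P \<subseteq> E \<and> (\<forall>p. 0 \<le> m p) \<and> (\<Sum>p\<in>P. m p) = (1::real) \<and>
     (\<forall>\<rho> x. 1 / 2 ^ n \<le> \<rho> \<longrightarrow> (\<Sum>y\<in>{y\<in>P. dist x y \<le> \<rho>}. m y) \<le> C * \<rho> powr s)"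
proof -
  obtain \<delta> where \<delta>: "\<delta> > 0" "hausdorff_pre s \<delta> E \<noteq> 0"
  proof -
    have "\<exists>\<delta>\<in>{0<..}. hausdorff_pre s \<delta> E \<noteq> 0"
    proof (rule ccontr)
      assume "\<not> ?thesis"
      then have "hausdorff_measure s E \<le> 0"
        unfolding hausdorff_measure_def by (intro SUP_least) auto
      then show False using H by simp
    qed
    then show ?thesis using that by auto
  qed
  obtain c\<^sub>0 :: real where c0: "c\<^sub>0 > 0" "ennreal c\<^sub>0 \<le> hausdorff_pre s \<delta> E"
  proof (cases "hausdorff_pre s \<delta> E")
    case (real r)
    then show ?thesis using \<delta> that[of r] by (cases "r = 0") auto
  next
    case top
    then show ?thesis using that[of 1] by simp
  qed
  let ?D = "real DIM('a)"
  \<comment> \<open>From this level on, cubes have diameter at most \<open>\<delta>\<close>, so they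
    are admissible in the premeasure.\<close>
  obtain k\<^sub>0 where "?D / \<delta> < 2 ^ k\<^sub>0"
    using real_arch_pow[of 2 "?D / \<delta>"] by auto
  then have k0: "?D / 2 ^ k\<^sub>0 \<le> \<delta>" using \<delta> by (simp add: field_simps)
  \<comment> \<open>The first summand counts neighbouring cubes, allows sides up to twice the
    radius, and includes the normalisation. The second serves radii above 2^(-k0), where the total
    mass 1 is already an adequate bound.\<close>
  define C where "C = 3 ^ DIM('a) * 2 powr s * ?D powr s / c\<^sub>0 + (2 ^ k\<^sub>0) powr s"
  have "C > 0" unfolding C_def using c0 by (intro add_nonneg_pos) auto
  moreover have "\<exists>P m. finite P \<and> P \<subseteq> E \<and> (\<forall>p. 0 \<le> m p) \<and> (\<Sum>p\<in>P. m p) = (1::real) \<and>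
     (\<forall>\<rho> x. 1 / 2 ^ n \<le> \<rho> \<longrightarrow> (\<Sum>y\<in>{y\<in>P. dist x y \<le> \<rho>}. m y) \<le> C * \<rho> powr s)" for n
  proof -
    define N where "N = max n k\<^sub>0"
    \<comment> \<open>One representative in \<open>E\<close> of each level-\<open>N\<close> cube
      that meets \<open>E\<close>.\<close>
    define P where "P = inv_into E (dyadic_index N) ` (dyadic_index N ` E)"
    have PE: "P \<subseteq> E" unfolding P_def by (auto intro: inv_into_into)
    have finP: "finite P" unfolding P_def by (intro finite_imageI finite_dyadic_index E)
    have kN: "k\<^sub>0 \<le> N" unfolding N_def by simp
    have injP: "inj_on (dyadic_index N) P"
      unfolding P_def by (auto simp: inj_on_def f_inv_into_f)
    have imP: "dyadic_index N ` P = dyadic_index N ` E"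
      unfolding P_def by (rule image_inv_into_cancel[OF refl order_refl])
    obtain m where m0': "\<forall>p. 0 \<le> m p"
      and m1': "\<forall>l\<in>{k\<^sub>0..N}. \<forall>i. (\<Sum>p\<in>{p\<in>P. dyadic_index l p = i}. m p) \<le> (1 / 2 ^ l) powr s"
      and m2': "\<forall>i. finite_cover_cost s \<delta> {x\<in>E. dyadic_index k\<^sub>0 x = i}
        (?D powr s * (\<Sum>p\<in>{p\<in>P. dyadic_index k\<^sub>0 p = i}. m p))"
      using dyadic_weights[OF finP injP imP s kN k0] by (elim exE conjE) (rule that)
    note m0 = m0'[rule_format] and m1 = m1'[rule_format] and m2 = m2'[rule_format]
    define M where "M = (\<Sum>p\<in>P. m p)"
    have "finite_cover_cost s \<delta> (\<Union>i\<in>dyadic_index k\<^sub>0 ` P. {x\<in>E. dyadic_index k\<^sub>0 x = i})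
        (\<Sum>i\<in>dyadic_index k\<^sub>0 ` P. ?D powr s * (\<Sum>p\<in>{p\<in>P. dyadic_index k\<^sub>0 p = i}. m p))"
      using finP by (intro finite_cover_cost_Union m2) auto
    moreover have "(\<Union>i\<in>dyadic_index k\<^sub>0 ` P. {x\<in>E. dyadic_index k\<^sub>0 x = i}) = E"
    proof (intro equalityI subsetI)
      fix x assume x: "x \<in> E"
      then obtain p where p: "p \<in> P" "dyadic_index N p = dyadic_index N x"
        using imP by (metis imageE imageI)
      have "dyadic_index k\<^sub>0 p = dyadic_index k\<^sub>0 x"
        by (rule dyadic_index_coarsen[OF p(2) kN])
      then show "x \<in> (\<Union>i\<in>dyadic_index k\<^sub>0 ` P. {x\<in>E. dyadic_index k\<^sub>0 x = i})"
        using x p(1) by (intro UN_I[of "dyadic_index k\<^sub>0 p"] imageI) auto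
    qed auto
    moreover have "(\<Sum>i\<in>dyadic_index k\<^sub>0 ` P. ?D powr s * (\<Sum>p\<in>{p\<in>P. dyadic_index k\<^sub>0 p = i}. m p)) = ?D powr s * M"
      unfolding M_def sum_distrib_left[symmetric] by (subst sum.image_gen[OF finP, of m "dyadic_index k\<^sub>0"]) simp
    ultimately have "hausdorff_pre s \<delta> E \<le> ennreal (?D powr s * M)"
      using \<delta> by (intro hausdorff_pre_le_finite_cover_cost) auto
    then have "ennreal c\<^sub>0 \<le> ennreal (?D powr s * M)" using c0(2) by (rule order_trans[rotated])
    then have c0M: "c\<^sub>0 \<le> ?D powr s * M"
      using c0(1) ennreal_le_iff2[of c\<^sub>0] by auto
    then have M: "M > 0" using c0(1) by (smt (verit) powr_ge_zero mult_nonneg_nonpos)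
    define w where "w = (\<lambda>p. m p / M)"
    have w0: "0 \<le> w p" for p unfolding w_def using m0 M by simp
    have w1: "(\<Sum>p\<in>P. w p) = 1" unfolding w_def using M by (simp add: sum_divide_distrib[symmetric] M_def)
    have wl: "(\<Sum>p\<in>{p\<in>P. dyadic_index l p = i}. w p) \<le> ?D powr s / c\<^sub>0 * (1 / 2 ^ l) powr s" if "l \<in> {k\<^sub>0..N}" for l i
    proof -
      have "1 / M \<le> ?D powr s / c\<^sub>0" using M c0 c0M by (simp add: field_simps)
      then have "1 / M * (\<Sum>p\<in>{p\<in>P. dyadic_index l p = i}. m p) \<le> ?D powr s / c\<^sub>0 * (1 / 2 ^ l) powr s"
        using m1[OF that, of i] c0 by (intro mult_mono) (auto intro: sum_nonneg m0)
      then show ?thesis by (simp add: w_def sum_divide_distrib)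
    qed
    have ball: "(\<Sum>y\<in>{y\<in>P. dist x y \<le> \<rho>}. w y) \<le> C * \<rho> powr s" if \<rho>: "1 / 2 ^ n \<le> \<rho>" for \<rho> x
    proof (cases "\<rho> \<le> 1 / 2 ^ k\<^sub>0")
      case False
      have "(\<Sum>y\<in>{y\<in>P. dist x y \<le> \<rho>}. w y) \<le> (\<Sum>y\<in>P. w y)"
        using finP by (intro sum_mono2) (auto intro: w0)
      also have "\<dots> = 1 powr s" using w1 by simp
      also have "1 powr s \<le> (2 ^ k\<^sub>0 * \<rho>) powr s"
        using False s by (intro powr_mono2) (auto simp: field_simps)
      also have "\<dots> = (2 ^ k\<^sub>0) powr s * \<rho> powr s"
        using \<rho> by (intro powr_mult)
      also have "\<dots> \<le> C * \<rho> powr s"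
        unfolding C_def using c0 by (intro mult_right_mono) auto
      finally show ?thesis .
    next
      case True
      \<comment> \<open>The finest admissible level whose side is still at least the radius. If the
        cap \<open>N\<close> stops the search, the side is at most 2^(-n), hence at most the
        radius.\<close>
      define S where "S = {l. l \<le> N \<and> \<rho> \<le> 1 / 2 ^ l}"
      define l where "l = Max S"
      have finS: "finite S" unfolding S_def by simp
      have kS: "k\<^sub>0 \<in> S" unfolding S_def N_def using True by simp
      have lS: "l \<in> S" unfolding l_def using finS kS by (intro Max_in) auto
      have kl: "k\<^sub>0 \<le> l" unfolding l_def using finS kS by (intro Max_ge)
      have l2: "1 / 2 ^ l \<le> 2 * \<rho>"
      proof (cases "l = N")
        case True
        have "1 / 2 ^ N \<le> (1 / 2 ^ n :: real)" unfolding N_def by (intro divide_left_mono power_increasing) auto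
        moreover have "0 < (1 / 2 ^ n :: real)" by simp
        ultimately show ?thesis using \<rho> unfolding True by linarith
      next
        case False
        have "Suc l \<notin> S" using Max_ge[OF finS, of "Suc l"] unfolding l_def by auto
        then have "1 / 2 ^ Suc l < \<rho>" using lS False unfolding S_def by auto
        then show ?thesis by simp
      qed
      \<comment> \<open>Within distance 2^(-l) each coordinate of the label changes by at most 1, so
        \<open>V\<close> lists the possible offsets.\<close>
      define V where "V = PiE (Basis::'a set) (\<lambda>_. {- 1, 0, 1 :: int})"
      have finV: "finite V" "card V = 3 ^ DIM('a)" unfolding V_def by (auto simp: card_PiE numeral_3_eq_3 intro: finite_PiE)
      define Q where "Q = {y\<in>P. dist x y \<le> \<rho>}"
      have finQ: "finite Q" unfolding Q_def using finP by simp
      have "dyadic_index l ` Q \<subseteq> (\<lambda>v. restrict (\<lambda>b. dyadic_index l x b + v b) Basis) ` V"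
      proof
        fix i assume "i \<in> dyadic_index l ` Q"
        then obtain y where i: "i = dyadic_index l y" and y: "y \<in> {y\<in>P. dist x y \<le> \<rho>}"
          unfolding Q_def by blast
        define v where "v = restrict (\<lambda>b. dyadic_index l y b - dyadic_index l x b) Basis"
        have "v b \<in> {- 1, 0, 1}" if b: "b \<in> Basis" for b
        proof -
          have "\<bar>(y - x) \<bullet> b\<bar> \<le> norm (y - x)" by (rule Basis_le_norm[OF b])
          also have "\<dots> \<le> 1 / 2 ^ l" using y lS unfolding S_def by (simp add: dist_norm norm_minus_commute)
          finally have "2 ^ l * \<bar>(y - x) \<bullet> b\<bar> \<le> 1" by (simp add: field_simps)
          then have "\<bar>2 ^ l * (y \<bullet> b) - 2 ^ l * (x \<bullet> b)\<bar> \<le> 1"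
            by (simp add: inner_diff_left abs_mult flip: right_diff_distrib)
          then have "\<bar>\<lfloor>2 ^ l * (y \<bullet> b)\<rfloor> - \<lfloor>2 ^ l * (x \<bullet> b)\<rfloor>\<bar> \<le> 1" by linarith
          then show ?thesis using b by (auto simp: v_def dyadic_index_def)
        qed
        then have "v \<in> V" unfolding V_def v_def by auto
        moreover have "i = restrict (\<lambda>b. dyadic_index l x b + v b) Basis"
          unfolding i by (auto simp: v_def dyadic_index_def fun_eq_iff)
        ultimately show "i \<in> (\<lambda>v. restrict (\<lambda>b. dyadic_index l x b + v b) Basis) ` V"
          by blast
      qed
      then have cardQ: "card (dyadic_index l ` Q) \<le> 3 ^ DIM('a)"
        using surj_card_le[OF finV(1)] finV(2) by metis
      have "(\<Sum>y\<in>Q. w y) = (\<Sum>i\<in>dyadic_index l ` Q. \<Sum>y\<in>{y\<in>Q. dyadic_index l y = i}. w y)"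
        by (rule sum.image_gen[OF finQ])
      also have "\<dots> \<le> (\<Sum>i\<in>dyadic_index l ` Q. ?D powr s / c\<^sub>0 * (1 / 2 ^ l) powr s)"
      proof (rule sum_mono)
        fix i
        have "(\<Sum>y\<in>{y\<in>Q. dyadic_index l y = i}. w y) \<le> (\<Sum>y\<in>{y\<in>P. dyadic_index l y = i}. w y)"
          using finP by (intro sum_mono2) (auto simp: Q_def intro: w0)
        also have "\<dots> \<le> ?D powr s / c\<^sub>0 * (1 / 2 ^ l) powr s"
          using kl lS by (intro wl) (auto simp: S_def)
        finally show "(\<Sum>y\<in>{y\<in>Q. dyadic_index l y = i}. w y) \<le> ?D powr s / c\<^sub>0 * (1 / 2 ^ l) powr s" .
      qed
      also have "\<dots> = real (card (dyadic_index l ` Q)) * (?D powr s / c\<^sub>0 * (1 / 2 ^ l) powr s)"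
        by simp
      also have "\<dots> \<le> 3 ^ DIM('a) * (?D powr s / c\<^sub>0 * (1 / 2 ^ l) powr s)"
      proof (rule mult_right_mono)
        have "real (card (dyadic_index l ` Q)) \<le> real (3 ^ DIM('a))" using cardQ by (rule of_nat_mono)
        then show "real (card (dyadic_index l ` Q)) \<le> 3 ^ DIM('a)" by simp
      qed (use c0 in simp)
      also have "\<dots> \<le> 3 ^ DIM('a) * (?D powr s / c\<^sub>0 * (2 * \<rho>) powr s)"
        using l2 s c0 by (intro mult_left_mono powr_mono2) auto
      also have "\<dots> = 3 ^ DIM('a) * 2 powr s * ?D powr s / c\<^sub>0 * \<rho> powr s"
        by (simp add: powr_mult mult_ac)
      also have "\<dots> \<le> C * \<rho> powr s" unfolding C_def by (intro mult_right_mono) auto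
      finally show ?thesis unfolding Q_def .
    qed
    show ?thesis
      using finP PE w0 w1 ball by (intro exI[of _ P] exI[of _ w]) blast
  qed
  ultimately show ?thesis by blast
qed

subsection \<open>Energy and moment estimates\<close>

text \<open>Bound the power by exp (s j) and complete the square in - 5 j^2 + (s + 1) j, which is at
  most (s + 1)^2 / 20; the spare exp (- j) leaves a geometric series.\<close>

lemma gaussian_shell_sum:
  fixes s :: real
  assumes "0 \<le> s"
  shows "(\<Sum>j<J. exp (- 5 * (real j)\<^sup>2) * (real j + 1) powr s) \<le> exp ((s + 1)\<^sup>2 / 20) / (1 - exp (- 1))"
proof -
  have le: "exp (- 5 * (real j)\<^sup>2) * (real j + 1) powr s \<le> exp ((s + 1)\<^sup>2 / 20) * exp (- 1) ^ j" for j
  proof -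
    have "(real j + 1) powr s \<le> exp (real j) powr s"
      using exp_ge_add_one_self[of "real j"] assms by (intro powr_mono2) (auto simp: add.commute)
    also have "\<dots> = exp (s * real j)" by (simp add: powr_def)
    finally have "exp (- 5 * (real j)\<^sup>2) * (real j + 1) powr s \<le> exp (- 5 * (real j)\<^sup>2 + s * real j)"
      unfolding exp_add by (intro mult_left_mono) auto
    also have "exp (- 5 * (real j)\<^sup>2 + s * real j) \<le> exp ((s + 1)\<^sup>2 / 20) * exp (- real j)"
    proof -
      have "5 * (real j - (s + 1) / 10)\<^sup>2 = 5 * (real j)\<^sup>2 - s * real j - real j + (s + 1)\<^sup>2 / 20"
      by (simp add: power2_eq_square field_simps)
      moreover have "0 \<le> 5 * (real j - (s + 1) / 10)\<^sup>2" by simp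
      ultimately have "- 5 * (real j)\<^sup>2 + s * real j \<le> (s + 1)\<^sup>2 / 20 + - real j" by linarith
      then show ?thesis by (simp only: exp_add[symmetric] exp_le_cancel_iff)
    qed
    also have "exp (- real j) = exp (- 1) ^ j"
      by (simp add: exp_of_nat_mult[symmetric])
    finally show ?thesis .
  qed
  have "(\<Sum>j<J. exp (- 5 * (real j)\<^sup>2) * (real j + 1) powr s) \<le> (\<Sum>j<J. exp ((s + 1)\<^sup>2 / 20) * exp (- 1) ^ j)"
    by (intro sum_mono le)
  also have "\<dots> = exp ((s + 1)\<^sup>2 / 20) * ((1 - exp (- 1) ^ J) / (1 - exp (- 1)))"
    unfolding sum_distrib_left[symmetric] by (subst sum_gp_strict) auto
  also have "\<dots> \<le> exp ((s + 1)\<^sup>2 / 20) * (1 / (1 - exp (- 1)))"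
    by (intro mult_left_mono divide_right_mono) auto
  finally show ?thesis by simp
qed

text \<open>Split \<open>P\<close> into shells of width 1/A around \<open>x\<close>. The shell of
  index \<open>j\<close> lies in the ball of radius \<open>(real j + 1) / A\<close>, never below
  1/A, so the mass bound is needed only at the scales where it is assumed.\<close>

lemma gaussian_energy_bound:
  fixes P :: "'a::metric_space set" and m :: "'a \<Rightarrow> real"
  assumes fin: "finite P" and m: "\<And>y. 0 \<le> m y" and C: "0 \<le> C" and s: "0 \<le> s" and A: "0 < A"
    and frost: "\<And>\<rho>. 1 / A \<le> \<rho> \<Longrightarrow> (\<Sum>y\<in>{y\<in>P. dist x y \<le> \<rho>}. m y) \<le> C * \<rho> powr s"
  shows "(\<Sum>y\<in>P. m y * exp (- 5 * A\<^sup>2 * (dist x y)\<^sup>2)) \<le> C * (exp ((s + 1)\<^sup>2 / 20) / (1 - exp (- 1))) * A powr (- s)"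
proof -
  define ix where "ix = (\<lambda>y. nat \<lfloor>A * dist x y\<rfloor>)"
  define J where "J = Suc (Max (insert 0 (ix ` P)))"
  have ix: "real (ix y) \<le> A * dist x y" "A * dist x y < real (ix y) + 1" for y
    unfolding ix_def using A by (simp_all add: of_nat_nat)
  have ixJ: "ix y < J" if "y \<in> P" for y
    unfolding J_def using fin that by (intro le_imp_less_Suc Max_ge) auto
  let ?B = "\<lambda>j. {y\<in>P. dist x y \<le> (real j + 1) / A}"
  have "m y * exp (- 5 * A\<^sup>2 * (dist x y)\<^sup>2) \<le> (\<Sum>j<J. if y \<in> ?B j then exp (- 5 * (real j)\<^sup>2) * m y else 0)"
    if y: "y \<in> P" for y
  proof -
    have "(real (ix y))\<^sup>2 \<le> (A * dist x y)\<^sup>2" using ix(1) by (intro power_mono) auto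
    then have "m y * exp (- 5 * A\<^sup>2 * (dist x y)\<^sup>2) \<le> exp (- 5 * (real (ix y))\<^sup>2) * m y"
      using m[of y] by (subst mult.commute) (auto simp: power_mult_distrib intro!: mult_right_mono)
    also have "y \<in> ?B (ix y)" using y ix(2)[of y] A by (simp add: field_simps)
    then have "exp (- 5 * (real (ix y))\<^sup>2) * m y = (if y \<in> ?B (ix y) then exp (- 5 * (real (ix y))\<^sup>2) * m y else 0)" by simp
    also have "\<dots> \<le> (\<Sum>j<J. if y \<in> ?B j then exp (- 5 * (real j)\<^sup>2) * m y else 0)"
      using ixJ[OF y] m[of y] by (intro member_le_sum[of "ix y" "{..<J}" "\<lambda>j. if y \<in> ?B j then exp (- 5 * (real j)\<^sup>2) * m y else 0"]) auto
    finally show ?thesis .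
  qed
  then have "(\<Sum>y\<in>P. m y * exp (- 5 * A\<^sup>2 * (dist x y)\<^sup>2)) \<le> (\<Sum>y\<in>P. \<Sum>j<J. if y \<in> ?B j then exp (- 5 * (real j)\<^sup>2) * m y else 0)"
    by (rule sum_mono)
  also have "\<dots> = (\<Sum>j<J. \<Sum>y\<in>P. if y \<in> ?B j then exp (- 5 * (real j)\<^sup>2) * m y else 0)"
    by (rule sum.swap)
  also have "\<dots> = (\<Sum>j<J. exp (- 5 * (real j)\<^sup>2) * (\<Sum>y\<in>?B j. m y))"
    unfolding sum_distrib_left using fin by (intro sum.cong refl sum.mono_neutral_cong_right) auto
  also have "\<dots> \<le> (\<Sum>j<J. exp (- 5 * (real j)\<^sup>2) * (C * ((real j + 1) / A) powr s))"
    using A by (intro sum_mono mult_left_mono frost divide_right_mono) auto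
  also have "\<dots> = C * A powr (- s) * (\<Sum>j<J. exp (- 5 * (real j)\<^sup>2) * (real j + 1) powr s)"
    unfolding sum_distrib_left using A by (intro sum.cong refl) (simp add: powr_divide powr_minus field_simps)
  also have "\<dots> \<le> C * A powr (- s) * (exp ((s + 1)\<^sup>2 / 20) / (1 - exp (- 1)))"
    using C by (intro mult_left_mono gaussian_shell_sum s) auto
  finally show ?thesis by (simp add: mult_ac)
qed

section \<open>Non-degeneracy: the inner products do not concentrate at 0\<close>

text \<open>The right-hand sum is the squared Frobenius norm of the matrix
  \<open>\<Sum> m x m y (x - y) (x - y)\<^sup>T\<close>, the left-hand one its trace.\<close>

lemma sum_inner_sq_ge:
  fixes P :: "'a::euclidean_space set" and m :: "'a \<Rightarrow> real"
  shows "(\<Sum>x\<in>P. \<Sum>y\<in>P. m x * m y * (norm (x - y))\<^sup>2)\<^sup>2 \<le>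
     real DIM('a) * (\<Sum>x\<in>P. \<Sum>y\<in>P. \<Sum>z\<in>P. \<Sum>w\<in>P. m x * m y * m z * m w * ((x - y) \<bullet> (z - w))\<^sup>2)"
proof -
  define t where "t = (\<lambda>b c. \<Sum>x\<in>P. \<Sum>y\<in>P. m x * m y * (((x - y) \<bullet> b) * ((x - y) \<bullet> c)))"
  have tr: "(\<Sum>x\<in>P. \<Sum>y\<in>P. m x * m y * (norm (x - y))\<^sup>2) = (\<Sum>b\<in>Basis. t b b)"
  proof -
    have "(norm v)\<^sup>2 = (\<Sum>b\<in>Basis. (v \<bullet> b) * (v \<bullet> b))" for v :: 'a
      by (simp add: power2_norm_eq_inner euclidean_inner[of v v])
    then show ?thesis
      unfolding t_def by (simp add: sum_distrib_left sum.swap[of _ P Basis])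
  qed
  have inner2: "(u \<bullet> v)\<^sup>2 = (\<Sum>b\<in>Basis. \<Sum>c\<in>Basis. ((u \<bullet> b) * (u \<bullet> c)) * ((v \<bullet> b) * (v \<bullet> c)))" for u v :: 'a
    unfolding power2_eq_square euclidean_inner[of u v] sum_product by (simp add: mult_ac)
  have "(\<Sum>x\<in>P. \<Sum>y\<in>P. \<Sum>z\<in>P. \<Sum>w\<in>P. m x * m y * m z * m w * ((x - y) \<bullet> (z - w))\<^sup>2)
     = (\<Sum>b\<in>Basis. \<Sum>c\<in>Basis. (t b c)\<^sup>2)"
  proof -
    have "(\<Sum>b\<in>Basis. \<Sum>c\<in>Basis. (t b c)\<^sup>2) = (\<Sum>b\<in>Basis. \<Sum>c\<in>Basis. \<Sum>x\<in>P. \<Sum>y\<in>P. \<Sum>z\<in>P. \<Sum>w\<in>P.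
        m x * m y * m z * m w * ((((x - y) \<bullet> b) * ((x - y) \<bullet> c)) * (((z - w) \<bullet> b) * ((z - w) \<bullet> c))))"
      unfolding t_def power2_eq_square sum_distrib_left sum_distrib_right by (simp add: mult_ac)
    also have "\<dots> = (\<Sum>x\<in>P. \<Sum>y\<in>P. \<Sum>z\<in>P. \<Sum>w\<in>P. m x * m y * m z * m w * ((x - y) \<bullet> (z - w))\<^sup>2)"
      unfolding inner2 sum_distrib_left
      by (simp only: sum.swap[of _ P Basis])
    finally show ?thesis by simp
  qed
  \<comment> \<open>Cauchy-Schwarz for the diagonal; adding the squares of the off-diagonal entries
    then gives the Frobenius norm.\<close>
  moreover have "(\<Sum>b\<in>Basis. t b b)\<^sup>2 \<le> real DIM('a) * (\<Sum>b\<in>Basis. (t b b)\<^sup>2)"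
    using Cauchy_Schwarz_ineq_sum[of "\<lambda>_. 1" "\<lambda>b. t b b" "Basis::'a set"] by simp
  moreover have "(\<Sum>b\<in>Basis. (t b b)\<^sup>2) \<le> (\<Sum>b\<in>Basis. \<Sum>c\<in>Basis. (t b c)\<^sup>2)"
    by (intro sum_mono member_le_sum) auto
  ultimately show ?thesis
    unfolding tr by (smt (verit) mult_left_mono of_nat_0_le_iff)
qed

text \<open>Around every point at least half of the mass lies farther away than
  \<open>\<rho>\<close>, so the mean of |x - y|^2 is at least \<open>\<rho>\<^sup>2 / 2\<close>; the
  trace inequality passes from this to the inner products.\<close>

lemma fourth_moment_positive:
  fixes P :: "'a::euclidean_space set" and m :: "'a \<Rightarrow> real"
  assumes fin: "finite P" and m: "\<And>y. 0 \<le> m y" and m1: "(\<Sum>x\<in>P. m x) = 1" and \<rho>: "0 < \<rho>"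
    and half: "\<And>x. (\<Sum>y\<in>{y\<in>P. dist x y \<le> \<rho>}. m y) \<le> 1 / 2"
  shows "\<rho> ^ 4 / (4 * real DIM('a)) \<le> (\<Sum>x\<in>P. \<Sum>y\<in>P. \<Sum>z\<in>P. \<Sum>w\<in>P. m x * m y * m z * m w * ((x - y) \<bullet> (z - w))\<^sup>2)"
proof -
  have "\<rho>\<^sup>2 / 2 \<le> (\<Sum>y\<in>P. m y * (norm (x - y))\<^sup>2)" for x
  proof -
    have "1 = (\<Sum>y\<in>{y\<in>P. dist x y \<le> \<rho>}. m y) + (\<Sum>y\<in>{y\<in>P. \<not> dist x y \<le> \<rho>}. m y)"
      unfolding m1[symmetric] using fin by (subst sum.union_disjoint[symmetric]) (auto intro!: sum.cong)
    then have "1 / 2 \<le> (\<Sum>y\<in>{y\<in>P. \<not> dist x y \<le> \<rho>}. m y)" using half[of x] by linarith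
    then have "1 / 2 * \<rho>\<^sup>2 \<le> (\<Sum>y\<in>{y\<in>P. \<not> dist x y \<le> \<rho>}. m y) * \<rho>\<^sup>2"
      by (rule mult_right_mono) simp
    also have "\<dots> \<le> (\<Sum>y\<in>{y\<in>P. \<not> dist x y \<le> \<rho>}. m y * (norm (x - y))\<^sup>2)"
      unfolding sum_distrib_right using m \<rho> by (intro sum_mono mult_left_mono power_mono) (auto simp: dist_norm)
    also have "\<dots> \<le> (\<Sum>y\<in>P. m y * (norm (x - y))\<^sup>2)"
      using fin m by (intro sum_mono2) auto
    finally show ?thesis by simp
  qed
  then have "(\<Sum>x\<in>P. m x * (\<rho>\<^sup>2 / 2)) \<le> (\<Sum>x\<in>P. m x * (\<Sum>y\<in>P. m y * (norm (x - y))\<^sup>2))"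
    using m by (intro sum_mono mult_left_mono) auto
  then have "\<rho>\<^sup>2 / 2 \<le> (\<Sum>x\<in>P. \<Sum>y\<in>P. m x * m y * (norm (x - y))\<^sup>2)"
    unfolding sum_distrib_right[symmetric] m1 by (simp add: sum_distrib_left mult_ac)
  then have "(\<rho>\<^sup>2 / 2)\<^sup>2 \<le> (\<Sum>x\<in>P. \<Sum>y\<in>P. m x * m y * (norm (x - y))\<^sup>2)\<^sup>2"
    by (intro power_mono) auto
  also note sum_inner_sq_ge
  finally show ?thesis
    by (simp add: field_simps power_divide power2_eq_square power4_eq_xxxx)
qed

subsection \<open>Fejer means\<close>

text \<open>The integral of \<open>cos (t * x)\<close> over \<open>t\<close> from 0 to
  \<open>T\<close>, for \<open>T \<ge> 0\<close>.\<close>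

definition dirichlet_int :: "real \<Rightarrow> real \<Rightarrow> real" where
  "dirichlet_int T x = (if x = 0 then T else sin (T * x) / x)"

text \<open>The average of \<open>dirichlet_int T x\<close> over \<open>T\<close> in
  \<open>{0..N}\<close>, for \<open>N > 0\<close>: the Fejer kernel of the line up to
  normalisation.\<close>

definition fejer_mean :: "real \<Rightarrow> real \<Rightarrow> real" where
  "fejer_mean N x = (if x = 0 then N / 2 else (1 - cos (N * x)) / (N * x\<^sup>2))"

lemma dirichlet_int_deriv: "((\<lambda>T. dirichlet_int T x) has_real_derivative cos (T * x)) (at T)"
  unfolding dirichlet_int_def by (cases "x = 0") (auto intro!: derivative_eq_intros)

lemma has_integral_cos:
  assumes "A \<le> B"
  shows "((\<lambda>t. cos (t * x)) has_integral (dirichlet_int B x - dirichlet_int A x)) {A..B}"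
  using dirichlet_int_deriv assms
  by (intro fundamental_theorem_of_calculus)
     (auto simp: has_real_derivative_iff_has_vector_derivative[symmetric] intro: DERIV_subset)

lemma Re_integral_cis:
  assumes "A \<le> B"
  shows "Re (integral {A..B} (\<lambda>t. cis (t * x))) = dirichlet_int B x - dirichlet_int A x"
proof -
  have "(\<lambda>t. cis (t * x)) integrable_on {A..B}"
    by (intro integrable_continuous_real continuous_intros)
  from has_integral_linear[OF integrable_integral[OF this] bounded_linear_Re]
  have "((\<lambda>t. cos (t * x)) has_integral Re (integral {A..B} (\<lambda>t. cis (t * x)))) {A..B}"
    by (simp add: o_def)
  then show ?thesis using has_integral_cos[OF assms] by (rule has_integral_unique)
qed

lemma dirichlet_int_0 [simp]: "dirichlet_int 0 x = 0"
  by (simp add: dirichlet_int_def)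

lemma abs_dirichlet_int_le:
  assumes "0 \<le> T"
  shows "\<bar>dirichlet_int T x\<bar> \<le> T"
  using has_integral_bound[of 1 "\<lambda>t. cos (t * x)" "dirichlet_int T x" 0 T] has_integral_cos[of 0 T x] assms
  by (simp add: cbox_interval)

lemma dirichlet_int_lipschitz:
  assumes "0 \<le> T"
  shows "\<bar>dirichlet_int T x - dirichlet_int T y\<bar> \<le> T\<^sup>2 * \<bar>x - y\<bar>"
proof -
  have "\<bar>cos (t * x) - cos (t * y)\<bar> \<le> T * \<bar>x - y\<bar>" if "t \<in> {0..T}" for t
  proof -
    have lip: "\<bar>cos u - cos v\<bar> \<le> \<bar>u - v\<bar>" for u v :: real
    proof -
      have "cos u - cos v = 2 * sin ((u + v) / 2) * sin ((v - u) / 2)" by (rule cos_diff_cos)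
      then have "\<bar>cos u - cos v\<bar> = 2 * \<bar>sin ((u + v) / 2)\<bar> * \<bar>sin ((v - u) / 2)\<bar>"
        by (simp add: abs_mult)
      also have "\<dots> \<le> 2 * 1 * \<bar>(v - u) / 2\<bar>"
        by (intro mult_mono abs_sin_x_le_abs_x) auto
      finally show ?thesis by simp
    qed
    have "\<bar>cos (t * x) - cos (t * y)\<bar> \<le> \<bar>t * x - t * y\<bar>" by (rule lip)
    also have "\<dots> = t * \<bar>x - y\<bar>" using that by (simp add: abs_mult flip: right_diff_distrib)
    also have "\<dots> \<le> T * \<bar>x - y\<bar>" using that by (intro mult_right_mono) auto
    finally show ?thesis .
  qed
  moreover have "((\<lambda>t. cos (t * x) - cos (t * y)) has_integral (dirichlet_int T x - dirichlet_int T y)) (cbox 0 T)"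
    using has_integral_diff[OF has_integral_cos[OF assms, of x] has_integral_cos[OF assms, of y]] by simp
  ultimately have "norm (dirichlet_int T x - dirichlet_int T y) \<le> (T * \<bar>x - y\<bar>) * Henstock_Kurzweil_Integration.content (cbox 0 T)"
    using assms by (intro has_integral_bound) auto
  then show ?thesis using assms by (simp add: power2_eq_square mult_ac)
qed

lemma fejer_mean_integral:
  assumes "0 < N"
  shows "((\<lambda>T. dirichlet_int T x) has_integral (N * fejer_mean N x)) {0..N}"
proof -
  define H where "H = (\<lambda>T. if x = 0 then T\<^sup>2 / 2 else - cos (T * x) / x\<^sup>2)"
  have "(H has_real_derivative dirichlet_int T x) (at T)" for T
    unfolding H_def dirichlet_int_def
    by (cases "x = 0") (auto intro!: derivative_eq_intros simp: power2_eq_square)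
  then have "((\<lambda>T. dirichlet_int T x) has_integral (H N - H 0)) {0..N}"
    using assms by (intro fundamental_theorem_of_calculus)
      (auto simp: has_real_derivative_iff_has_vector_derivative[symmetric] intro: DERIV_subset)
  moreover have "H N - H 0 = N * fejer_mean N x"
    using assms by (cases "x = 0") (simp_all add: H_def fejer_mean_def power2_eq_square field_simps)
  ultimately show ?thesis by simp
qed

lemma fejer_mean_nonneg: "0 < N \<Longrightarrow> 0 \<le> fejer_mean N x"
  by (simp add: fejer_mean_def)

lemma fejer_mean_le:
  assumes "0 < N" "0 < \<delta>" "\<delta> \<le> \<bar>x\<bar>"
  shows "fejer_mean N x \<le> 2 / (N * \<delta>\<^sup>2)"
proof -
  have "\<delta>\<^sup>2 \<le> \<bar>x\<bar>\<^sup>2" using assms by (intro power_mono) auto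
  then have "(1 - cos (N * x)) / (N * x\<^sup>2) \<le> 2 / (N * \<delta>\<^sup>2)"
    using assms cos_ge_minus_one[of "N * x"] by (intro frac_le mult_left_mono mult_pos_pos) auto
  then show ?thesis using assms by (auto simp: fejer_mean_def)
qed

text \<open>With y = N x and |y| at most 1, the fourth-order expansion gives 1 - cos y >= y^2/2 -
  y^4/24 >= y^2/4.\<close>

lemma fejer_mean_ge:
  assumes "0 < N" "\<bar>x\<bar> \<le> 1 / N"
  shows "N / 4 \<le> fejer_mean N x"
proof (cases "x = 0")
  case False
  define y where "y = N * x"
  have y: "\<bar>y\<bar> \<le> 1" using assms by (simp add: y_def abs_mult field_simps)
  obtain t where "cos y = (\<Sum>m<4. cos_coeff m * y ^ m) + cos (t + 1/2 * real 4 * pi) / fact 4 * y ^ 4"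
    using Maclaurin_cos_expansion[of y 4] by blast
  moreover have "(\<Sum>m<4. cos_coeff m * y ^ m) = 1 - y\<^sup>2 / 2"
  proof -
    have "cos_coeff 0 = 1" "cos_coeff 1 = 0" "cos_coeff 2 = - 1 / 2" "cos_coeff 3 = 0"
      by (simp_all add: cos_coeff_def)
    moreover have "{..<4} = {0, 1, 2, 3::nat}" by auto
    ultimately show ?thesis by simp
  qed
  moreover have "cos (t + 1/2 * real 4 * pi) / fact 4 * y ^ 4 \<le> 1 / 24 * y ^ 4"
    by (intro mult_right_mono) (auto simp: fact_numeral)
  moreover have "y ^ 4 \<le> y\<^sup>2"
  proof -
    have "y\<^sup>2 * y\<^sup>2 \<le> 1 * y\<^sup>2" using y by (intro mult_right_mono) (auto simp: abs_square_le_1)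
    then show ?thesis by (simp add: power2_eq_square power4_eq_xxxx)
  qed
  ultimately have "y\<^sup>2 / 4 \<le> 1 - cos y" using zero_le_power2[of y] by linarith
  then have "(y\<^sup>2 / 4) / (N * x\<^sup>2) \<le> (1 - cos y) / (N * x\<^sup>2)"
    using assms by (intro divide_right_mono) auto
  moreover have "(y\<^sup>2 / 4) / (N * x\<^sup>2) = N / 4"
    using False assms by (simp add: y_def power2_eq_square)
  moreover have "fejer_mean N x = (1 - cos y) / (N * x\<^sup>2)"
    using False by (simp add: fejer_mean_def y_def)
  ultimately show ?thesis by linarith
qed (use assms in \<open>simp add: fejer_mean_def\<close>)

section \<open>From dyadic oscillation bounds to interior points\<close>

text \<open>Cut the interval at A, 2 A, 4 A and so on; the pieces decay geometrically with ratio x =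
  2^(-epsilon), and \<open>K\<^sub>1 / (1 - x)\<close> is the fixed point of K = K1 + x K. The
  induction counts doublings.\<close>

lemma dyadic_decay_sum:
  fixes w q :: "'k \<Rightarrow> real"
  assumes e: "0 < \<epsilon>" "0 \<le> K\<^sub>1" and fin: "finite K"
    and osc: "\<And>A B. 2 \<le> A \<Longrightarrow> A \<le> B \<Longrightarrow> B \<le> 2 * A \<Longrightarrow> A \<le> N \<Longrightarrow>
        norm (\<Sum>k\<in>K. w k *\<^sub>R integral {A..B} (\<lambda>t. cis (t * (q k - r)))) \<le> K\<^sub>1 * A powr (- \<epsilon>)"
    and AB: "2 \<le> A" "A \<le> B" "B \<le> N"
  shows "\<bar>(\<Sum>k\<in>K. w k * dirichlet_int B (q k - r)) - (\<Sum>k\<in>K. w k * dirichlet_int A (q k - r))\<bar>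
     \<le> K\<^sub>1 / (1 - 2 powr (- \<epsilon>)) * A powr (- \<epsilon>)"
proof -
  define S where "S = (\<lambda>T. \<Sum>k\<in>K. w k * dirichlet_int T (q k - r))"
  define x where "x = (2::real) powr (- \<epsilon>)"
  have x: "0 < x" "x < 1" unfolding x_def using e powr_less_mono[of "- \<epsilon>" 0 2] by auto
  have one: "\<bar>S B - S A\<bar> \<le> K\<^sub>1 * A powr (- \<epsilon>)" if "2 \<le> A" "A \<le> B" "B \<le> 2 * A" "A \<le> N" for A B
  proof -
    have eq: "S B - S A = Re (\<Sum>k\<in>K. w k *\<^sub>R integral {A..B} (\<lambda>t. cis (t * (q k - r))))"
      unfolding S_def sum_subtractf[symmetric] Re_sum scaleR_complex.sel Re_integral_cis[OF that(2)]
      by (rule sum.cong) (simp_all add: right_diff_distrib)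
    show ?thesis unfolding eq by (rule order_trans[OF abs_Re_le_cmod osc[OF that]])
  qed
  have "\<bar>S B - S A\<bar> \<le> K\<^sub>1 / (1 - x) * A powr (- \<epsilon>)" if "2 \<le> A" "A \<le> B" "B \<le> N" "B \<le> 2 ^ j * A" for A B j
    using that
  proof (induction j arbitrary: A)
    case 0
    then have "B = A" by simp
    then show ?case using e x by simp
  next
    case (Suc j)
    have le1: "K\<^sub>1 \<le> K\<^sub>1 / (1 - x)" using x e by (simp add: field_simps)
    show ?case
    proof (cases "B \<le> 2 * A")
      case True
      then have "\<bar>S B - S A\<bar> \<le> K\<^sub>1 * A powr (- \<epsilon>)" using Suc.prems by (intro one) auto
      also have "\<dots> \<le> K\<^sub>1 / (1 - x) * A powr (- \<epsilon>)" by (intro mult_right_mono le1) auto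
      finally show ?thesis .
    next
      case False
      have "\<bar>S B - S (2 * A)\<bar> \<le> K\<^sub>1 / (1 - x) * (2 * A) powr (- \<epsilon>)"
        using Suc.prems False by (intro Suc.IH) auto
      also have "(2 * A) powr (- \<epsilon>) = x * A powr (- \<epsilon>)"
        using Suc.prems by (simp add: x_def powr_mult)
      finally have "\<bar>S B - S (2 * A)\<bar> \<le> K\<^sub>1 / (1 - x) * (x * A powr (- \<epsilon>))" .
      moreover have "\<bar>S (2 * A) - S A\<bar> \<le> K\<^sub>1 * A powr (- \<epsilon>)"
        using Suc.prems False by (intro one) auto
      moreover have "K\<^sub>1 / (1 - x) * (x * A powr (- \<epsilon>)) + K\<^sub>1 * A powr (- \<epsilon>) = K\<^sub>1 / (1 - x) * A powr (- \<epsilon>)"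
        using x by (simp add: field_simps)
      ultimately show ?thesis by linarith
    qed
  qed
  moreover obtain j where "B / A < 2 ^ j" using real_arch_pow[of 2 "B / A"] by auto
  then have "B \<le> 2 ^ j * A" using AB by (simp add: field_simps)
  ultimately show ?thesis using AB unfolding S_def x_def by blast
qed

text \<open>The Fejer sum is the average over \<open>{0..N}\<close> of the Dirichlet sums. Above
  \<open>T\<^sub>1\<close> these differ from the one at \<open>T\<^sub>1\<close> by at most
  \<open>e\<close>; below, the crude bound \<open>2 * T\<^sub>1\<close> on an interval of length
  \<open>T\<^sub>1\<close> contributes \<open>2 * T\<^sub>1\<^sup>2 / N\<close> to the
  average.\<close>

lemma fejer_sum_near_dirichlet_sum:
  fixes w q :: "'k \<Rightarrow> real"
  assumes fin: "finite K" and w: "\<And>k. k \<in> K \<Longrightarrow> 0 \<le> w k" "(\<Sum>k\<in>K. w k) \<le> 1"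
    and T: "0 < T\<^sub>1" "T\<^sub>1 \<le> N" and e: "0 \<le> e"
    and cauchy: "\<And>T. T\<^sub>1 \<le> T \<Longrightarrow> T \<le> N \<Longrightarrow>
       \<bar>(\<Sum>k\<in>K. w k * dirichlet_int T (x k)) - (\<Sum>k\<in>K. w k * dirichlet_int T\<^sub>1 (x k))\<bar> \<le> e"
  shows "\<bar>(\<Sum>k\<in>K. w k * fejer_mean N (x k)) - (\<Sum>k\<in>K. w k * dirichlet_int T\<^sub>1 (x k))\<bar> \<le> 2 * T\<^sub>1\<^sup>2 / N + e"
proof -
  define S where "S = (\<lambda>T. \<Sum>k\<in>K. w k * dirichlet_int T (x k))"
  define F where "F = (\<Sum>k\<in>K. w k * fejer_mean N (x k))"
  have N: "N > 0" using T by simp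
  have S_le: "\<bar>S T\<bar> \<le> T" if "0 \<le> T" for T
  proof -
    have "\<bar>S T\<bar> \<le> (\<Sum>k\<in>K. \<bar>w k * dirichlet_int T (x k)\<bar>)" unfolding S_def by (rule sum_abs)
    also have "\<dots> \<le> (\<Sum>k\<in>K. w k * T)"
      using abs_dirichlet_int_le[OF that] w by (intro sum_mono) (auto simp: abs_mult intro!: mult_left_mono)
    also have "\<dots> \<le> 1 * T" unfolding sum_distrib_right[symmetric] using w that by (intro mult_right_mono) auto
    finally show ?thesis by simp
  qed
  have "(S has_integral (\<Sum>k\<in>K. w k * (N * fejer_mean N (x k)))) {0..N}"
    unfolding S_def using fin N by (intro has_integral_sum has_integral_mult_right fejer_mean_integral)
  then have intS: "(S has_integral (N * F)) {0..N}"
    by (simp add: F_def sum_distrib_left mult_ac)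
  have "((\<lambda>T. S T - S T\<^sub>1) has_integral (N * F - N * S T\<^sub>1)) {0..N}"
    using has_integral_diff[OF intS has_integral_const_real[of "S T\<^sub>1" 0 N]] N by simp
  then have int: "((\<lambda>T. S T - S T\<^sub>1) has_integral (N * F - N * S T\<^sub>1)) (cbox 0 N)" by simp
  have i1: "(\<lambda>T. S T - S T\<^sub>1) integrable_on {0..T\<^sub>1}" and i2: "(\<lambda>T. S T - S T\<^sub>1) integrable_on {T\<^sub>1..N}"
    using int T by (auto intro: integrable_subinterval_real[of _ 0 N])
  have "N * F - N * S T\<^sub>1 = integral {0..T\<^sub>1} (\<lambda>T. S T - S T\<^sub>1) + integral {T\<^sub>1..N} (\<lambda>T. S T - S T\<^sub>1)"
    using integral_unique[OF int] Henstock_Kurzweil_Integration.integral_combine[of 0 T\<^sub>1 N "\<lambda>T. S T - S T\<^sub>1"] int T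
    by auto
  moreover have "norm (integral {0..T\<^sub>1} (\<lambda>T. S T - S T\<^sub>1)) \<le> (2 * T\<^sub>1) * Henstock_Kurzweil_Integration.content (cbox 0 T\<^sub>1)"
  proof (rule has_integral_bound)
    show "norm (S t - S T\<^sub>1) \<le> 2 * T\<^sub>1" if "t \<in> cbox 0 T\<^sub>1" for t
      using S_le[of t] S_le[of T\<^sub>1] that T by auto
  qed (use T i1 in \<open>auto intro: integrable_integral\<close>)
  moreover have "norm (integral {T\<^sub>1..N} (\<lambda>T. S T - S T\<^sub>1)) \<le> e * Henstock_Kurzweil_Integration.content (cbox T\<^sub>1 N)"
  proof (rule has_integral_bound)
    show "norm (S t - S T\<^sub>1) \<le> e" if "t \<in> cbox T\<^sub>1 N" for t
      using cauchy[of t] that by (auto simp: S_def)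
  qed (use e i2 in \<open>auto intro: integrable_integral\<close>)
  moreover have "e * (N - T\<^sub>1) \<le> e * N" using e T by (intro mult_left_mono) auto
  ultimately have "\<bar>N * F - N * S T\<^sub>1\<bar> \<le> 2 * T\<^sub>1\<^sup>2 + e * N"
    using T by (simp add: power2_eq_square)
  then have "N * \<bar>F - S T\<^sub>1\<bar> \<le> N * (2 * T\<^sub>1\<^sup>2 / N + e)"
  proof -
    have "N * \<bar>F - S T\<^sub>1\<bar> = \<bar>N * (F - S T\<^sub>1)\<bar>" using N by (simp add: abs_mult)
    moreover have "N * (2 * T\<^sub>1\<^sup>2 / N + e) = 2 * T\<^sub>1\<^sup>2 + e * N" using N by (simp add: distrib_left mult.commute)
    ultimately show ?thesis using \<open>\<bar>N * F - N * S T\<^sub>1\<bar> \<le> _\<close> by (simp only: right_diff_distrib)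
  qed
  then show ?thesis using N unfolding F_def S_def by simp
qed

text \<open>Averaging over a grid of spacing 1/N: every \<open>k\<close> with
  \<open>3 * r\<^sub>1 \<le> \<bar>q k\<bar>\<close> receives at least \<open>N / 4\<close> from one
  grid point close to \<open>q k\<close>, while there are at most \<open>4 * N * (R + 1)\<close>
  grid points. Hence some grid point has a sum of at least the average.\<close>

lemma exists_large_fejer_sum:
  fixes w q :: "'k \<Rightarrow> real"
  assumes fin: "finite K" and w: "\<And>k. k \<in> K \<Longrightarrow> 0 \<le> w k"
    and R: "\<And>k. k \<in> K \<Longrightarrow> \<bar>q k\<bar> \<le> R" "0 \<le> R" and r: "0 < r\<^sub>1" and c1: "0 < c\<^sub>1"
    and mass: "c\<^sub>1 \<le> (\<Sum>k\<in>{k\<in>K. 3 * r\<^sub>1 \<le> \<bar>q k\<bar>}. w k)" and N: "1 \<le> N" "1 / r\<^sub>1 \<le> N"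
  shows "\<exists>r. 2 * r\<^sub>1 \<le> \<bar>r\<bar> \<and> \<bar>r\<bar> \<le> R + 1 \<and> c\<^sub>1 / (16 * (R + 1)) \<le> (\<Sum>k\<in>K. w k * fejer_mean N (q k - r))"
proof (rule ccontr)
  assume "\<not> ?thesis"
  then have small: "(\<Sum>k\<in>K. w k * fejer_mean N (q k - r)) < c\<^sub>1 / (16 * (R + 1))" if "2 * r\<^sub>1 \<le> \<bar>r\<bar>" "\<bar>r\<bar> \<le> R + 1" for r
    using that by force
  define M where "M = \<lfloor>N * (R + 1)\<rfloor>"
  define I where "I = {i\<in>{- M..M}. 2 * r\<^sub>1 \<le> \<bar>real_of_int i / N\<bar>}"
  define K' where "K' = {k\<in>K. 3 * r\<^sub>1 \<le> \<bar>q k\<bar>}"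
  have N0: "N > 0" using N by simp
  have M: "1 \<le> M" "real_of_int M \<le> N * (R + 1)"
  proof -
    have "1 * 1 \<le> N * (R + 1)" using N R by (intro mult_mono) auto
    then show "1 \<le> M" unfolding M_def by simp
    show "real_of_int M \<le> N * (R + 1)" unfolding M_def by simp
  qed
  have I_range: "2 * r\<^sub>1 \<le> \<bar>real_of_int i / N\<bar>" "\<bar>real_of_int i / N\<bar> \<le> R + 1" if "i \<in> I" for i
  proof -
    have "\<bar>real_of_int i\<bar> \<le> real_of_int M" using that unfolding I_def by auto
    then have "\<bar>real_of_int i\<bar> \<le> N * (R + 1)" using M by linarith
    then show "\<bar>real_of_int i / N\<bar> \<le> R + 1" using N0 by (simp add: field_simps)
  qed (use that in \<open>auto simp: I_def\<close>)
  have finI: "finite I" unfolding I_def by (rule finite_subset[of _ "{- M..M}"]) auto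
  have low: "N / 4 \<le> (\<Sum>i\<in>I. fejer_mean N (q k - real_of_int i / N))" if k: "k \<in> K'" for k
  proof -
    \<comment> \<open>The grid point just below \<open>q k\<close>; moving by at most 1/N, hence by
      at most \<open>r\<^sub>1\<close>, turns the margin \<open>3 * r\<^sub>1\<close> into
      \<open>2 * r\<^sub>1\<close>.\<close>
    define i where "i = \<lfloor>N * q k\<rfloor>"
    have i: "real_of_int i \<le> N * q k" "N * q k < real_of_int i + 1" unfolding i_def by linarith+
    have "\<bar>q k - real_of_int i / N\<bar> = \<bar>N * q k - real_of_int i\<bar> / N"
      using N0 by (simp add: field_simps)
    also have "\<dots> \<le> 1 / N" using N0 i by (intro divide_right_mono) auto
    finally have d: "\<bar>q k - real_of_int i / N\<bar> \<le> 1 / N" .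
    have r1N: "1 / N \<le> r\<^sub>1" using N r N0 by (simp add: field_simps)
    have "2 * r\<^sub>1 \<le> \<bar>real_of_int i / N\<bar>" using k d r1N unfolding K'_def mem_Collect_eq by linarith
    moreover have "i \<in> {- M..M}"
    proof -
      have "\<bar>N * q k\<bar> \<le> N * R" using R(1)[of k] k N0 unfolding K'_def by (simp add: abs_mult)
      then have "\<bar>real_of_int i\<bar> \<le> N * R + 1" using i by linarith
      also have "\<dots> \<le> N * (R + 1)" using N by (simp add: distrib_left)
      finally have "\<bar>i\<bar> \<le> M" unfolding M_def by (simp add: le_floor_iff)
      then show ?thesis by auto
    qed
    ultimately have "i \<in> I" unfolding I_def by simp
    have "N / 4 \<le> fejer_mean N (q k - real_of_int i / N)" by (rule fejer_mean_ge[OF N0 d])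
    also have "\<dots> \<le> (\<Sum>i\<in>I. fejer_mean N (q k - real_of_int i / N))"
      using \<open>i \<in> I\<close> finI N0 by (intro member_le_sum) (auto intro: fejer_mean_nonneg)
    finally show ?thesis .
  qed
  have nonempty: "I \<noteq> {}"
  proof -
    have "K' \<noteq> {}" using mass c1 unfolding K'_def[symmetric] by auto
    then show ?thesis using low N0 by fastforce
  qed
  have "(\<Sum>k\<in>K'. w k) * (N / 4) \<le> (\<Sum>k\<in>K'. w k * (\<Sum>i\<in>I. fejer_mean N (q k - real_of_int i / N)))"
    unfolding sum_distrib_right using w low by (intro sum_mono mult_left_mono) (auto simp: K'_def)
  also have "\<dots> \<le> (\<Sum>k\<in>K. w k * (\<Sum>i\<in>I. fejer_mean N (q k - real_of_int i / N)))"
    using fin w N0 by (intro sum_mono2) (auto simp: K'_def intro!: mult_nonneg_nonneg sum_nonneg fejer_mean_nonneg)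
  also have "\<dots> = (\<Sum>i\<in>I. \<Sum>k\<in>K. w k * fejer_mean N (q k - real_of_int i / N))"
    unfolding sum_distrib_left by (rule sum.swap)
  also have "\<dots> < (\<Sum>i\<in>I. c\<^sub>1 / (16 * (R + 1)))"
    using nonempty finI small I_range by (intro sum_strict_mono) auto
  also have "\<dots> = real (card I) * (c\<^sub>1 / (16 * (R + 1)))" by simp
  also have "\<dots> \<le> (4 * N * (R + 1)) * (c\<^sub>1 / (16 * (R + 1)))"
  proof (intro mult_right_mono)
    have "card I \<le> card {- M..M}" unfolding I_def by (intro card_mono) auto
    then have "real (card I) \<le> 2 * real_of_int M + 1" using M(1) by simp
    also have "\<dots> \<le> 4 * real_of_int M" using M(1) by simp
    finally show "real (card I) \<le> 4 * N * (R + 1)" using M(2) by simp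
  qed (use c1 R in simp)
  also have "\<dots> = c\<^sub>1 * (N / 4)" using R by (simp add: field_simps)
  also have "\<dots> \<le> (\<Sum>k\<in>K'. w k) * (N / 4)"
    using mass N0 unfolding K'_def by (intro mult_right_mono) auto
  finally show False by simp
qed

text \<open>The oscillation bounds make the Fejer sums uniformly close to a Lipschitz function whose
  constant \<open>T\<^sub>1\<^sup>2\<close> is independent of \<open>n\<close>. A large value thus
  spreads over a fixed length \<open>l\<close>. If \<open>S\<close> had no interior, every cell of
  that length would contain a point at positive distance from \<open>S\<close>, where the sums
  vanish as \<open>n\<close> grows. All constants but \<open>n\<close> are chosen before the
  measure.\<close>

lemma interior_nonempty_of_oscillation_bounds:
  fixes S :: "real set" and \<epsilon> K\<^sub>1 r\<^sub>1 R c\<^sub>1 :: real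
  assumes S: "closed S" and pars: "0 < \<epsilon>" "0 \<le> K\<^sub>1" "0 < r\<^sub>1" "0 \<le> R" "0 < c\<^sub>1"
    and sys: "\<And>n. \<exists>(K :: 'k set) w q. finite K \<and> (\<forall>k\<in>K. 0 \<le> w k) \<and> (\<Sum>k\<in>K. w k) \<le> 1 \<and>
       (\<forall>k\<in>K. q k \<in> S \<and> \<bar>q k\<bar> \<le> R) \<and> c\<^sub>1 \<le> (\<Sum>k\<in>{k\<in>K. 3 * r\<^sub>1 \<le> \<bar>q k\<bar>}. w k) \<and>
       (\<forall>A B r. 2 \<le> A \<longrightarrow> A \<le> B \<longrightarrow> B \<le> 2 * A \<longrightarrow> A \<le> 2 ^ n \<longrightarrow> r\<^sub>1 \<le> \<bar>r\<bar> \<longrightarrow>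
          norm (\<Sum>k\<in>K. w k *\<^sub>R integral {A..B} (\<lambda>t. cis (t * (q k - r)))) \<le> K\<^sub>1 * A powr (- \<epsilon>))"
  shows "interior S \<noteq> {}"
proof
  assume int: "interior S = {}"
  define c where "c = c\<^sub>1 / (16 * (R + 1))"
  define K\<^sub>2 where "K\<^sub>2 = K\<^sub>1 / (1 - 2 powr (- \<epsilon>))"
  \<comment> \<open>Chosen so that the tail \<open>K\<^sub>2 * T\<^sub>1 powr (- \<epsilon>)\<close>
    is at most \<open>c / 8\<close>.\<close>
  define T\<^sub>1 where "T\<^sub>1 = max 2 ((8 * K\<^sub>2 / c + 1) powr (1 / \<epsilon>))"
  define e where "e = K\<^sub>2 * T\<^sub>1 powr (- \<epsilon>)"
  \<comment> \<open>A move by \<open>l\<close> changes the Lipschitz function by at most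
    \<open>c / 8\<close> and leads from \<open>2 * r\<^sub>1 \<le> \<bar>r\<bar>\<close> to a point
    that is still at least \<open>r\<^sub>1\<close> in absolute value.\<close>
  define l where "l = min r\<^sub>1 (c / (8 * T\<^sub>1\<^sup>2))"
  have c: "c > 0" unfolding c_def using pars by simp
  have "2 powr (- \<epsilon>) < (1::real)" using pars powr_less_mono[of "- \<epsilon>" 0 2] by simp
  then have K2: "K\<^sub>2 \<ge> 0" unfolding K\<^sub>2_def using pars by simp
  have T1: "2 \<le> T\<^sub>1" unfolding T\<^sub>1_def by simp
  have l: "0 < l" "l \<le> r\<^sub>1" "T\<^sub>1\<^sup>2 * l \<le> c / 8"
  proof -
    show "0 < l" "l \<le> r\<^sub>1" unfolding l_def using pars c T1 by auto
    have "T\<^sub>1\<^sup>2 * l \<le> T\<^sub>1\<^sup>2 * (c / (8 * T\<^sub>1\<^sup>2))" unfolding l_def by (intro mult_left_mono) auto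
    then show "T\<^sub>1\<^sup>2 * l \<le> c / 8" using T1 by simp
  qed
  have e: "0 \<le> e" "e \<le> c / 8"
  proof -
    define y where "y = 8 * K\<^sub>2 / c + 1"
    have y: "y > 0" unfolding y_def using K2 c by (simp add: add_nonneg_pos)
    have "T\<^sub>1 powr (- \<epsilon>) \<le> (y powr (1 / \<epsilon>)) powr (- \<epsilon>)"
      unfolding T\<^sub>1_def y_def[symmetric] using pars y by (intro powr_mono2') auto
    also have "\<dots> = 1 / y" using pars y by (simp add: powr_powr powr_minus field_simps)
    finally have "e \<le> K\<^sub>2 * (1 / y)" unfolding e_def using K2 by (intro mult_left_mono) auto
    also have "\<dots> \<le> c / 8" using K2 c y unfolding y_def by (simp add: field_simps)
    finally show "e \<le> c / 8" .
    show "0 \<le> e" unfolding e_def using K2 by simp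
  qed
  define M where "M = \<lceil>(R + 1) / l\<rceil> + 1"
  have "\<exists>\<rho> \<delta>. real_of_int i * l < \<rho> \<and> \<rho> < (real_of_int i + 1) * l \<and> 0 < \<delta> \<and> (\<forall>x\<in>S. \<delta> \<le> \<bar>x - \<rho>\<bar>)" for i
  proof -
    have "\<not> {real_of_int i * l<..<(real_of_int i + 1) * l} \<subseteq> S"
    proof
      assume "{real_of_int i * l<..<(real_of_int i + 1) * l} \<subseteq> S"
      then have "{real_of_int i * l<..<(real_of_int i + 1) * l} \<subseteq> interior S"
        by (simp add: interior_maximal)
      then have "{real_of_int i * l<..<(real_of_int i + 1) * l} = {}" using int by simp
      moreover have "real_of_int i * l < (real_of_int i + 1) * l" using l by (simp add: distrib_right)
      ultimately show False by simp
    qed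
    then obtain \<rho> where "\<rho> \<in> {real_of_int i * l<..<(real_of_int i + 1) * l}" "\<rho> \<notin> S" by blast
    then have \<rho>: "real_of_int i * l < \<rho>" "\<rho> < (real_of_int i + 1) * l" "\<rho> \<notin> S" by simp_all
    have "open (- S)" using S by (rule open_Compl)
    then obtain \<delta> where "\<delta> > 0" "ball \<rho> \<delta> \<subseteq> - S" using \<rho>(3) by (meson ComplI openE)
    then have "\<forall>x\<in>S. \<delta> \<le> \<bar>x - \<rho>\<bar>" by (force simp: dist_real_def abs_minus_commute)
    then show ?thesis using \<rho> \<open>\<delta> > 0\<close> by blast
  qed
  then obtain \<rho> \<delta> where \<rho>: "\<And>i. real_of_int i * l < \<rho> i" "\<And>i. \<rho> i < (real_of_int i + 1) * l"
    and \<delta>: "\<And>i. 0 < \<delta> i" "\<And>i x. x \<in> S \<Longrightarrow> \<delta> i \<le> \<bar>x - \<rho> i\<bar>"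
    by metis
  \<comment> \<open>Finitely many cells meet the range of possible \<open>r\<close>, so one distance
    to \<open>S\<close> serves all of them, before \<open>n\<close> and \<open>r\<close> are
    known.\<close>
  define \<delta>\<^sub>0 where "\<delta>\<^sub>0 = Min (insert 1 (\<delta> ` {- M..M}))"
  have \<delta>0: "0 < \<delta>\<^sub>0" unfolding \<delta>\<^sub>0_def using \<delta>(1) by (subst Min_gr_iff) auto
  have \<delta>0_le: "\<delta>\<^sub>0 \<le> \<delta> i" if "i \<in> {- M..M}" for i unfolding \<delta>\<^sub>0_def using that by (intro Min_le) auto
  \<comment> \<open>Each summand is one demand on \<open>N\<close>: it exceeds
    \<open>T\<^sub>1\<close>, resolves the scale \<open>r\<^sub>1\<close>, makes the averaging error
    small, and makes the kernel at distance \<open>\<delta>\<^sub>0\<close> smaller than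
    \<open>c / 2\<close>.\<close>
  obtain n where n: "1 + T\<^sub>1 + 1 / r\<^sub>1 + 32 * T\<^sub>1\<^sup>2 / c + 4 / (c * \<delta>\<^sub>0\<^sup>2) < 2 ^ n"
    using real_arch_pow[of 2] by fastforce
  define N where "N = (2::real) ^ n"
  have nn: "0 < 1 / r\<^sub>1" "0 < 32 * T\<^sub>1\<^sup>2 / c" "0 < 4 / (c * \<delta>\<^sub>0\<^sup>2)" using pars c T1 \<delta>0 by auto
  have N: "1 \<le> N" "T\<^sub>1 \<le> N" "1 / r\<^sub>1 \<le> N" "32 * T\<^sub>1\<^sup>2 / c \<le> N" "4 / (c * \<delta>\<^sub>0\<^sup>2) < N"
    using n nn T1 unfolding N_def[symmetric] by linarith+
  obtain K :: "'k set" and w q where fin: "finite K" and w': "\<forall>k\<in>K. 0 \<le> w k" and w1: "(\<Sum>k\<in>K. w k) \<le> 1"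
    and q': "\<forall>k\<in>K. q k \<in> S \<and> \<bar>q k\<bar> \<le> R"
    and mass: "c\<^sub>1 \<le> (\<Sum>k\<in>{k\<in>K. 3 * r\<^sub>1 \<le> \<bar>q k\<bar>}. w k)"
    and osc': "\<forall>A B r. 2 \<le> A \<longrightarrow> A \<le> B \<longrightarrow> B \<le> 2 * A \<longrightarrow> A \<le> 2 ^ n \<longrightarrow> r\<^sub>1 \<le> \<bar>r\<bar> \<longrightarrow>
          norm (\<Sum>k\<in>K. w k *\<^sub>R integral {A..B} (\<lambda>t. cis (t * (q k - r)))) \<le> K\<^sub>1 * A powr (- \<epsilon>)"
    using sys[of n] by (elim exE conjE) (rule that)
  have w: "\<And>k. k \<in> K \<Longrightarrow> 0 \<le> w k" "(\<Sum>k\<in>K. w k) \<le> 1" using w' w1 by blast+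
  have q: "\<And>k. k \<in> K \<Longrightarrow> q k \<in> S" "\<And>k. k \<in> K \<Longrightarrow> \<bar>q k\<bar> \<le> R" using q' by blast+
  have osc: "norm (\<Sum>k\<in>K. w k *\<^sub>R integral {A..B} (\<lambda>t. cis (t * (q k - r)))) \<le> K\<^sub>1 * A powr (- \<epsilon>)"
    if "2 \<le> A" "A \<le> B" "B \<le> 2 * A" "A \<le> N" "r\<^sub>1 \<le> \<bar>r\<bar>" for A B r
    using osc'[rule_format, OF that(1,2,3) _ that(5)] that(4) unfolding N_def .
  define F where "F = (\<lambda>r. \<Sum>k\<in>K. w k * fejer_mean N (q k - r))"
  define D where "D = (\<lambda>r. \<Sum>k\<in>K. w k * dirichlet_int T\<^sub>1 (q k - r))"
  have FD: "\<bar>F r - D r\<bar> \<le> 2 * T\<^sub>1\<^sup>2 / N + e" if r: "r\<^sub>1 \<le> \<bar>r\<bar>" for r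
    unfolding F_def D_def
  proof (rule fejer_sum_near_dirichlet_sum[OF fin w])
    show "\<bar>(\<Sum>k\<in>K. w k * dirichlet_int T (q k - r)) - (\<Sum>k\<in>K. w k * dirichlet_int T\<^sub>1 (q k - r))\<bar> \<le> e"
      if "T\<^sub>1 \<le> T" "T \<le> N" for T
      unfolding e_def K\<^sub>2_def
      using dyadic_decay_sum[OF pars(1,2) fin, where N = N and w = w and q = q and r = r and A = T\<^sub>1 and B = T] osc r T1 that by blast
  qed (use T1 N e in auto)
  have Dlip: "\<bar>D r - D r'\<bar> \<le> T\<^sub>1\<^sup>2 * \<bar>r - r'\<bar>" for r r'
  proof -
    have "\<bar>D r - D r'\<bar> = \<bar>\<Sum>k\<in>K. w k * (dirichlet_int T\<^sub>1 (q k - r) - dirichlet_int T\<^sub>1 (q k - r'))\<bar>"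
      unfolding D_def by (simp add: sum_subtractf right_diff_distrib)
    also have "\<dots> \<le> (\<Sum>k\<in>K. \<bar>w k * (dirichlet_int T\<^sub>1 (q k - r) - dirichlet_int T\<^sub>1 (q k - r'))\<bar>)"
      by (rule sum_abs)
    also have "\<dots> \<le> (\<Sum>k\<in>K. w k * (T\<^sub>1\<^sup>2 * \<bar>r - r'\<bar>))"
    proof (intro sum_mono)
      fix k assume k: "k \<in> K"
      have "\<bar>dirichlet_int T\<^sub>1 (q k - r) - dirichlet_int T\<^sub>1 (q k - r')\<bar> \<le> T\<^sub>1\<^sup>2 * \<bar>r - r'\<bar>"
        using dirichlet_int_lipschitz[of T\<^sub>1 "q k - r" "q k - r'"] T1 by (simp add: abs_minus_commute)
      then show "\<bar>w k * (dirichlet_int T\<^sub>1 (q k - r) - dirichlet_int T\<^sub>1 (q k - r'))\<bar> \<le> w k * (T\<^sub>1\<^sup>2 * \<bar>r - r'\<bar>)"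
        using w(1)[OF k] by (simp add: abs_mult mult_left_mono)
    qed
    also have "\<dots> \<le> 1 * (T\<^sub>1\<^sup>2 * \<bar>r - r'\<bar>)"
      unfolding sum_distrib_right[symmetric] using w(2) by (intro mult_right_mono) auto
    finally show ?thesis by simp
  qed
  obtain r where r: "2 * r\<^sub>1 \<le> \<bar>r\<bar>" "\<bar>r\<bar> \<le> R + 1" "c \<le> F r"
    using exists_large_fejer_sum[OF fin w(1) q(2) pars(4,3,5) mass N(1,3)] unfolding F_def c_def by blast
  define i where "i = \<lfloor>r / l\<rfloor>"
  have i: "real_of_int i * l \<le> r" "r < (real_of_int i + 1) * l"
    unfolding i_def using l(1) by (simp_all add: floor_divide_lower floor_divide_upper)
  have r\<rho>: "\<bar>r - \<rho> i\<bar> \<le> l" using i \<rho>[of i] by (auto simp: algebra_simps)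
  have iM: "i \<in> {- M..M}"
  proof -
    have "\<bar>r / l\<bar> \<le> (R + 1) / l" using r(2) l(1) by (simp add: divide_right_mono)
    then have "\<bar>i\<bar> \<le> M" unfolding i_def M_def by linarith
    then show ?thesis by auto
  qed
  have "r\<^sub>1 \<le> \<bar>\<rho> i\<bar>" using r(1) r\<rho> l(2) by linarith
  moreover have "r\<^sub>1 \<le> \<bar>r\<bar>" using r(1) pars(3) by linarith
  ultimately have "\<bar>F (\<rho> i) - D (\<rho> i)\<bar> \<le> 2 * T\<^sub>1\<^sup>2 / N + e" "\<bar>F r - D r\<bar> \<le> 2 * T\<^sub>1\<^sup>2 / N + e"
    by (simp_all add: FD)
  with Dlip[of r "\<rho> i"]
  have "F r - F (\<rho> i) \<le> 2 * (2 * T\<^sub>1\<^sup>2 / N + e) + T\<^sub>1\<^sup>2 * \<bar>r - \<rho> i\<bar>"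
    unfolding distrib_left by linarith
  moreover have "2 * (2 * T\<^sub>1\<^sup>2 / N + e) = 4 * T\<^sub>1\<^sup>2 / N + 2 * e" by simp
  moreover have "T\<^sub>1\<^sup>2 * \<bar>r - \<rho> i\<bar> \<le> T\<^sub>1\<^sup>2 * l" using r\<rho> by (intro mult_left_mono) auto
  moreover have "4 * T\<^sub>1\<^sup>2 / N \<le> c / 8" using N c by (simp add: field_simps)
  \<comment> \<open>The losses are \<open>c / 8\<close> from averaging, \<open>c / 4\<close> from
    the two tails and \<open>c / 8\<close> from the move to \<open>\<rho> i\<close>.\<close>
  ultimately have "c / 2 \<le> F (\<rho> i)" using r(3) l(3) e(2) by linarith
  also have "F (\<rho> i) \<le> (\<Sum>k\<in>K. w k * (2 / (N * \<delta>\<^sub>0\<^sup>2)))"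
    unfolding F_def
  proof (intro sum_mono mult_left_mono w(1))
    fix k assume k: "k \<in> K"
    have "\<delta>\<^sub>0 \<le> \<bar>q k - \<rho> i\<bar>" using \<delta>(2)[OF q(1)[OF k], of i] \<delta>0_le[OF iM] by linarith
    then show "fejer_mean N (q k - \<rho> i) \<le> 2 / (N * \<delta>\<^sub>0\<^sup>2)"
      using N(1) \<delta>0 by (intro fejer_mean_le) auto
  qed
  also have "\<dots> \<le> 1 * (2 / (N * \<delta>\<^sub>0\<^sup>2))"
    unfolding sum_distrib_right[symmetric] using w(2) N(1) by (intro mult_right_mono) auto
  also have "\<dots> < c / 2"
    using N(1,5) c \<delta>0 by (simp add: field_simps)
  finally show False by simp
qed

subsection \<open>The interior of the set of inner products of differences\<close>

lemma sum4_product: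
  fixes f g :: "'a \<Rightarrow> 'a \<Rightarrow> 'b::comm_semiring_1"
  shows "(\<Sum>(x, y, z, w)\<in>P \<times> P \<times> P \<times> P. f x y * g z w) = (\<Sum>x\<in>P. \<Sum>y\<in>P. f x y) * (\<Sum>z\<in>P. \<Sum>w\<in>P. g z w)"
  unfolding sum.cartesian_product' case_prod_conv sum_distrib_right unfolding sum_distrib_left ..

text \<open>Differences of two independent points have the squared modulus of a Fourier transform as
  characteristic function; this is the source of all positivity.\<close>

lemma sum_difference_characters:
  fixes \<xi> :: "'a::real_inner" and m :: "'a \<Rightarrow> real"
  shows "(\<Sum>x\<in>P. \<Sum>y\<in>P. (m x * m y) *\<^sub>R cis (\<xi> \<bullet> (x - y))) = of_real ((norm (\<Sum>x\<in>P. m x *\<^sub>R cis (\<xi> \<bullet> x)))\<^sup>2)"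
proof -
  have "of_real ((norm (\<Sum>x\<in>P. m x *\<^sub>R cis (\<xi> \<bullet> x)))\<^sup>2) = (\<Sum>x\<in>P. m x *\<^sub>R cis (\<xi> \<bullet> x)) * cnj (\<Sum>y\<in>P. m y *\<^sub>R cis (\<xi> \<bullet> y))"
    by (simp only: complex_norm_square)
  also have "\<dots> = (\<Sum>x\<in>P. \<Sum>y\<in>P. (m x *\<^sub>R cis (\<xi> \<bullet> x)) * (m y *\<^sub>R cis (- (\<xi> \<bullet> y))))"
    by (simp add: sum_product cis_cnj)
  also have "\<dots> = (\<Sum>x\<in>P. \<Sum>y\<in>P. (m x * m y) *\<^sub>R cis (\<xi> \<bullet> (x - y)))"
    by (simp add: cis_mult inner_diff_right mult.commute)
  finally show ?thesis ..
qed

text \<open>Because \<open>K\<close> is a product, the character sum is a product of two squared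
  moduli and the Gaussian sum is the square of the energy \<open>U\<close>. With \<open>U\<close> of
  order A^(-s), the powers A^(1/2), A^d and A^(-2 s) combine to the stated exponent.\<close>

lemma frostman_oscillation_bound:
  fixes P :: "'a::euclidean_space set" and m :: "'a \<Rightarrow> real"
  defines "K \<equiv> P \<times> P \<times> P \<times> P"
  defines "w\<^sub>0 \<equiv> (\<lambda>(x, y, z, w). (m x * m y) * (m z * m w))"
  defines "Z \<equiv> (\<lambda>(x, y, z, w). (x - y, z - w))"
  assumes fin: "finite P" and m: "\<And>y. 0 \<le> m y" and m1: "(\<Sum>x\<in>P. m x) = 1" and C: "0 \<le> C" and s: "0 \<le> s"
    and frost: "\<And>x \<rho>. 1 / A \<le> \<rho> \<Longrightarrow> (\<Sum>y\<in>{y\<in>P. dist x y \<le> \<rho>}. m y) \<le> C * \<rho> powr s"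
    and A: "2 \<le> A" "A \<le> B" "B \<le> 2 * A" and r: "0 < r\<^sub>1" "r\<^sub>1 \<le> \<bar>r\<bar>"
  shows "norm (\<Sum>k\<in>K. (w\<^sub>0 k * exp (- (norm (Z k))\<^sup>2 / 2)) *\<^sub>R integral {A..B} (\<lambda>t. cis (t * (fst (Z k) \<bullet> snd (Z k) - r))))
    \<le> ((16 + 4 * real DIM('a) + 16 * pi) / sqrt r\<^sub>1 + 1 / (16 * r\<^sub>1)) * 10 ^ DIM('a)
        * (C * (exp ((s + 1)\<^sup>2 / 20) / (1 - exp (- 1))))\<^sup>2 * A powr (- (2 * s - real DIM('a) - 1 / 2))"
proof -
  define C' where "C' = ((16 + 4 * real DIM('a) + 16 * pi) / sqrt r\<^sub>1 + 1 / (16 * r\<^sub>1)) * 10 ^ DIM('a)"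
  define L where "L = C * (exp ((s + 1)\<^sup>2 / 20) / (1 - exp (- 1)))"
  define U where "U = (\<Sum>x\<in>P. \<Sum>y\<in>P. m x * m y * exp (- 5 * A\<^sup>2 * (norm (x - y))\<^sup>2))"
  have finK: "finite K" unfolding K_def using fin by simp
  have w0: "0 \<le> w\<^sub>0 k" for k unfolding w\<^sub>0_def using m by (auto split: prod.split)
  have C'0: "0 \<le> C'" unfolding C'_def using r by simp
  have pos: "\<exists>\<psi>\<ge>0. (\<Sum>k\<in>K. w\<^sub>0 k *\<^sub>R cis (\<zeta> \<bullet> Z k)) = of_real \<psi>" for \<zeta>
  proof -
    have "(\<Sum>k\<in>K. w\<^sub>0 k *\<^sub>R cis (\<zeta> \<bullet> Z k)) = (\<Sum>(x, y, z, w)\<in>P \<times> P \<times> P \<times> P.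
        ((m x * m y) *\<^sub>R cis (fst \<zeta> \<bullet> (x - y))) * ((m z * m w) *\<^sub>R cis (snd \<zeta> \<bullet> (z - w))))"
      unfolding K_def by (intro sum.cong refl) (auto simp: w\<^sub>0_def Z_def inner_prod_def cis_mult)
    also have "\<dots> = of_real ((norm (\<Sum>x\<in>P. m x *\<^sub>R cis (fst \<zeta> \<bullet> x)))\<^sup>2) * of_real ((norm (\<Sum>x\<in>P. m x *\<^sub>R cis (snd \<zeta> \<bullet> x)))\<^sup>2)"
      unfolding sum4_product sum_difference_characters ..
    also have "\<dots> = of_real ((norm (\<Sum>x\<in>P. m x *\<^sub>R cis (fst \<zeta> \<bullet> x)))\<^sup>2 * (norm (\<Sum>x\<in>P. m x *\<^sub>R cis (snd \<zeta> \<bullet> x)))\<^sup>2)"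
      by (rule of_real_mult[symmetric])
    finally have "(\<Sum>k\<in>K. w\<^sub>0 k *\<^sub>R cis (\<zeta> \<bullet> Z k)) = of_real ((norm (\<Sum>x\<in>P. m x *\<^sub>R cis (fst \<zeta> \<bullet> x)))\<^sup>2 * (norm (\<Sum>x\<in>P. m x *\<^sub>R cis (snd \<zeta> \<bullet> x)))\<^sup>2)" .
    moreover have "0 \<le> (norm (\<Sum>x\<in>P. m x *\<^sub>R cis (fst \<zeta> \<bullet> x)))\<^sup>2 * (norm (\<Sum>x\<in>P. m x *\<^sub>R cis (snd \<zeta> \<bullet> x)))\<^sup>2"
      by simp
    ultimately show ?thesis by blast
  qed
  have "(\<Sum>k\<in>K. w\<^sub>0 k * exp (- 5 * A\<^sup>2 * (norm (Z k))\<^sup>2)) = (\<Sum>(x, y, z, w)\<in>P \<times> P \<times> P \<times> P.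
        (m x * m y * exp (- 5 * A\<^sup>2 * (norm (x - y))\<^sup>2)) * (m z * m w * exp (- 5 * A\<^sup>2 * (norm (z - w))\<^sup>2)))"
    unfolding K_def
    by (intro sum.cong refl) (auto simp: w\<^sub>0_def Z_def norm_Pair exp_add[symmetric] algebra_simps)
  also have "\<dots> = U\<^sup>2"
    unfolding sum4_product U_def power2_eq_square ..
  finally have energy: "(\<Sum>k\<in>K. w\<^sub>0 k * exp (- 5 * A\<^sup>2 * (norm (Z k))\<^sup>2)) = U\<^sup>2" .
  have "U = (\<Sum>x\<in>P. m x * (\<Sum>y\<in>P. m y * exp (- 5 * A\<^sup>2 * (dist x y)\<^sup>2)))"
    unfolding U_def sum_distrib_left by (simp add: dist_norm mult.assoc)
  also have "\<dots> \<le> (\<Sum>x\<in>P. m x * (L * A powr (- s)))"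
    unfolding L_def using A by (intro sum_mono mult_left_mono gaussian_energy_bound fin m C s frost) auto
  also have "\<dots> = L * A powr (- s)"
    unfolding sum_distrib_right[symmetric] m1 by simp
  finally have U: "U \<le> L * A powr (- s)" .
  have U0: "0 \<le> U" unfolding U_def using m by (intro sum_nonneg) auto
  have "U\<^sup>2 \<le> (L * A powr (- s))\<^sup>2" using U U0 by (intro power_mono)
  also have "\<dots> = L\<^sup>2 * A powr (- (2 * s))"
    by (simp add: power_mult_distrib power2_eq_square powr_add[symmetric])
  finally have U2: "U\<^sup>2 \<le> L\<^sup>2 * A powr (- (2 * s))" .
  have "norm (\<Sum>k\<in>K. (w\<^sub>0 k * exp (- (norm (Z k))\<^sup>2 / 2)) *\<^sub>R integral {A..B} (\<lambda>t. cis (t * (fst (Z k) \<bullet> snd (Z k) - r))))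
    \<le> C' * sqrt A * A ^ DIM('a) * U\<^sup>2"
    using oscillatory_sum_bound[OF finK w0 pos A r] unfolding energy C'_def .
  also have "\<dots> \<le> C' * sqrt A * A ^ DIM('a) * (L\<^sup>2 * A powr (- (2 * s)))"
    using C'0 A by (intro mult_left_mono U2) auto
  also have "\<dots> = C' * L\<^sup>2 * (A powr (1 / 2) * A powr real DIM('a) * A powr (- (2 * s)))"
    using A by (simp add: powr_half_sqrt powr_realpow mult_ac)
  also have "A powr (1 / 2) * A powr real DIM('a) * A powr (- (2 * s)) = A powr (- (2 * s - real DIM('a) - 1 / 2))"
    unfolding powr_add[symmetric] by (rule arg_cong[of _ _ "(powr) A"]) simp
  finally show ?thesis unfolding C'_def L_def .
qed

theorem theorem1p6:
  fixes E :: "'a::euclidean_space set"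
  assumes "compact E"
    and "hausdorff_dim E > real DIM('a) / 2 + 1 / 4"
  shows "interior {(x - y) \<bullet> (z - w) | x y z w. x \<in> E \<and> y \<in> E \<and> z \<in> E \<and> w \<in> E} \<noteq> {}"
proof -
  let ?d = "real DIM('a)"
  define S where "S = {(x - y) \<bullet> (z - w) | x y z w. x \<in> E \<and> y \<in> E \<and> z \<in> E \<and> w \<in> E}"
  \<comment> \<open>Strictly below the dimension, so that the measure of exponent \<open>s\<close>
    is nonzero; strictly above the threshold, so that the decay exponent
    \<open>2 * s - ?d - 1 / 2\<close> is positive.\<close>
  obtain s where s: "?d / 2 + 1 / 4 < s" "s < hausdorff_dim E"
    using dense[OF assms(2)] by blast
  have s0: "0 < s" using s(1) by (simp add: add_nonneg_pos order_le_less_trans[rotated])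
  have H: "hausdorff_measure s E \<noteq> 0"
  proof
    assume "hausdorff_measure s E = 0"
    then have "hausdorff_dim E \<le> s"
      unfolding hausdorff_dim_def using s0 by (intro cInf_lower bdd_belowI[of _ 0]) auto
    then show False using s(2) by simp
  qed
  have bE: "bounded E" using assms(1) by (rule compact_imp_bounded)
  have "compact ((\<lambda>(x, y, z, w). (x - y) \<bullet> (z - w)) ` (E \<times> E \<times> E \<times> E))"
    unfolding split_beta' by (intro compact_continuous_image compact_Times assms(1) continuous_intros)
  moreover have "S = (\<lambda>(x, y, z, w). (x - y) \<bullet> (z - w)) ` (E \<times> E \<times> E \<times> E)"
  proof (intro set_eqI iffI)
    fix v assume "v \<in> S"
    then obtain x y z w where "v = (x - y) \<bullet> (z - w)" "x \<in> E" "y \<in> E" "z \<in> E" "w \<in> E"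
      unfolding S_def by blast
    then show "v \<in> (\<lambda>(x, y, z, w). (x - y) \<bullet> (z - w)) ` (E \<times> E \<times> E \<times> E)"
      by (intro image_eqI[of _ _ "(x, y, z, w)"]) auto
  next
    fix v assume "v \<in> (\<lambda>(x, y, z, w). (x - y) \<bullet> (z - w)) ` (E \<times> E \<times> E \<times> E)"
    then obtain x y z w where "v = (x - y) \<bullet> (z - w)" "x \<in> E" "y \<in> E" "z \<in> E" "w \<in> E" by auto
    then show "v \<in> S" unfolding S_def by blast
  qed
  ultimately have closed: "closed S" by (simp add: compact_imp_closed)
  obtain C where C: "C > 0" and frost: "\<And>n. \<exists>P m. finite P \<and> P \<subseteq> E \<and> (\<forall>p. 0 \<le> m p) \<and> (\<Sum>p\<in>P. m p) = (1::real) \<and>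
     (\<forall>\<rho> x. 1 / 2 ^ n \<le> \<rho> \<longrightarrow> (\<Sum>y\<in>{y\<in>P. dist x y \<le> \<rho>}. m y) \<le> C * \<rho> powr s)"
    using frostman_discrete[OF bE less_imp_le[OF s0] H] by blast
  obtain D where D: "1 \<le> D" "\<And>x y. x \<in> E \<Longrightarrow> y \<in> E \<Longrightarrow> norm (x - y) \<le> D"
  proof -
    have "norm (x - y) \<le> diameter E" if "x \<in> E" "y \<in> E" for x y
      using diameter_bounded_bound[OF bE that] by (simp add: dist_norm)
    then show ?thesis by (intro that[of "max 1 (diameter E)"]) (auto simp: le_max_iff_disj)
  qed
  \<comment> \<open>The radius at which the Frostman bound equals 1/2, as the second moment estimate
    requires.\<close>
  define \<rho> where "\<rho> = (1 / (2 * C)) powr (1 / s)"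
  have \<rho>: "0 < \<rho>" "C * \<rho> powr s = 1 / 2"
    unfolding \<rho>_def using C s0 by (simp_all add: powr_powr)
  obtain n\<^sub>0 where "1 / \<rho> < 2 ^ n\<^sub>0" using real_arch_pow[of 2 "1 / \<rho>"] by auto
  then have n0: "1 / 2 ^ n\<^sub>0 \<le> \<rho>" using \<rho>(1) by (simp add: field_simps)
  \<comment> \<open>The second moment bound for the unweighted measure, times the least value that
    the Gaussian weight takes when both differences have norm at most \<open>D\<close>.\<close>
  define c where "c = exp (- D\<^sup>2) * (\<rho> ^ 4 / (4 * ?d))"
  define R where "R = D\<^sup>2"
  \<comment> \<open>Values below \<open>3 * r\<^sub>1\<close> contribute at most
    \<open>c / 2\<close> to the second moment. The remaining \<open>c / 2\<close> comes from values
    of square at most \<open>R\<^sup>2\<close>, which gives the mass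
    \<open>c\<^sub>1\<close>.\<close>
  define r\<^sub>1 where "r\<^sub>1 = sqrt (c / 2) / 3"
  define c\<^sub>1 where "c\<^sub>1 = c / (2 * R\<^sup>2)"
  define K\<^sub>1 where "K\<^sub>1 = ((16 + 4 * ?d + 16 * pi) / sqrt r\<^sub>1 + 1 / (16 * r\<^sub>1)) * 10 ^ DIM('a)
        * (C * (exp ((s + 1)\<^sup>2 / 20) / (1 - exp (- 1))))\<^sup>2"
  define \<epsilon> where "\<epsilon> = 2 * s - ?d - 1 / 2"
  have c: "c > 0" unfolding c_def using \<rho> by simp
  have R: "1 \<le> R" unfolding R_def using D(1) by simp
  have r1: "r\<^sub>1 > 0" "(3 * r\<^sub>1)\<^sup>2 = c / 2" unfolding r\<^sub>1_def using c by auto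
  have c1: "c\<^sub>1 > 0" unfolding c\<^sub>1_def using c R by simp
  have "interior S \<noteq> {}"
  proof (rule interior_nonempty_of_oscillation_bounds[where 'k = "'a \<times> 'a \<times> 'a \<times> 'a"])
    show "0 < \<epsilon>" unfolding \<epsilon>_def using s(1) by simp
    show "0 \<le> K\<^sub>1" unfolding K\<^sub>1_def using r1 by simp
    show "closed S" "0 < r\<^sub>1" "0 \<le> R" "0 < c\<^sub>1" using closed r1 R c1 by auto
    fix n
    \<comment> \<open>Oscillation is needed for \<open>A\<close> up to 2^n, while the half-mass
      condition also needs the Frostman bound at the fixed radius \<open>\<rho>\<close>.\<close>
    define N where "N = max n n\<^sub>0"
    obtain P m where fin: "finite P" and PE: "P \<subseteq> E" and m0: "\<And>p. 0 \<le> m p" and m1: "(\<Sum>p\<in>P. m p) = (1::real)"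
      and fr: "\<And>\<rho> x. 1 / 2 ^ N \<le> \<rho> \<Longrightarrow> (\<Sum>y\<in>{y\<in>P. dist x y \<le> \<rho>}. m y) \<le> C * \<rho> powr s"
      using frost[of N] by blast
    define K where "K = P \<times> P \<times> P \<times> P"
    define w\<^sub>0 where "w\<^sub>0 = (\<lambda>(x, y, z, w). (m x * m y) * (m z * m w))"
    define Z :: "'a \<times> 'a \<times> 'a \<times> 'a \<Rightarrow> 'a \<times> 'a" where "Z = (\<lambda>(x, y, z, w). (x - y, z - w))"
    define w where "w = (\<lambda>k. w\<^sub>0 k * exp (- (norm (Z k))\<^sup>2 / 2))"
    define q where "q = (\<lambda>k. fst (Z k) \<bullet> snd (Z k))"
    have finK: "finite K" unfolding K_def using fin by simp
    have w0: "0 \<le> w\<^sub>0 k" for k unfolding w\<^sub>0_def using m0 by (auto split: prod.split)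
    have w_nonneg: "0 \<le> w k" for k unfolding w_def using w0 by simp
    have "(\<Sum>k\<in>K. w k) \<le> (\<Sum>k\<in>K. w\<^sub>0 k)"
      unfolding w_def using w0 by (intro sum_mono) (simp add: mult_left_le)
    also have "\<dots> = 1"
      using sum4_product[of "\<lambda>x y. m x * m y" "\<lambda>x y. m x * m y" P] 
      unfolding K_def w\<^sub>0_def by (simp add: m1 flip: sum_distrib_left)
    finally have w_sum: "(\<Sum>k\<in>K. w k) \<le> 1" .
    have Zk: "norm (fst (Z k)) \<le> D" "norm (snd (Z k)) \<le> D" "q k \<in> S" if "k \<in> K" for k
    proof -
      obtain a b c e where k: "k = (a, b, c, e)" by (rule prod_cases4)
      then have "a \<in> P" "b \<in> P" "c \<in> P" "e \<in> P"
        using \<open>k \<in> K\<close> unfolding K_def by auto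
      then have "a \<in> E" "b \<in> E" "c \<in> E" "e \<in> E" using PE by auto
      then show "norm (fst (Z k)) \<le> D" "norm (snd (Z k)) \<le> D" "q k \<in> S"
        using D(2) unfolding k Z_def q_def S_def by auto
    qed
    have qR: "\<bar>q k\<bar> \<le> R" if "k \<in> K" for k
    proof -
      have "\<bar>q k\<bar> \<le> norm (fst (Z k)) * norm (snd (Z k))" unfolding q_def by (rule Cauchy_Schwarz_ineq2)
      also have "\<dots> \<le> D * D" using Zk[OF that] D(1) by (intro mult_mono) auto
      finally show ?thesis by (simp add: R_def power2_eq_square)
    qed
    have "1 / 2 ^ N \<le> (1 / 2 ^ n\<^sub>0 :: real)" unfolding N_def by (intro divide_left_mono power_increasing) auto
    then have "1 / 2 ^ N \<le> \<rho>" using n0 by linarith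
    then have half: "(\<Sum>y\<in>{y\<in>P. dist x y \<le> \<rho>}. m y) \<le> 1 / 2" for x
      using fr[of \<rho> x] \<rho>(2) by simp
    have "\<rho> ^ 4 / (4 * ?d) \<le> (\<Sum>k\<in>K. w\<^sub>0 k * (q k)\<^sup>2)"
    proof -
      have "(\<Sum>k\<in>K. w\<^sub>0 k * (q k)\<^sup>2) = (\<Sum>x\<in>P. \<Sum>y\<in>P. \<Sum>z\<in>P. \<Sum>w\<in>P. m x * m y * m z * m w * ((x - y) \<bullet> (z - w))\<^sup>2)"
        unfolding K_def sum.cartesian_product' w\<^sub>0_def q_def Z_def by (simp add: mult.assoc)
      then show ?thesis using fourth_moment_positive[OF fin m0 m1 \<rho>(1) half] by simp
    qed
    then have "c \<le> exp (- D\<^sup>2) * (\<Sum>k\<in>K. w\<^sub>0 k * (q k)\<^sup>2)"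
      unfolding c_def by (intro mult_left_mono) auto
    also have "\<dots> \<le> (\<Sum>k\<in>K. w k * (q k)\<^sup>2)"
      unfolding sum_distrib_left
    proof (intro sum_mono)
      fix k assume k: "k \<in> K"
      have "(norm (fst (Z k)))\<^sup>2 \<le> D\<^sup>2" "(norm (snd (Z k)))\<^sup>2 \<le> D\<^sup>2" using Zk[OF k] by (auto intro: power_mono)
      moreover have "(norm (Z k))\<^sup>2 = (norm (fst (Z k)))\<^sup>2 + (norm (snd (Z k)))\<^sup>2"
        using norm_Pair[of "fst (Z k)" "snd (Z k)"] by simp
      ultimately have "exp (- D\<^sup>2) \<le> exp (- (norm (Z k))\<^sup>2 / 2)" by simp
      then have "exp (- D\<^sup>2) * (w\<^sub>0 k * (q k)\<^sup>2) \<le> exp (- (norm (Z k))\<^sup>2 / 2) * (w\<^sub>0 k * (q k)\<^sup>2)"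
        using w0 by (intro mult_right_mono) auto
      then show "exp (- D\<^sup>2) * (w\<^sub>0 k * (q k)\<^sup>2) \<le> w k * (q k)\<^sup>2" by (simp add: w_def mult_ac)
    qed
    \<comment> \<open>A Chebyshev-type splitting of the second moment at
      \<open>3 * r\<^sub>1\<close>.\<close>
    also have "\<dots> \<le> (\<Sum>k\<in>K. w k * (c / 2) + (if 3 * r\<^sub>1 \<le> \<bar>q k\<bar> then w k * R\<^sup>2 else 0))"
    proof (intro sum_mono)
      fix k assume k: "k \<in> K"
      show "w k * (q k)\<^sup>2 \<le> w k * (c / 2) + (if 3 * r\<^sub>1 \<le> \<bar>q k\<bar> then w k * R\<^sup>2 else 0)"
      proof (cases "3 * r\<^sub>1 \<le> \<bar>q k\<bar>")
        case True
        have "\<bar>q k\<bar>\<^sup>2 \<le> R\<^sup>2" using qR[OF k] by (intro power_mono) auto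
        then have "w k * (q k)\<^sup>2 \<le> w k * R\<^sup>2" using w_nonneg by (intro mult_left_mono) auto
        moreover have "0 \<le> w k * (c / 2)" using w_nonneg[of k] c by simp
        ultimately show ?thesis using True by simp
      next
        case False
        then have "\<bar>q k\<bar>\<^sup>2 \<le> (3 * r\<^sub>1)\<^sup>2" by (intro power_mono) auto
        then have "w k * (q k)\<^sup>2 \<le> w k * (c / 2)" unfolding r1(2) using w_nonneg by (intro mult_left_mono) auto
        then show ?thesis using False by simp
      qed
    qed
    also have "\<dots> = (\<Sum>k\<in>K. w k) * (c / 2) + (\<Sum>k\<in>{k\<in>K. 3 * r\<^sub>1 \<le> \<bar>q k\<bar>}. w k) * R\<^sup>2"
      unfolding sum.distrib sum_distrib_right using finK by (simp add: sum.inter_filter)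
    also have "\<dots> \<le> 1 * (c / 2) + (\<Sum>k\<in>{k\<in>K. 3 * r\<^sub>1 \<le> \<bar>q k\<bar>}. w k) * R\<^sup>2"
      using w_sum c by (intro add_right_mono mult_right_mono) auto
    finally have "c / 2 \<le> (\<Sum>k\<in>{k\<in>K. 3 * r\<^sub>1 \<le> \<bar>q k\<bar>}. w k) * R\<^sup>2" by simp
    then have mass: "c\<^sub>1 \<le> (\<Sum>k\<in>{k\<in>K. 3 * r\<^sub>1 \<le> \<bar>q k\<bar>}. w k)"
      unfolding c\<^sub>1_def using R by (simp add: field_simps)
    have osc: "norm (\<Sum>k\<in>K. w k *\<^sub>R integral {A..B} (\<lambda>t. cis (t * (q k - r)))) \<le> K\<^sub>1 * A powr (- \<epsilon>)"
      if A: "2 \<le> A" "A \<le> B" "B \<le> 2 * A" "A \<le> 2 ^ n" and r: "r\<^sub>1 \<le> \<bar>r\<bar>" for A B r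
    proof -
      have "A \<le> 2 ^ N" using A(4) by (rule order_trans) (simp add: N_def)
      then have "1 / 2 ^ N \<le> 1 / A" using A by (intro divide_left_mono) auto
      then have fr': "(\<Sum>y\<in>{y\<in>P. dist x y \<le> \<rho>}. m y) \<le> C * \<rho> powr s" if "1 / A \<le> \<rho>" for x \<rho>
        using that by (intro fr) linarith
      show ?thesis
        using frostman_oscillation_bound[OF fin m0 m1 less_imp_le[OF C] less_imp_le[OF s0] fr' A(1-3) r1(1) r]
        unfolding w_def q_def K_def w\<^sub>0_def Z_def K\<^sub>1_def \<epsilon>_def by simp
    qed
    show "\<exists>(K :: ('a \<times> 'a \<times> 'a \<times> 'a) set) w q. finite K \<and> (\<forall>k\<in>K. 0 \<le> w k) \<and> (\<Sum>k\<in>K. w k) \<le> 1 \<and>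
       (\<forall>k\<in>K. q k \<in> S \<and> \<bar>q k\<bar> \<le> R) \<and> c\<^sub>1 \<le> (\<Sum>k\<in>{k\<in>K. 3 * r\<^sub>1 \<le> \<bar>q k\<bar>}. w k) \<and>
       (\<forall>A B r. 2 \<le> A \<longrightarrow> A \<le> B \<longrightarrow> B \<le> 2 * A \<longrightarrow> A \<le> 2 ^ n \<longrightarrow> r\<^sub>1 \<le> \<bar>r\<bar> \<longrightarrow>
          norm (\<Sum>k\<in>K. w k *\<^sub>R integral {A..B} (\<lambda>t. cis (t * (q k - r)))) \<le> K\<^sub>1 * A powr (- \<epsilon>))"
      using finK w_nonneg w_sum Zk(3) qR mass osc by (intro exI[of _ K] exI[of _ w] exI[of _ q]) blast
  qed
  then show ?thesis unfolding S_def .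
qed

end
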